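(* Let $(\Gamma,\imath)$ be a computable group with a fixed computable regular symmetric F{\o}lner monotiling $([F_n,\mathcal{Z}_n])_{n\ge 1}$. Let $\Lambda$ be a finite alphabet, let $\mathrm{X}\subseteq\Lambda^{\Gamma}$ be a subshift, let $\mu$ be a $\Gamma$-invariant ergodic Borel probability measure on $\mathrm{X}$, and let $\mathbf{X}=(\mathrm{X},\mu,\Gamma)$ be the associated measure-preserving system. Then $$\widehat{\mathrm{K}}(\omega)=h(\mathbf{X})$$ for $\mu$-a.e. $\omega\in\mathrm{X}$, where $\widehat{\mathrm{K}}(\omega)$ is the asymptotic Kolmogorov complexity of $\omega$ along the sequence $(F_n)_{n\ge1}$ and $h(\mathbf{X})$ is the Kolmogorov-Sinai entropy of $\mathbf{X}$.
   Context: All groups are discrete and countably infinite; $\mathbb{N}=\{1,2,\dots\}$; $|\cdot|$ is cardinality; $\mathrm{e}$ is the identity of $\Gamma$; $A\triangle B$ is symmetric difference; $\log=\log_2$; $0\log 0=0$; $\mathbf{1}_A$ is the indicator function of $A$. Computability. An indexing of a set $X$ is an injective map $\imath:X\to\mathbb{N}$ with $\imath(X)$ a computable subset of $\mathbb{N}$. A map between (products of) indexed sets is computable if the induced map on indices is computable ($\mathbb{N}$ is indexed by the identity). A computable group is a pair $(\Gamma,\imath)$ of a group and an indexing such that multiplication $\Gamma\times\Gamma\to\Gamma$ is computable. A sequence $(G_n)_{n\ge1}$ of subsets of $\Gamma$ is computable if $(n,g)\mapsto\mathbf{1}_{G_n}(g)$ is computable on $\mathbb{N}\times\Gamma$. A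 sequence $(F_n)_{n\ge1}$ of finite subsets of $\Gamma$ is canonically computable if there is an algorithm which, given $n$, prints the finite set $\imath(F_n)$ and halts (equivalently, $n\mapsto\sum_{i\in\imath(F_n)}2^{i}$ is a total computable function). F{\o}lner sequences. A sequence $(F_n)_{n\ge1}$ of finite non-empty subsets of $\Gamma$ is a left (resp. right) F{\o}lner sequence if for every finite $K\subseteq\Gamma$ one has $|F_n\triangle KF_n|/|F_n|\to0$ (resp. $|F_n\triangle F_nK|/|F_n|\to 0$), with $K$ non-empty; it is two-sided if it is both. It is tempered if there is a constant $C$ with $|\bigcup_{i<j}F_i^{-1}F_j|<C|F_j|$ for all $j$. Monotilings. A left monotiling $[F,\mathcal{Z}]$ of $\Gamma$ is a finite set $F\subseteq\Gamma$ and a set $\mathcal{Z}\subseteq\Gamma$ such that $\{Fz:z\in\mathcal{Z}\}$ is a covering of $\Gamma$ by pairwise disjoint translates. A (left) F{\o}lner monotiling is a sequence $([F_n,\mathcal{Z}_n])_{n\ge1}$ of left monotilings with $(F_n)_{n\ge1}$ a left F{\o}lner sequence. It is symmetric if $\mathcal{Z}_k^{-1}=\mathcal{Z}_k$ for all $k$. It is regular if: (a) $(F_n)$ is a tempered two-sided F{\o}lner sequence; (b) for every $k$ the function $\mathbf{1}_{\mathcal{Z}_k}$ is a good weight for pointwise convergence of ergodic averages along $(F_n)$; (c) $|F_n|/\log n\to\infty$; (d) $\mathrm{e}\in F_n$ for every $n$. Here a function $c$ on $\Gamma$ is a good weight along $(F_n)$ if for every probability-measure-preserving system $(\mathrm{Y},\nu,\Gamma)$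 and every $f\in L^\infty(\mathrm{Y})$ the averages $\frac1{|F_n|}\sum_{g\in F_n}c(g)f(gy)$ converge as $n\to\infty$ for $\nu$-a.e. $y$. A F{\o}lner monotiling is computable if $(F_n)$ is a canonically computable sequence of finite sets and $(\mathcal{Z}_n)$ is a computable sequence of sets. Subshifts. For a finite alphabet $\Lambda$, $\Gamma$ acts on $\Lambda^\Gamma$ by $(g\cdot\omega)(x)=\omega(xg)$. A subshift is a closed $\Gamma$-invariant subset $\mathrm{X}\subseteq\Lambda^\Gamma$. Kolmogorov complexity. A decompressor is a partial computable function $A$ from finite binary words to finite words over $\Lambda$. For a finite $\Lambda$-word $w$ put $\mathrm{K}^0_A(w)=\inf\{l(p):A(p)=w\}$, where $l$ is length and $\inf\varnothing=\infty$. A decompressor $A^*$ is optimal if for every decompressor $A$ there is a constant $c$ with $\mathrm{K}^0_{A^*}(w)\le\mathrm{K}^0_A(w)+c$ for all $w$; optimal decompressors exist, and one such $A^*$ is fixed. For $\omega\in\Lambda^\Gamma$ and finite $F=\{x_1,\dots,x_m\}\subseteq\Gamma$ listed so that $\imath(x_1)<\dots<\imath(x_m)$, put $\overline{\mathrm{K}}(\omega|_F,F)=\frac1m\mathrm{K}^0_{A^*}(\omega(x_1)\omega(x_2)\cdots\omega(x_m))$. The asymptotic Kolmogorov complexity of $\omega$ along $(F_n)$ is $\widehat{\mathrm{K}}(\omega)=\limsup_{n\to\infty}\overline{\mathrm{K}}(\omega|_{F_n},F_n)$. Entropy. For a finite measurable partition $\alpha$ of $\mathrm{X}$, $h_\mu(\alpha)=-\sum_{A\in\alpha}\mu(A)\log\mu(A)$;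 for finite $F\subseteq\Gamma$, $\alpha^F=\bigvee_{g\in F}g^{-1}\alpha$; $h_\mu(\alpha,\Gamma)=\lim_{n}h_\mu(\alpha^{F_n})/|F_n|$ for a F{\o}lner sequence $(F_n)$ (the limit exists and does not depend on the F{\o}lner sequence); $h(\mathbf{X})=\sup_\alpha h_\mu(\alpha,\Gamma)$ over finite measurable partitions $\alpha$. *)

theory Defs
  imports
    "HOL-Probability.Probability"
    "HOL-Algebra.Group_Action"
    "HOL-Library.Nat_Bijection"
begin

section \<open>Computability\<close>

text \<open>
  Partial recursive functions, given by programs and a big-step semantics:
  \<open>rec_eval e xs y\<close> says that program \<open>e\<close> halts on the arguments \<open>xs\<close> with result \<open>y\<close>.
\<close>

datatype recf = Zero | Succ | Proj nat | Comp recf "recf list" | PrimRec recf recf | Mu recf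

inductive rec_eval :: "recf \<Rightarrow> nat list \<Rightarrow> nat \<Rightarrow> bool" where
  "rec_eval Zero xs 0"
| "rec_eval Succ (x # xs) (Suc x)"
| "i < length xs \<Longrightarrow> rec_eval (Proj i) xs (xs ! i)"
| "list_all2 (\<lambda>g y. rec_eval g xs y) gs ys \<Longrightarrow> rec_eval f ys z \<Longrightarrow> rec_eval (Comp f gs) xs z"
| "rec_eval f xs z \<Longrightarrow> rec_eval (PrimRec f g) (0 # xs) z"
| "rec_eval (PrimRec f g) (n # xs) y \<Longrightarrow> rec_eval g (n # y # xs) z
    \<Longrightarrow> rec_eval (PrimRec f g) (Suc n # xs) z"
| "rec_eval f (n # xs) 0 \<Longrightarrow> (\<forall>m<n. \<exists>y. rec_eval f (m # xs) (Suc y))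
    \<Longrightarrow> rec_eval (Mu f) xs n"

inductive_cases rec_evalE:
  "rec_eval Zero xs z" "rec_eval Succ xs z" "rec_eval (Proj i) xs z" "rec_eval (Comp f gs) xs z"
  "rec_eval (PrimRec f g) (0 # xs) z" "rec_eval (PrimRec f g) (Suc n # xs) z" "rec_eval (Mu f) xs z"

lemma rec_eval_deterministic:
  "rec_eval e xs y \<Longrightarrow> rec_eval e xs z \<Longrightarrow> y = z"
proof (induction arbitrary: z rule: rec_eval.induct)
  case (1 xs)
  from "1.prems" show ?case by (rule rec_evalE(1)) simp
next
  case (2 x xs)
  then show ?case by (rule rec_evalE(2)) simp
next
  case (3 i xs)
  from "3.prems" show ?case by (rule rec_evalE(3)) simp
next
  case (4 xs gs ys f v)
  from "4.prems" obtain ys' where ys': "list_all2 (\<lambda>g y. rec_eval g xs y) gs ys'" "rec_eval f ys' z"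
    by (rule rec_evalE(4))
  have "ys = ys'"
  proof (rule nth_equalityI)
    show "length ys = length ys'"
      using "4.IH"(1) ys'(1) by (simp add: list_all2_conv_all_nth)
    fix i assume "i < length ys"
    then show "ys ! i = ys' ! i"
      using "4.IH"(1) ys'(1) by (simp add: list_all2_conv_all_nth)
  qed
  then show ?case using "4.IH"(2) ys'(2) by simp
next
  case (5 f xs v g)
  from "5.prems" have "rec_eval f xs z" by (rule rec_evalE(5))
  then show ?case by (rule "5.IH")
next
  case (6 f g n xs y v)
  from "6.prems" obtain y' where "rec_eval (PrimRec f g) (n # xs) y'" "rec_eval g (n # y' # xs) z"
    by (rule rec_evalE(6))
  then show ?case using "6.IH" by simp
next
  case (7 f n xs)
  from "7.prems" have z: "rec_eval f (z # xs) 0" "\<forall>m<z. \<exists>y. rec_eval f (m # xs) (Suc y)"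
    by (rule rec_evalE(7), simp)+
  have "\<not> n < z" using z(2) "7.IH"(1) by (metis nat.distinct(1))
  moreover have "\<not> z < n" using z(1) "7.IH"(2) by (metis nat.distinct(1))
  ultimately show ?case by simp
qed

definition computable_nat_set :: "nat set \<Rightarrow> bool" where
  "computable_nat_set S \<longleftrightarrow> (\<exists>e. \<forall>n. rec_eval e [n] (of_bool (n \<in> S)))"

text \<open>
  Index \<open>0\<close> is excluded since the natural numbers start at \<open>1\<close>. For the same reason,
  sequences \<open>(a n)\<close>, \<open>n \<ge> 1\<close>, are functions on \<^typ>\<open>nat\<close> whose value at \<open>0\<close> is ignored.
\<close>

definition indexing :: "'x set \<Rightarrow> ('x \<Rightarrow> nat) \<Rightarrow> bool" where
  "indexing X \<iota> \<longleftrightarrow> inj_on \<iota> X \<and> 0 \<notin> \<iota> ` X \<and> computable_nat_set (\<iota> ` X)"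

definition computable_group :: "('g, 'b) monoid_scheme \<Rightarrow> ('g \<Rightarrow> nat) \<Rightarrow> bool" where
  "computable_group G \<iota> \<longleftrightarrow> group G \<and> indexing (carrier G) \<iota> \<and>
     (\<exists>e. \<forall>g\<in>carrier G. \<forall>h\<in>carrier G. rec_eval e [\<iota> g, \<iota> h] (\<iota> (g \<otimes>\<^bsub>G\<^esub> h)))"

definition computable_set_seq ::
    "('g, 'b) monoid_scheme \<Rightarrow> ('g \<Rightarrow> nat) \<Rightarrow> (nat \<Rightarrow> 'g set) \<Rightarrow> bool" where
  "computable_set_seq G \<iota> S \<longleftrightarrow>
     (\<exists>e. \<forall>n\<ge>1. \<forall>g\<in>carrier G. rec_eval e [n, \<iota> g] (of_bool (g \<in> S n)))"

text \<open>\<^const>\<open>set_encode\<close> maps a finite set \<open>I\<close> to the sum of \<open>2 ^ i\<close> over \<open>i \<in> I\<close>.\<close>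

definition canonically_computable :: "('g \<Rightarrow> nat) \<Rightarrow> (nat \<Rightarrow> 'g set) \<Rightarrow> bool" where
  "canonically_computable \<iota> F \<longleftrightarrow> (\<exists>e. \<forall>n\<ge>1. rec_eval e [n] (set_encode (\<iota> ` F n)))"


section \<open>Foelner sequences\<close>

definition left_folner :: "('g, 'b) monoid_scheme \<Rightarrow> (nat \<Rightarrow> 'g set) \<Rightarrow> bool" where
  "left_folner G F \<longleftrightarrow>
     (\<forall>n\<ge>1. finite (F n) \<and> F n \<noteq> {} \<and> F n \<subseteq> carrier G) \<and>
     (\<forall>K. finite K \<and> K \<noteq> {} \<and> K \<subseteq> carrier G \<longrightarrow>
        (\<lambda>n. real (card (sym_diff (F n) (K <#>\<^bsub>G\<^esub> F n))) / real (card (F n))) \<longlonglongrightarrow> 0)"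

definition right_folner :: "('g, 'b) monoid_scheme \<Rightarrow> (nat \<Rightarrow> 'g set) \<Rightarrow> bool" where
  "right_folner G F \<longleftrightarrow>
     (\<forall>n\<ge>1. finite (F n) \<and> F n \<noteq> {} \<and> F n \<subseteq> carrier G) \<and>
     (\<forall>K. finite K \<and> K \<noteq> {} \<and> K \<subseteq> carrier G \<longrightarrow>
        (\<lambda>n. real (card (sym_diff (F n) (F n <#>\<^bsub>G\<^esub> K))) / real (card (F n))) \<longlonglongrightarrow> 0)"

definition tempered :: "('g, 'b) monoid_scheme \<Rightarrow> (nat \<Rightarrow> 'g set) \<Rightarrow> bool" where
  "tempered G F \<longleftrightarrow> (\<exists>C::real. \<forall>j\<ge>1.
     real (card (\<Union>i\<in>{1..<j}. (set_inv\<^bsub>G\<^esub> (F i)) <#>\<^bsub>G\<^esub> F j)) < C * real (card (F j)))"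


section \<open>Measure-preserving systems and good weights\<close>

definition pmp_system ::
    "('g, 'b) monoid_scheme \<Rightarrow> 'y measure \<Rightarrow> ('g \<Rightarrow> 'y \<Rightarrow> 'y) \<Rightarrow> bool" where
  "pmp_system G M act \<longleftrightarrow> prob_space M \<and> group_action G (space M) act \<and>
     (\<forall>g\<in>carrier G. act g \<in> measurable M M \<and> distr M M (act g) = M)"

definition ergodic_action ::
    "('g, 'b) monoid_scheme \<Rightarrow> 'y measure \<Rightarrow> ('g \<Rightarrow> 'y \<Rightarrow> 'y) \<Rightarrow> bool" where
  "ergodic_action G M act \<longleftrightarrow>
     (\<forall>A\<in>sets M. (\<forall>g\<in>carrier G. act g -` A \<inter> space M = A) \<longrightarrow>
        measure M A = 0 \<or> measure M A = 1)"

definition good_weight_for ::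
    "('g, 'b) monoid_scheme \<Rightarrow> (nat \<Rightarrow> 'g set) \<Rightarrow> ('g \<Rightarrow> real) \<Rightarrow>
     'y measure \<Rightarrow> ('g \<Rightarrow> 'y \<Rightarrow> 'y) \<Rightarrow> bool" where
  "good_weight_for G F c M act \<longleftrightarrow>
     (\<forall>f \<in> borel_measurable M. (\<exists>B::real. AE y in M. \<bar>f y\<bar> \<le> B) \<longrightarrow>
        (AE y in M. convergent (\<lambda>n. (\<Sum>g\<in>F n. c g * f (act g y)) / real (card (F n)))))"

text \<open>
  A formula cannot quantify over the type of the points of a system, so a good weight is defined
  through systems whose points are of the type \<^typ>\<open>'g \<Rightarrow> real\<close>. Lemma \<open>good_weight_all_systems\<close>
  below shows that this entails the defining property for systems on every type.
\<close>

definition good_weight ::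
    "('g, 'b) monoid_scheme \<Rightarrow> (nat \<Rightarrow> 'g set) \<Rightarrow> ('g \<Rightarrow> real) \<Rightarrow> bool" where
  "good_weight G F c \<longleftrightarrow>
     (\<forall>(M :: ('g \<Rightarrow> real) measure) act. pmp_system G M act \<longrightarrow> good_weight_for G F c M act)"


section \<open>Monotilings\<close>

definition left_monotiling :: "('g, 'b) monoid_scheme \<Rightarrow> 'g set \<Rightarrow> 'g set \<Rightarrow> bool" where
  "left_monotiling G T Z \<longleftrightarrow> finite T \<and> T \<subseteq> carrier G \<and> Z \<subseteq> carrier G \<and>
     (\<Union>z\<in>Z. T #>\<^bsub>G\<^esub> z) = carrier G \<and> disjoint_family_on (\<lambda>z. T #>\<^bsub>G\<^esub> z) Z"

definition folner_monotiling ::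
    "('g, 'b) monoid_scheme \<Rightarrow> (nat \<Rightarrow> 'g set) \<Rightarrow> (nat \<Rightarrow> 'g set) \<Rightarrow> bool" where
  "folner_monotiling G F Z \<longleftrightarrow> (\<forall>n\<ge>1. left_monotiling G (F n) (Z n)) \<and> left_folner G F"

definition symmetric_monotiling ::
    "('g, 'b) monoid_scheme \<Rightarrow> (nat \<Rightarrow> 'g set) \<Rightarrow> bool" where
  "symmetric_monotiling G Z \<longleftrightarrow> (\<forall>k\<ge>1. set_inv\<^bsub>G\<^esub> (Z k) = Z k)"

definition regular_monotiling ::
    "('g, 'b) monoid_scheme \<Rightarrow> (nat \<Rightarrow> 'g set) \<Rightarrow> (nat \<Rightarrow> 'g set) \<Rightarrow> bool" where
  "regular_monotiling G F Z \<longleftrightarrow>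
     tempered G F \<and> left_folner G F \<and> right_folner G F \<and>
     (\<forall>k\<ge>1. good_weight G F (indicator (Z k))) \<and>
     filterlim (\<lambda>n. real (card (F n)) / log 2 (real n)) at_top sequentially \<and>
     (\<forall>n\<ge>1. \<one>\<^bsub>G\<^esub> \<in> F n)"

definition computable_monotiling ::
    "('g, 'b) monoid_scheme \<Rightarrow> ('g \<Rightarrow> nat) \<Rightarrow> (nat \<Rightarrow> 'g set) \<Rightarrow> (nat \<Rightarrow> 'g set) \<Rightarrow> bool" where
  "computable_monotiling G \<iota> F Z \<longleftrightarrow> canonically_computable \<iota> F \<and> computable_set_seq G \<iota> Z"


section \<open>Subshifts\<close>

definition full_shift :: "('g, 'b) monoid_scheme \<Rightarrow> 'l set \<Rightarrow> ('g \<Rightarrow> 'l) topology" where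
  "full_shift G \<Lambda> = product_topology (\<lambda>_. discrete_topology \<Lambda>) (carrier G)"

text \<open>The action is restricted to \<open>X\<close> because \<^const>\<open>group_action\<close> needs extensional maps.\<close>

definition shift_action :: "('g, 'b) monoid_scheme \<Rightarrow> ('g \<Rightarrow> 'l) set \<Rightarrow> 'g \<Rightarrow> ('g \<Rightarrow> 'l) \<Rightarrow> ('g \<Rightarrow> 'l)" where
  "shift_action G X g = (\<lambda>\<omega>\<in>X. \<lambda>x\<in>carrier G. \<omega> (x \<otimes>\<^bsub>G\<^esub> g))"

definition subshift :: "('g, 'b) monoid_scheme \<Rightarrow> 'l set \<Rightarrow> ('g \<Rightarrow> 'l) set \<Rightarrow> bool" where
  "subshift G \<Lambda> X \<longleftrightarrow> closedin (full_shift G \<Lambda>) X \<and> (\<forall>g\<in>carrier G. shift_action G X g ` X \<subseteq> X)"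

definition borel_of :: "'x topology \<Rightarrow> 'x measure" where
  "borel_of T = sigma (topspace T) {U. openin T U}"

lemma group_action_shift:
  assumes "group G" "X \<subseteq> extensional (carrier G)" "\<And>g. g \<in> carrier G \<Longrightarrow> shift_action G X g ` X \<subseteq> X"
  shows "group_action G X (shift_action G X)"
proof -
  interpret group G by fact
  have ext: "shift_action G X g \<in> extensional X" for g
    by (simp add: shift_action_def)
  have inX: "shift_action G X g \<omega> \<in> X" if "g \<in> carrier G" "\<omega> \<in> X" for g \<omega>
    using assms(3) that by blast
  have comp: "shift_action G X (g \<otimes>\<^bsub>G\<^esub> h) \<omega> = shift_action G X g (shift_action G X h \<omega>)"
    if "g \<in> carrier G" "h \<in> carrier G" "\<omega> \<in> X" for g h \<omega>
    using that inX[of h \<omega>] by (auto simp: shift_action_def m_assoc restrict_def fun_eq_iff)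
  have one: "shift_action G X \<one>\<^bsub>G\<^esub> \<omega> = \<omega>" if "\<omega> \<in> X" for \<omega>
    using that assms(2) by (auto simp: shift_action_def restrict_def fun_eq_iff extensional_def subset_iff)
  have bij: "shift_action G X g \<in> Bij X" if g: "g \<in> carrier G" for g
  proof -
    have "bij_betw (shift_action G X g) X X"
    proof (rule bij_betw_byWitness[where f' = "shift_action G X (inv\<^bsub>G\<^esub> g)"])
      show "\<forall>a\<in>X. shift_action G X (inv\<^bsub>G\<^esub> g) (shift_action G X g a) = a"
        using g one comp[of "inv\<^bsub>G\<^esub> g" g] by auto
      show "\<forall>a\<in>X. shift_action G X g (shift_action G X (inv\<^bsub>G\<^esub> g) a) = a"
        using g one comp[of g "inv\<^bsub>G\<^esub> g"] by auto
    qed (use g assms(3) in auto)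
    then show ?thesis using ext by (simp add: Bij_def)
  qed
  have "shift_action G X (g \<otimes>\<^bsub>G\<^esub> h) = compose X (shift_action G X g) (shift_action G X h)"
    if "g \<in> carrier G" "h \<in> carrier G" for g h
    by (rule extensionalityI[of _ X]) (use that comp ext in \<open>auto simp: compose_def\<close>)
  then have "shift_action G X \<in> hom G (BijGroup X)"
    using bij by (auto simp: hom_def BijGroup_def)
  then show ?thesis
    using group_BijGroup[of X] assms(1)
    by (simp add: group_action_def group_hom_def group_hom_axioms_def)
qed

lemma good_weight_all_systems:
  fixes G :: "('g, 'b) monoid_scheme" and M :: "'y measure"
  assumes good: "good_weight G F c" and sys: "pmp_system G M act"
    and F: "\<And>n. n \<ge> 1 \<Longrightarrow> F n \<subseteq> carrier G"
  shows "good_weight_for G F c M act"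
  unfolding good_weight_for_def
proof (intro ballI impI)
  fix f :: "'y \<Rightarrow> real"
  assume f[measurable]: "f \<in> borel_measurable M" and "\<exists>B. AE y in M. \<bar>f y\<bar> \<le> B"
  then obtain B where B: "AE y in M. \<bar>f y\<bar> \<le> B" by blast
  have ps: "prob_space M" and ga: "group_action G (space M) act"
    and act: "\<And>g. g \<in> carrier G \<Longrightarrow> act g \<in> measurable M M"
    and inva: "\<And>g. g \<in> carrier G \<Longrightarrow> distr M M (act g) = M"
    using sys by (auto simp: pmp_system_def)
  interpret ga: group_action G "space M" act by fact
  interpret group G using ga.group_hom by (rule group_hom.axioms(1))
  define P :: "('g \<Rightarrow> real) measure" where "P = PiM (carrier G) (\<lambda>_. borel)"
  define X :: "('g \<Rightarrow> real) set" where "X = space P"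
  have X: "X = extensional (carrier G)"
    by (simp add: X_def P_def space_PiM PiE_def)
  define \<Phi> where "\<Phi> = (\<lambda>y. \<lambda>g\<in>carrier G. f (act g y))"
  have \<Phi>: "\<Phi> \<in> measurable M P"
    unfolding \<Phi>_def P_def by (intro measurable_restrict measurable_compose[OF act f])
  define N where "N = distr M P \<Phi>"
  have sN: "space N = X" "sets N = sets P" by (simp_all add: N_def X_def)
  have sh: "shift_action G X g \<in> measurable P P" if g: "g \<in> carrier G" for g
  proof -
    have "(\<lambda>\<omega>. \<lambda>x\<in>carrier G. \<omega> (x \<otimes>\<^bsub>G\<^esub> g)) \<in> measurable P P"
      unfolding P_def using g by (intro measurable_restrict measurable_component_singleton) auto
    then show ?thesis
      by (rule measurable_cong[THEN iffD1, rotated]) (simp add: shift_action_def X_def)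
  qed
  have \<Phi>X: "\<Phi> y \<in> X" for y by (simp add: X \<Phi>_def)
  have equi: "shift_action G X g (\<Phi> y) = \<Phi> (act g y)" if "g \<in> carrier G" "y \<in> space M" for g y
    using that \<Phi>X[of y] ga.composition_rule[of y _ g]
    by (auto simp: shift_action_def \<Phi>_def fun_eq_iff)
  have "pmp_system G N (shift_action G X)"
    unfolding pmp_system_def
  proof (intro conjI ballI)
    show "prob_space N"
      unfolding N_def using ps \<Phi> by (rule prob_space.prob_space_distr)
    show "group_action G (space N) (shift_action G X)"
      unfolding sN using X by (intro group_action_shift is_group) (auto simp: shift_action_def)
    fix g assume g: "g \<in> carrier G"
    show "shift_action G X g \<in> measurable N N"
      using sh[OF g] by (simp add: N_def)
    have "distr N N (shift_action G X g) = distr (distr M P \<Phi>) P (shift_action G X g)"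
      by (rule distr_cong) (simp_all add: N_def)
    also have "\<dots> = distr M P (shift_action G X g \<circ> \<Phi>)"
      by (rule distr_distr[OF sh[OF g] \<Phi>])
    also have "\<dots> = distr M P (\<Phi> \<circ> act g)"
      by (rule distr_cong) (auto simp: equi g)
    also have "\<dots> = distr (distr M M (act g)) P \<Phi>"
      by (rule distr_distr[OF \<Phi> act[OF g], symmetric])
    also have "\<dots> = N"
      by (simp add: inva[OF g] N_def)
    finally show "distr N N (shift_action G X g) = N" .
  qed
  then have gw: "good_weight_for G F c N (shift_action G X)"
    using good by (simp add: good_weight_def)
  have ev: "(\<lambda>\<omega>. \<omega> \<one>\<^bsub>G\<^esub>) \<in> borel_measurable P"
    unfolding P_def by (rule measurable_component_singleton) simp
  have \<Phi>1: "\<Phi> y \<one>\<^bsub>G\<^esub> = f y" if "y \<in> space M" for y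
    using that ga.id_eq_one by (simp add: \<Phi>_def) (metis restrict_apply')
  have "AE y in M. \<bar>\<Phi> y \<one>\<^bsub>G\<^esub>\<bar> \<le> B"
    using B AE_space by eventually_elim (simp add: \<Phi>1)
  then have "AE \<omega> in N. \<bar>\<omega> \<one>\<^bsub>G\<^esub>\<bar> \<le> B"
    unfolding N_def using \<Phi> ev by (subst AE_distr_iff) auto
  moreover have "(\<lambda>\<omega>. \<omega> \<one>\<^bsub>G\<^esub>) \<in> borel_measurable N"
    using ev by (simp add: N_def)
  ultimately have "AE \<omega> in N. convergent
      (\<lambda>n. (\<Sum>g\<in>F n. c g * (shift_action G X g \<omega>) \<one>\<^bsub>G\<^esub>) / real (card (F n)))"
    using gw[unfolded good_weight_for_def, rule_format, of "\<lambda>\<omega>. \<omega> \<one>\<^bsub>G\<^esub>"] by blast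
  then have "AE y in M. convergent
      (\<lambda>n. (\<Sum>g\<in>F n. c g * (shift_action G X g (\<Phi> y)) \<one>\<^bsub>G\<^esub>) / real (card (F n)))"
    unfolding N_def by (rule AE_distrD[OF \<Phi>])
  then show "AE y in M. convergent (\<lambda>n. (\<Sum>g\<in>F n. c g * f (act g y)) / real (card (F n)))"
    using AE_space
  proof eventually_elim
    case (elim y)
    have "(\<Sum>g\<in>F (Suc n). c g * (shift_action G X g (\<Phi> y)) \<one>\<^bsub>G\<^esub>) = (\<Sum>g\<in>F (Suc n). c g * f (act g y))" for n
    proof (rule sum.cong)
      fix g assume "g \<in> F (Suc n)"
      then have "g \<in> carrier G" using F[of "Suc n"] by auto
      then show "c g * (shift_action G X g (\<Phi> y)) \<one>\<^bsub>G\<^esub> = c g * f (act g y)"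
        using \<Phi>X[of y] by (simp add: shift_action_def \<Phi>_def)
    qed simp
    then show ?case
      using elim(1)
      by (subst convergent_Suc_iff[symmetric]) (subst (asm) convergent_Suc_iff[symmetric], simp)
  qed
qed


section \<open>Kolmogorov complexity\<close>

text \<open>
  Partial functions on words are read as partial functions on codes, by \<^const>\<open>list_encode\<close>.
  The alphabet enters through an indexing \<open>\<kappa>\<close>; since it is finite, the choice does not matter.
\<close>

definition decompressor ::
    "'l set \<Rightarrow> ('l \<Rightarrow> nat) \<Rightarrow> (bool list \<Rightarrow> 'l list option) \<Rightarrow> bool" where
  "decompressor \<Lambda> \<kappa> A \<longleftrightarrow>
     (\<forall>p w. A p = Some w \<longrightarrow> w \<in> lists \<Lambda>) \<and>
     (\<exists>e. \<forall>p y. rec_eval e [list_encode (map of_bool p)] y \<longleftrightarrow>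
                (\<exists>w. A p = Some w \<and> y = list_encode (map \<kappa> w)))"

definition K0 :: "(bool list \<Rightarrow> 'l list option) \<Rightarrow> 'l list \<Rightarrow> enat" where
  "K0 A w = (INF p\<in>{p. A p = Some w}. enat (length p))"

definition optimal_decompressor ::
    "'l set \<Rightarrow> ('l \<Rightarrow> nat) \<Rightarrow> (bool list \<Rightarrow> 'l list option) \<Rightarrow> bool" where
  "optimal_decompressor \<Lambda> \<kappa> A \<longleftrightarrow> decompressor \<Lambda> \<kappa> A \<and>
     (\<forall>B. decompressor \<Lambda> \<kappa> B \<longrightarrow> (\<exists>c::nat. \<forall>w\<in>lists \<Lambda>. K0 A w \<le> K0 B w + enat c))"

definition mean_complexity ::
    "('g \<Rightarrow> nat) \<Rightarrow> (bool list \<Rightarrow> 'l list option) \<Rightarrow> ('g \<Rightarrow> 'l) \<Rightarrow> 'g set \<Rightarrow> ereal" where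
  "mean_complexity \<iota> A \<omega> T =
     ereal_of_enat (K0 A (map \<omega> (sorted_key_list_of_set \<iota> T))) / ereal (real (card T))"

definition asymptotic_complexity ::
    "('g \<Rightarrow> nat) \<Rightarrow> (bool list \<Rightarrow> 'l list option) \<Rightarrow> (nat \<Rightarrow> 'g set) \<Rightarrow> ('g \<Rightarrow> 'l) \<Rightarrow> ereal" where
  "asymptotic_complexity \<iota> A F \<omega> = limsup (\<lambda>n. mean_complexity \<iota> A \<omega> (F n))"


section \<open>Kolmogorov-Sinai entropy\<close>

definition finite_measurable_partition :: "'y measure \<Rightarrow> 'y set set \<Rightarrow> bool" where
  "finite_measurable_partition M \<alpha> \<longleftrightarrow> finite \<alpha> \<and> \<alpha> \<subseteq> sets M \<and> partition_on (space M) \<alpha>"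

definition partition_entropy :: "'y measure \<Rightarrow> 'y set set \<Rightarrow> real" where
  "partition_entropy M \<alpha> = - (\<Sum>A\<in>\<alpha>. measure M A * log 2 (measure M A))"

definition refined_partition ::
    "'y measure \<Rightarrow> ('g \<Rightarrow> 'y \<Rightarrow> 'y) \<Rightarrow> 'y set set \<Rightarrow> 'g set \<Rightarrow> 'y set set" where
  "refined_partition M act \<alpha> T =
     common_refinement ((\<lambda>g. (\<lambda>A. act g -` A \<inter> space M) ` \<alpha>) ` T)"

text \<open>
  The limit does not depend on the (left) Foelner sequence \<open>F\<close>, which is therefore just a parameter.
\<close>

definition entropy_rate ::
    "'y measure \<Rightarrow> ('g \<Rightarrow> 'y \<Rightarrow> 'y) \<Rightarrow> (nat \<Rightarrow> 'g set) \<Rightarrow> 'y set set \<Rightarrow> real" where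
  "entropy_rate M act F \<alpha> =
     lim (\<lambda>n. partition_entropy M (refined_partition M act \<alpha> (F n)) / real (card (F n)))"

definition KS_entropy ::
    "'y measure \<Rightarrow> ('g \<Rightarrow> 'y \<Rightarrow> 'y) \<Rightarrow> (nat \<Rightarrow> 'g set) \<Rightarrow> ereal" where
  "KS_entropy M act F =
     (SUP \<alpha>\<in>{\<alpha>. finite_measurable_partition M \<alpha>}. ereal (entropy_rate M act F \<alpha>))"

end

theory Submission
  imports Defs
begin

text \<open>
  Upper bound: for fixed \<open>k\<close>, a word on \<open>F n\<close> is described by its patterns on the tiles \<open>F k z\<close>
  inside \<open>F n\<close>, coded with Shannon's code lengths for the distribution of \<open>\<omega>\<close> on \<open>F k\<close>, and by
  its letters on the few uncovered sites. The code length is a computable function of the word and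
  satisfies Kraft's inequality, so it bounds the complexity, up to \<open>O(log n)\<close>, by numbering the words
  of equal cost. Because the indicator of \<open>Z k\<close> is a good weight, the normalised code length
  converges almost everywhere, to a function whose mean is at most \<open>(H(F k) + 2) / |F k|\<close>.

  Lower bound: there are at most \<open>2 ^ (m + 1)\<close> words of complexity at most \<open>m\<close>. If \<open>\<omega>\<close> had
  complexity below \<open>e < h\<close> along a tail of \<open>F\<close> with positive probability, then by ergodicity finitely
  many translates of this event would have probability almost one. As \<open>F\<close> is a right Foelner
  sequence, a translation changes few sites of \<open>F n\<close>, so the distribution on \<open>F n\<close> would be
  concentrated on too few words to have entropy rate \<open>h\<close>. This replaces the
  Shannon-McMillan-Breiman theorem.

  The complexity is thus at least \<open>h\<close> almost everywhere, and bounded by functions whose means tend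
  to \<open>h\<close>; hence it equals \<open>h\<close>.
\<close>

section \<open>Computable functions\<close>

text \<open>The measure \<open>\<mu>\<close> need not be computable: for fixed \<open>k\<close> it
  enters the program only through the code lengths of the finitely many patterns on
  \<open>F k\<close>, a table that can be hardwired. The decompressor is not told \<open>n\<close>,
  so \<open>n\<close> is part of the description; this is the \<open>O(log n)\<close>, absorbed
  because \<open>card (F n) / log 2 n\<close> tends to infinity.

  The pattern of \<open>\<omega>\<close> on the tile \<open>F k #> z\<close> is the pattern of
  \<open>z \<omega>\<close> on \<open>F k\<close>, so the code length of the tiles is an ergodic sum
  weighted by the indicator of \<open>Z k\<close>. A good weight provides a limit but says nothing
  about its value, and the limit may depend on the point. Hence only its mean is estimated, and the
  two bounds are joined through means.

  Complexity along \<open>F\<close> is not obviously shift invariant, so ergodicity is applied to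
  the union of all translates of an event of low complexity. That event demands low complexity at
  every \<open>n \<ge> N\<close>, so that one \<open>n\<close> serves finitely many translates at
  once.\<close>

definition computable :: "nat \<Rightarrow> (nat list \<Rightarrow> nat) \<Rightarrow> bool" where
  "computable k f \<longleftrightarrow> (\<exists>e. \<forall>xs. length xs = k \<longrightarrow> rec_eval e xs (f xs))"

lemma computableI:
  assumes "\<And>xs. length xs = k \<Longrightarrow> rec_eval e xs (f xs)"
  shows "computable k f"
  using assms by (auto simp: computable_def)

lemma computable_cong:
  assumes "\<And>xs. length xs = k \<Longrightarrow> f xs = g xs"
  shows "computable k f \<longleftrightarrow> computable k g"
  using assms by (auto simp: computable_def)

lemma computable_nth: "i < k \<Longrightarrow> computable k (\<lambda>xs. xs ! i)"
  by (rule computableI[where e = "Proj i"]) (auto intro: rec_eval.intros)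

text \<open>\<open>e\<close> only has to halt on the values that actually occur. This serves the
  programs for \<open>G\<close>, \<open>F\<close> and \<open>Z\<close>, which may diverge on numbers
  that are not indices or at the sequence index \<open>0\<close>.\<close>

lemma computable_partial_comp:
  assumes "\<forall>g\<in>set gs. computable k g"
    and "\<And>xs. length xs = k \<Longrightarrow> rec_eval e (map (\<lambda>g. g xs) gs) (f xs)"
  shows "computable k f"
proof -
  obtain c where c: "\<And>g xs. g \<in> set gs \<Longrightarrow> length xs = k \<Longrightarrow> rec_eval (c g) xs (g xs)"
    using assms(1) unfolding computable_def by metis
  show ?thesis
  proof (rule computableI[where e = "Comp e (map c gs)"])
    fix xs :: "nat list" assume xs: "length xs = k"
    have "list_all2 (\<lambda>g y. rec_eval g xs y) (map c gs) (map (\<lambda>g. g xs) gs)"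
      using c xs by (simp add: list_all2_map1 list_all2_map2 list_all2_same)
    then show "rec_eval (Comp e (map c gs)) xs (f xs)"
      using assms(2)[OF xs] by (rule rec_eval.intros(4))
  qed
qed

lemma computable_comp:
  assumes "computable m f" "length gs = m" "\<forall>g\<in>set gs. computable k g"
  shows "computable k (\<lambda>xs. f (map (\<lambda>g. g xs) gs))"
proof -
  obtain e where "\<And>xs. length xs = m \<Longrightarrow> rec_eval e xs (f xs)"
    using assms(1) by (auto simp: computable_def)
  then show ?thesis using assms(2) by (intro computable_partial_comp[OF assms(3), of e]) simp
qed

lemma computable_comp1:
  assumes "computable 1 f" "computable k g"
  shows "computable k (\<lambda>xs. f [g xs])"
  using computable_comp[OF assms(1), of "[g]"] assms(2) by simp

lemma computable_comp2:
  assumes "computable 2 f" "computable k g" "computable k h"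
  shows "computable k (\<lambda>xs. f [g xs, h xs])"
  using computable_comp[OF assms(1), of "[g, h]"] assms(2,3) by simp

lemma computable_Suc: "computable k f \<Longrightarrow> computable k (\<lambda>xs. Suc (f xs))"
proof -
  have "computable 1 (\<lambda>xs. Suc (xs ! 0))"
    by (rule computableI[where e = Succ]) (auto simp: length_Suc_conv intro: rec_eval.intros)
  then show "computable k f \<Longrightarrow> ?thesis" using computable_comp1 by fastforce
qed

lemma computable_const: "computable k (\<lambda>_. c)"
proof (induction c)
  case 0
  show ?case by (rule computableI[where e = Zero]) (auto intro: rec_eval.intros)
qed (rule computable_Suc)

lemma computable_rec:
  assumes "computable k a" "computable k b" "computable (Suc (Suc k)) g"
  shows "computable k (\<lambda>xs. rec_nat (a xs) (\<lambda>n y. g (n # y # xs)) (b xs))"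
proof -
  obtain e where e: "\<And>xs. length xs = k \<Longrightarrow> rec_eval e xs (a xs)"
    using assms(1) by (auto simp: computable_def)
  obtain d where d: "\<And>xs. length xs = Suc (Suc k) \<Longrightarrow> rec_eval d xs (g xs)"
    using assms(3) by (auto simp: computable_def)
  have *: "rec_eval (PrimRec e d) (m # xs) (rec_nat (a xs) (\<lambda>n y. g (n # y # xs)) m)"
    if "length xs = k" for m xs
    by (induction m) (use e d that in \<open>auto intro: rec_eval.intros\<close>)
  have "computable (Suc k) (\<lambda>zs. rec_nat (a (tl zs)) (\<lambda>n y. g (n # y # tl zs)) (zs ! 0))"
    by (rule computableI[where e = "PrimRec e d"]) (use * in \<open>auto simp: length_Suc_conv\<close>)
  \<comment> \<open>\<open>PrimRec\<close> recurses on its first argument; feeding it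
    \<open>b xs\<close> followed by all projections gives a recursion up to \<open>b xs\<close> with
    \<open>xs\<close> as parameters.\<close>
  from computable_comp[OF this, of "b # map (\<lambda>i xs. xs ! i) [0..<k]" k]
  have "computable k (\<lambda>xs. rec_nat (a (map (\<lambda>i. xs ! i) [0..<k]))
      (\<lambda>n y. g (n # y # map (\<lambda>i. xs ! i) [0..<k])) (b xs))"
    using assms(2) by (simp add: comp_def computable_nth)
  then show ?thesis
    by (rule computable_cong[THEN iffD1, rotated]) (metis map_nth)
qed

lemma computable_weaken1:
  assumes "computable k f" shows "computable (Suc k) (\<lambda>xs. f (tl xs))"
proof -
  have "computable (Suc k) (\<lambda>xs. f (map (\<lambda>g. g xs) (map (\<lambda>i xs. xs ! Suc i) [0..<k])))"
    by (rule computable_comp[OF assms]) (auto intro: computable_nth)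
  then show ?thesis
  proof (rule computable_cong[THEN iffD1, rotated])
    fix xs :: "nat list" assume "length xs = Suc k"
    then have "map (\<lambda>g. g xs) (map (\<lambda>i xs. xs ! Suc i) [0..<k]) = tl xs"
      by (intro nth_equalityI) (auto simp: nth_tl)
    then show "f (map (\<lambda>g. g xs) (map (\<lambda>i xs. xs ! Suc i) [0..<k])) = f (tl xs)" by simp
  qed
qed

lemma computable_add:
  assumes "computable k f" "computable k g"
  shows "computable k (\<lambda>xs. f xs + g xs)"
proof -
  have "rec_nat a (\<lambda>n y. Suc y) b = a + b" for a b :: nat by (induction b) auto
  then show ?thesis
    using computable_rec[OF assms computable_Suc[OF computable_nth[of 1]]] by simp
qed

text \<open>Bounded quantifiers, division, decoding of pairs and counting are all reduced to this
  rule by writing them as finite sums.\<close>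

lemma computable_sum:
  assumes "computable (Suc k) g" "computable k b"
  shows "computable k (\<lambda>xs. \<Sum>i<b xs. g (i # xs))"
proof -
  have *: "rec_nat 0 (\<lambda>n y. y + g (n # xs)) m = (\<Sum>i<m. g (i # xs))" for m xs
    by (induction m) auto
  \<comment> \<open>The recursion hands \<open>n # y # xs\<close> to its body, whereas
    \<open>g\<close> expects \<open>n # xs\<close>; the projections skip the accumulator
    \<open>y\<close>.\<close>
  have "computable (Suc (Suc k)) (\<lambda>ys. g (map (\<lambda>h. h ys) ((\<lambda>ys. ys ! 0) # map (\<lambda>i ys. ys ! Suc (Suc i)) [0..<k])))"
    by (rule computable_comp[OF assms(1)]) (auto intro: computable_nth)
  then have "computable (Suc (Suc k)) (\<lambda>ys. ys ! 1 + g (ys ! 0 # drop 2 ys))"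
  proof (intro computable_add computable_nth, goal_cases)
    case 2
    then show ?case
    proof (rule computable_cong[THEN iffD1, rotated])
      fix ys :: "nat list" assume "length ys = Suc (Suc k)"
      then have "map (\<lambda>h. h ys) ((\<lambda>ys. ys ! 0) # map (\<lambda>i ys. ys ! Suc (Suc i)) [0..<k]) = ys ! 0 # drop 2 ys"
        by (auto intro: nth_equalityI)
      then show "g (map (\<lambda>h. h ys) ((\<lambda>ys. ys ! 0) # map (\<lambda>i ys. ys ! Suc (Suc i)) [0..<k])) =
          g (ys ! 0 # drop 2 ys)" by simp
    qed
  qed simp
  from computable_rec[OF computable_const[of k 0] assms(2) this] show ?thesis by (simp add: *)
qed

lemma computable_mult:
  assumes "computable k f" "computable k g"
  shows "computable k (\<lambda>xs. f xs * g xs)"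
  using computable_sum[OF computable_weaken1[OF assms(2)] assms(1)] by simp

lemma computable_power:
  assumes "computable k f" "computable k g"
  shows "computable k (\<lambda>xs. f xs ^ g xs)"
proof -
  have *: "rec_nat 1 (\<lambda>n y. y * a) b = a ^ b" for a b :: nat by (induction b) auto
  have "computable (Suc (Suc k)) (\<lambda>ys. ys ! 1 * f (tl (tl ys)))"
    by (intro computable_mult computable_nth computable_weaken1[OF computable_weaken1[OF assms(1)]]) simp
  from computable_rec[OF computable_const[of k 1] assms(2) this] show ?thesis by (simp add: *[unfolded One_nat_def])
qed

lemma computable_diff:
  assumes "computable k f" "computable k g"
  shows "computable k (\<lambda>xs. f xs - g xs)"
proof -
  have pre: "rec_nat 0 (\<lambda>n y. n) b = b - 1" for b :: nat by (cases b) auto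
  have "computable (Suc (Suc k)) (\<lambda>ys. ys ! 1 - 1)"
    using computable_rec[OF computable_const[of _ 0] computable_nth[of 1 "Suc (Suc k)"] computable_nth[of 0 "Suc (Suc (Suc (Suc k)))"]]
    by (simp add: pre)
  moreover have "rec_nat a (\<lambda>n y. y - 1) b = a - b" for a b :: nat by (induction b) auto
  ultimately show ?thesis
    using computable_rec[OF assms, of "\<lambda>ys. ys ! 1 - 1"] by simp
qed

lemma computable_le:
  assumes "computable k f" "computable k g"
  shows "computable k (\<lambda>xs. of_bool (f xs \<le> g xs))"
proof -
  have "computable k (\<lambda>xs. 1 - (f xs - g xs))" by (intro computable_diff computable_const assms)
  moreover have "1 - (a - b) = of_bool (a \<le> b)" for a b :: nat by auto
  ultimately show ?thesis by simp
qed

lemma computable_conj: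
  assumes "computable k (\<lambda>xs. of_bool (P xs))" "computable k (\<lambda>xs. of_bool (Q xs))"
  shows "computable k (\<lambda>xs. of_bool (P xs \<and> Q xs))"
  using computable_mult[OF assms] by (simp add: of_bool_conj)

lemma computable_not:
  assumes "computable k (\<lambda>xs. of_bool (P xs))"
  shows "computable k (\<lambda>xs. of_bool (\<not> P xs))"
proof -
  have "computable k (\<lambda>xs. 1 - of_bool (P xs))" by (intro computable_diff computable_const assms)
  moreover have "1 - of_bool P = (of_bool (\<not> P) :: nat)" for P by auto
  ultimately show ?thesis by simp
qed

lemma computable_less:
  assumes "computable k f" "computable k g"
  shows "computable k (\<lambda>xs. of_bool (f xs < g xs))"
  using computable_le[OF computable_Suc[OF assms(1)] assms(2)] by (simp add: Suc_le_eq)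

lemma computable_eq:
  assumes "computable k f" "computable k g"
  shows "computable k (\<lambda>xs. of_bool (f xs = g xs))"
  using computable_conj[OF computable_le[OF assms] computable_le[OF assms(2,1)]]
  by (simp add: order_eq_iff)

lemma computable_if:
  assumes "computable k (\<lambda>xs. of_bool (P xs))" "computable k f" "computable k g"
  shows "computable k (\<lambda>xs. if P xs then f xs else g xs)"
proof -
  have "computable k (\<lambda>xs. of_bool (P xs) * f xs + of_bool (\<not> P xs) * g xs)"
    by (intro computable_add computable_mult computable_not assms)
  moreover have "of_bool P * a + of_bool (\<not> P) * b = (if P then a else b)" for P and a b :: nat by auto
  ultimately show ?thesis by simp
qed

lemma computable_ball:
  assumes "computable (Suc k) (\<lambda>xs. of_bool (P xs))" "computable k b"
  shows "computable k (\<lambda>xs. of_bool (\<forall>i<b xs. P (i # xs)))"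
proof -
  have "computable k (\<lambda>xs. of_bool ((\<Sum>i<b xs. of_bool (\<not> P (i # xs))) = (0::nat)))"
    by (intro computable_eq computable_sum[where g = "\<lambda>xs. of_bool (\<not> P xs)"] computable_not
        computable_const assms)
  moreover have "((\<Sum>i<b xs. of_bool (\<not> P (i # xs))) = (0::nat)) = (\<forall>i<b xs. P (i # xs))" for xs
    by auto
  ultimately show ?thesis by simp
qed

lemma computable_set_sum:
  assumes "\<And>u. u \<in> U \<Longrightarrow> computable k (f u)"
  shows "computable k (\<lambda>xs. \<Sum>u\<in>U. f u xs)"
  using assms by (induction U rule: infinite_finite_induct) (auto intro: computable_add computable_const)

lemma computable_set_ball:
  assumes "finite U" "\<And>u. u \<in> U \<Longrightarrow> computable k (\<lambda>xs. of_bool (P u xs))"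
  shows "computable k (\<lambda>xs. of_bool (\<forall>u\<in>U. P u xs))"
  using assms by (induction U) (auto intro: computable_conj computable_const)

text \<open>The quotient is the number of \<open>i < x\<close> with
  \<open>Suc i * m \<le> x\<close>; the conjunct \<open>0 < m\<close> reproduces the convention that
  division by zero gives zero.\<close>

lemma computable_div:
  assumes "computable k f" "computable k g"
  shows "computable k (\<lambda>xs. f xs div g xs)"
proof -
  have "x div m = (\<Sum>i<x. of_bool (0 < m \<and> Suc i * m \<le> x))" for x m :: nat
  proof (cases "m = 0")
    case False
    have *: "Suc i * m \<le> x \<longleftrightarrow> i < x div m" for i
      using False less_eq_div_iff_mult_less_eq[of m "Suc i" x] by (simp only: Suc_le_eq)
    then have "{i. i < x \<and> Suc i * m \<le> x} = {..<x div m}"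
      unfolding * using less_le_trans[OF _ div_le_dividend[of x m]] by blast
    then show ?thesis using False by (simp add: sum.If_cases of_bool_def Int_def del: mult_Suc)
  qed simp
  moreover have "computable (Suc k) (\<lambda>ys. of_bool (0 < g (tl ys) \<and> Suc (ys ! 0) * g (tl ys) \<le> f (tl ys)))"
    by (intro computable_conj computable_less computable_le computable_mult computable_nth computable_Suc
        computable_const computable_weaken1[OF assms(1)] computable_weaken1[OF assms(2)]) simp
  from computable_sum[OF this assms(1)]
  have "computable k (\<lambda>xs. \<Sum>i<f xs. of_bool (0 < g xs \<and> Suc i * g xs \<le> f xs))" by simp
  ultimately show ?thesis by simp
qed

lemmas computable_intros = computable_nth computable_const computable_add computable_mult computable_power
  computable_diff computable_le computable_less computable_eq computable_not computable_conj computable_if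
  computable_div computable_Suc

lemma computable_prod_encode:
  assumes "computable k f" "computable k g"
  shows "computable k (\<lambda>xs. prod_encode (f xs, g xs))"
  unfolding prod_encode_def triangle_def prod.case by (intro computable_intros assms)

text \<open>Decoding is a search among all \<open>x, y \<le> z\<close>: the components of a pair do
  not exceed its code, so exactly one term of the double sum survives.\<close>

lemma computable_prod_decode:
  assumes "computable k f"
  shows computable_fst_prod_decode: "computable k (\<lambda>xs. fst (prod_decode (f xs)))"
    and computable_snd_prod_decode: "computable k (\<lambda>xs. snd (prod_decode (f xs)))"
proof -
  have *: "(\<Sum>x<Suc z. \<Sum>y<Suc z. of_bool (prod_encode (x, y) = z) * h x y)
      = h (fst (prod_decode z)) (snd (prod_decode z))" for z :: nat and h :: "nat \<Rightarrow> nat \<Rightarrow> nat"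
  proof -
    obtain a b where ab: "prod_decode z = (a, b)" by fastforce
    then have z: "z = prod_encode (a, b)" by (metis prod_decode_inverse)
    then have le: "a < Suc z" "b < Suc z" using le_prod_encode_1[of a b] le_prod_encode_2[of b a] by auto
    have ob: "of_bool P * t = (if P then t else 0)" for P and t :: nat by simp
    have "(\<Sum>x<Suc z. \<Sum>y<Suc z. of_bool (prod_encode (x, y) = z) * h x y)
        = (\<Sum>x<Suc z. if x = a then (\<Sum>y<Suc z. if y = b then h x y else 0) else 0)"
      unfolding z by (intro sum.cong refl, rename_tac x, case_tac "x = a") (simp_all add: ob del: sum.lessThan_Suc)
    also have "\<dots> = h a b" using le by simp
    finally show ?thesis using ab by simp
  qed
  have **: "computable k (\<lambda>xs. \<Sum>x<Suc (f xs). \<Sum>y<Suc (f xs). of_bool (prod_encode (x, y) = f xs) * h x y)"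
    if "computable (Suc (Suc k)) (\<lambda>ys. h (ys ! 1) (ys ! 0))" for h
  proof -
    have "computable (Suc (Suc k)) (\<lambda>ys. of_bool (prod_encode (ys ! 1, ys ! 0) = f (tl (tl ys))) * h (ys ! 1) (ys ! 0))"
      using that computable_weaken1[OF computable_weaken1[OF assms]]
      by (intro computable_intros computable_prod_encode; simp)
    from computable_sum[OF computable_sum[OF this computable_weaken1[OF computable_Suc[OF assms]]] computable_Suc[OF assms]]
    show ?thesis by (simp del: sum.lessThan_Suc)
  qed
  show "computable k (\<lambda>xs. fst (prod_decode (f xs)))" "computable k (\<lambda>xs. snd (prod_decode (f xs)))"
    using **[of "\<lambda>x y. x"] **[of "\<lambda>x y. y"] unfolding * by (simp_all add: computable_nth)
qed

section \<open>Reading coded lists\<close>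

definition code_nth :: "nat \<Rightarrow> nat \<Rightarrow> nat" where
  "code_nth c i = (if i < length (list_decode c) then list_decode c ! i else 0)"

lemma code_nth_list_encode [simp]: "i < length xs \<Longrightarrow> code_nth (list_encode xs) i = xs ! i"
  by (simp add: code_nth_def)

text \<open>\<open>list_encode (x # xs)\<close> is the successor of a pair code, which
  \<open>c - 1\<close> undoes. On \<open>0\<close>, the code of \<open>[]\<close>, truncated
  subtraction and \<open>prod_decode 0 = (0, 0)\<close> give \<open>0\<close> again, so iterating
  past the end is harmless.\<close>

definition code_tl :: "nat \<Rightarrow> nat" where
  "code_tl c = snd (prod_decode (c - 1))"

lemma prod_decode_0: "prod_decode 0 = (0, 0)"
  by (simp add: prod_decode_def prod_decode_aux.simps)

lemma code_tl_list_encode: "code_tl (list_encode xs) = list_encode (tl xs)"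
  by (cases xs) (auto simp: code_tl_def prod_decode_0)

lemma code_drop: "(code_tl ^^ i) c = list_encode (drop i (list_decode c))"
  by (induction i) (simp_all add: code_tl_list_encode drop_Suc tl_drop)

lemma computable_code_drop:
  assumes "computable k f" "computable k g"
  shows "computable k (\<lambda>xs. (code_tl ^^ g xs) (f xs))"
proof -
  have "rec_nat a (\<lambda>n y. code_tl y) b = (code_tl ^^ b) a" for a b by (induction b) auto
  moreover have "computable (Suc (Suc k)) (\<lambda>ys. code_tl (ys ! 1))"
    unfolding code_tl_def by (intro computable_snd_prod_decode computable_intros) auto
  ultimately show ?thesis
    using computable_rec[OF assms, of "\<lambda>ys. code_tl (ys ! 1)"] by auto
qed

lemma computable_code_nth:
  assumes "computable k f" "computable k g"
  shows "computable k (\<lambda>xs. code_nth (f xs) (g xs))"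
proof -
  have "code_nth c i = fst (prod_decode ((code_tl ^^ i) c - 1))" for c i
  proof (cases "i < length (list_decode c)")
    case True
    then show ?thesis by (simp add: code_drop Cons_nth_drop_Suc[symmetric] code_nth_def)
  qed (simp add: code_drop code_nth_def prod_decode_0)
  then show ?thesis
    by (simp only:) (intro computable_fst_prod_decode computable_diff computable_code_drop computable_const assms)
qed

lemma length_le_list_encode: "length xs \<le> list_encode xs"
proof (induction xs)
  case (Cons x xs)
  then show ?case using le_prod_encode_2[of "list_encode xs" x] by simp
qed simp

text \<open>Counts the iterated tails that are non-empty; the code itself bounds the count because a
  list is never longer than its code.\<close>

lemma computable_code_length:
  assumes "computable k f"
  shows "computable k (\<lambda>xs. length (list_decode (f xs)))"
proof -
  have *: "length (list_decode c) = (\<Sum>i<c. of_bool ((code_tl ^^ i) c \<noteq> 0))" for c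
  proof -
    have "list_encode ys = 0 \<longleftrightarrow> ys = []" for ys by (cases ys) auto
    then have "(code_tl ^^ i) c \<noteq> 0 \<longleftrightarrow> i < length (list_decode c)" for i
      unfolding code_drop by (simp add: not_le)
    then have "{i. i < c \<and> (code_tl ^^ i) c \<noteq> 0} = {..<length (list_decode c)}"
      using less_le_trans[OF _ length_le_list_encode[of "list_decode c"]] by auto
    then show ?thesis by (simp only: of_bool_def sum.If_cases[OF finite_lessThan] Int_def) simp
  qed
  have "computable (Suc k) (\<lambda>ys. of_bool ((code_tl ^^ (ys ! 0)) (f (tl ys)) \<noteq> 0))"
    by (intro computable_intros computable_code_drop computable_weaken1[OF assms]) simp
  from computable_sum[OF this assms] show ?thesis by (simp add: *)
qed

lemma computable_mem_set_decode:
  assumes "computable k f" "computable k g"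
  shows "computable k (\<lambda>xs. of_bool (f xs \<in> set_decode (g xs)))"
proof -
  have "odd x \<longleftrightarrow> x \<noteq> 2 * (x div 2)" for x :: nat by presburger
  then show ?thesis
    unfolding set_decode_def mem_Collect_eq by (simp only:) (intro computable_intros assms)
qed

lemma computable_mem_finite:
  assumes "finite S" "computable k f"
  shows "computable k (\<lambda>xs. of_bool (f xs \<in> S))"
proof -
  have "of_bool (x \<in> S) = (\<Sum>s\<in>S. of_bool (x = s) :: nat)" for x
    using assms(1) by (simp add: of_bool_def sum.delta)
  then show ?thesis by (simp only:) (intro computable_set_sum computable_eq computable_const assms)
qed

section \<open>Complexity and computable costs\<close>

text \<open>Unbounded minimisation followed by \<open>h\<close>. The equivalence also records
  divergence when there is no witness, since \<open>decompressor\<close> requires the domain of the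
  partial function to be matched exactly.\<close>

lemma computable_search:
  assumes P: "computable 2 (\<lambda>xs. of_bool (P (xs ! 0) (xs ! 1)))" and h: "computable 1 (\<lambda>xs. h (xs ! 0))"
  obtains e where "\<And>x y. rec_eval e [x] y \<longleftrightarrow> (\<exists>t. P t x \<and> (\<forall>t'<t. \<not> P t' x) \<and> y = h t)"
proof -
  obtain f where f: "\<And>xs. length xs = 2 \<Longrightarrow> rec_eval f xs (of_bool (\<not> P (xs ! 0) (xs ! 1)))"
    using computable_not[OF P] by (auto simp: computable_def)
  obtain d where d: "\<And>xs. length xs = 1 \<Longrightarrow> rec_eval d xs (h (xs ! 0))"
    using h by (auto simp: computable_def)
  have f': "rec_eval f [t, x] y \<longleftrightarrow> y = of_bool (\<not> P t x)" for t x y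
    using f[of "[t, x]"] rec_eval_deterministic by fastforce
  have d': "rec_eval d [t] y \<longleftrightarrow> y = h t" for t y
    using d[of "[t]"] rec_eval_deterministic by fastforce
  have mu: "rec_eval (Mu f) [x] t \<longleftrightarrow> P t x \<and> (\<forall>t'<t. \<not> P t' x)" for x t
  proof
    assume "rec_eval (Mu f) [x] t"
    then show "P t x \<and> (\<forall>t'<t. \<not> P t' x)"
      by (rule rec_evalE(7)) (auto simp: f' split: if_splits)
  next
    assume "P t x \<and> (\<forall>t'<t. \<not> P t' x)"
    then show "rec_eval (Mu f) [x] t"
      by (intro rec_eval.intros(7)) (auto simp: f')
  qed
  have "rec_eval (Comp d [Mu f]) [x] y \<longleftrightarrow> (\<exists>t. rec_eval (Mu f) [x] t \<and> rec_eval d [t] y)" for x y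
  proof
    assume "rec_eval (Comp d [Mu f]) [x] y"
    then show "\<exists>t. rec_eval (Mu f) [x] t \<and> rec_eval d [t] y"
      by (rule rec_evalE(4)) (auto simp: list_all2_Cons1)
  next
    assume "\<exists>t. rec_eval (Mu f) [x] t \<and> rec_eval d [t] y"
    then show "rec_eval (Comp d [Mu f]) [x] y"
      by (auto intro: rec_eval.intros(4))
  qed
  then show ?thesis by (intro that[of "Comp d [Mu f]"]) (auto simp: mu d')
qed

text \<open>The digit \<open>1\<close> in front makes the length of the word recoverable from its number.\<close>

fun word_num :: "bool list \<Rightarrow> nat" where
  "word_num [] = 1"
| "word_num (b # p) = 2 * word_num p + of_bool b"

lemma word_num_ge: "2 ^ length p \<le> word_num p"
  by (induction p) auto

lemma ex_word_num: "m \<ge> 1 \<Longrightarrow> \<exists>p. word_num p = m"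
proof (induction m rule: less_induct)
  case (less m)
  show ?case
  proof (cases "m = 1")
    case True
    then show ?thesis by (metis word_num.simps(1))
  next
    case False
    then obtain p where "word_num p = m div 2" using less.IH[of "m div 2"] less.prems by force
    then have "word_num (odd m # p) = m" by simp
    then show ?thesis by blast
  qed
qed

text \<open>Replaces recursion on the word by a bounded sum over its digits, which is computable
  from the code of the word.\<close>

lemma word_num_eq_sum:
  "word_num p = 2 ^ length p + (\<Sum>i<length p. 2 ^ i * of_bool (p ! i))"
proof (induction p)
  case (Cons b p)
  have "(\<Sum>i<length p. 2 ^ Suc i * of_bool ((b # p) ! Suc i)) = (2::nat) * (\<Sum>i<length p. 2 ^ i * of_bool (p ! i))"
    unfolding sum_distrib_left by (intro sum.cong refl) simp
  then show ?case
    by (simp only: word_num.simps Cons length_Cons sum.lessThan_Suc_shift) simp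
qed simp

lemma computable_word_num:
  obtains f where "computable 1 (\<lambda>xs. f (xs ! 0))" "\<And>p. f (list_encode (map of_bool p)) = word_num p"
proof
  let ?f = "\<lambda>c. 2 ^ length (list_decode c) + (\<Sum>i<length (list_decode c). 2 ^ i * code_nth c i)"
  have "computable (Suc 1) (\<lambda>xs. 2 ^ (xs ! 0) * code_nth (xs ! 1) (xs ! 0))"
    by (intro computable_intros computable_code_nth) auto
  from computable_sum[OF this computable_code_length[OF computable_nth[of 0 1]]]
  show "computable 1 (\<lambda>xs. ?f (xs ! 0))"
    by (intro computable_add computable_power computable_const computable_code_length computable_nth) auto
  show "?f (list_encode (map of_bool p)) = word_num p" for p
    by (simp add: word_num_eq_sum)
qed

text \<open>This and the next two lemmas undo the layers of the numbers \<open>N\<close> in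
  \<open>K0_le_cost\<close>: the trailing zeros give \<open>s\<close>, the leading \<open>1\<close>
  separates the cost from the rank, and the residue modulo \<open>2 ^ s\<close> gives
  \<open>n\<close>.\<close>

lemma power2_odd_unique:
  fixes x y :: nat
  assumes "2 ^ a * (2 * x + 1) = 2 ^ b * (2 * y + 1)"
  shows "a = b \<and> x = y"
  using assms
proof (induction a arbitrary: b)
  case 0
  then show ?case by (cases b) (auto, presburger)
next
  case (Suc a)
  show ?case
  proof (cases b)
    case 0
    with Suc.prems show ?thesis by (simp, presburger)
  next
    case (Suc b')
    with Suc.prems Suc.IH[of b'] show ?thesis by simp
  qed
qed

lemma power2_add_unique:
  fixes r r' :: nat
  assumes "2 ^ L + r = 2 ^ L' + r'" "r < 2 ^ L" "r' < 2 ^ L'"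
  shows "L = L' \<and> r = r'"
proof -
  have False if "a < b" "2 ^ a + c = 2 ^ b + d" "c < 2 ^ a" for a b c d :: nat
  proof -
    have "(2::nat) ^ Suc a \<le> 2 ^ b" using that(1) by (intro power_increasing) auto
    then show False using that by simp
  qed
  then have "L = L'" using assms by (metis linorder_neqE_nat)
  then show ?thesis using assms by simp
qed

lemma add_mult_unique:
  fixes n m q r d :: nat
  assumes "n + d * q = m + d * r" "n < d" "m < d"
  shows "n = m \<and> q = r"
proof -
  have "(n + d * q) mod d = n" "(m + d * r) mod d = m" "(n + d * q) div d = q" "(m + d * r) div d = r"
    using assms(2,3) by auto
  then show ?thesis using assms(1) by metis
qed

text \<open>No prefix code is built; only the number of words of each cost matters. A word is
  recovered from \<open>n\<close>, its cost and its rank among the valid codes of equal cost. The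
  rank fits into \<open>cost n c\<close> binary digits, and the number of digits conveys the cost.
  The summand \<open>2 * s\<close> pays for the \<open>s\<close> digits of \<open>n\<close> and for
  the zeros that announce \<open>s\<close>.\<close>

theorem K0_le_cost:
  fixes valid :: "nat \<Rightarrow> nat \<Rightarrow> bool" and cost :: "nat \<Rightarrow> nat \<Rightarrow> nat"
  assumes opt: "optimal_decompressor \<Lambda> \<kappa> A" and inj: "inj_on \<kappa> \<Lambda>"
    and cv: "computable 2 (\<lambda>xs. of_bool (valid (xs ! 0) (xs ! 1)))"
    and cc: "computable 2 (\<lambda>xs. cost (xs ! 0) (xs ! 1))"
    and word: "\<And>n c. valid n c \<Longrightarrow> \<exists>w\<in>lists \<Lambda>. c = list_encode (map \<kappa> w)"
    and fin: "\<And>n L. finite {c. valid n c \<and> cost n c = L}"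
    and card: "\<And>n L. card {c. valid n c \<and> cost n c = L} \<le> 2 ^ L"
  shows "\<exists>C. \<forall>n s. \<forall>w\<in>lists \<Lambda>. n < 2 ^ s \<longrightarrow> valid n (list_encode (map \<kappa> w)) \<longrightarrow>
    K0 A w \<le> enat (cost n (list_encode (map \<kappa> w)) + 2 * s + C)"
proof -
  define rank where "rank n c = (\<Sum>i<c. of_bool (valid n i \<and> cost n i = cost n c) :: nat)" for n c
  have rank: "rank n c = card {i. i < c \<and> valid n i \<and> cost n i = cost n c}" for n c
    by (simp add: rank_def of_bool_def sum.If_cases Int_def)
  have rank_less: "rank n c < 2 ^ cost n c" if "valid n c" for n c
  proof -
    have "rank n c < card {i. valid n i \<and> cost n i = cost n c}"
      unfolding rank using that fin by (intro psubset_card_mono) auto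
    also have "\<dots> \<le> 2 ^ cost n c" by (rule card)
    finally show ?thesis .
  qed
  have rank_mono: "rank n c < rank n c'" if "c < c'" "valid n c" "cost n c = cost n c'" for n c c'
    unfolding rank using that by (intro psubset_card_mono) auto
  txt \<open>
    In binary, \<open>N s n c\<close> is a \<open>1\<close>, the \<open>cost n c\<close> digits of the rank, the \<open>s\<close> digits of \<open>n\<close>,
    a \<open>1\<close> and \<open>s\<close> zeros; this can be parsed from the right.
  \<close>
  define N where "N s n c = 2 ^ s * (2 * (n + 2 ^ s * (2 ^ cost n c + rank n c)) + 1)" for s n c
  have uniq: "s = s' \<and> n = n' \<and> c = c'"
    if "n < 2 ^ s" "n' < 2 ^ s'" "valid n c" "valid n' c'" "N s n c = N s' n' c'" for s s' n n' c c'
  proof -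
    have 1: "s = s'" "n + 2 ^ s * (2 ^ cost n c + rank n c) = n' + 2 ^ s * (2 ^ cost n' c' + rank n' c')"
      using power2_odd_unique[OF that(5)[unfolded N_def]] by auto
    then have 2: "n = n'" "2 ^ cost n c + rank n c = 2 ^ cost n' c' + rank n' c'"
      using add_mult_unique[OF 1(2)] that by auto
    then have 3: "cost n c = cost n c'" "rank n c = rank n c'"
      using power2_add_unique[OF 2(2)] rank_less that by auto
    then have "c = c'" using rank_mono[of c c' n] rank_mono[of c' c n] that 2 by (metis linorder_neqE_nat less_irrefl)
    then show ?thesis using 1 2 by simp
  qed
  obtain num where num: "computable 1 (\<lambda>xs. num (xs ! 0))"
      "\<And>p. num (list_encode (map of_bool p)) = word_num p"
    by (rule computable_word_num) blast
  define fs where "fs t = fst (prod_decode t)" for t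
  define fn where "fn t = fst (prod_decode (snd (prod_decode t)))" for t
  define fc where "fc t = snd (prod_decode (snd (prod_decode t)))" for t
  \<comment> \<open>A program with number \<open>num x\<close> is decoded by searching for a triple
    \<open>(s, n, c)\<close>, coded by \<open>t\<close>, with this number; the other two conditions
    are those under which \<open>uniq\<close> makes the triple unique.\<close>
  define P where "P t x \<longleftrightarrow> fn t < 2 ^ fs t \<and> valid (fn t) (fc t) \<and> num x = N (fs t) (fn t) (fc t)" for t x
  have cf: "computable k (\<lambda>xs. fs (f xs))" "computable k (\<lambda>xs. fn (f xs))" "computable k (\<lambda>xs. fc (f xs))"
    if "computable k f" for k f
    unfolding fs_def fn_def fc_def using that by (intro computable_prod_decode; assumption)+
  have cv': "computable k (\<lambda>xs. of_bool (valid (f xs) (g xs)))"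
    and cc': "computable k (\<lambda>xs. cost (f xs) (g xs))" if "computable k f" "computable k g" for k f g
    using computable_comp2[OF cv that] computable_comp2[OF cc that] by simp_all
  have crank: "computable 2 (\<lambda>xs. rank (xs ! 0) (xs ! 1))"
  proof -
    have "computable (Suc 2) (\<lambda>ys. of_bool (valid (ys ! 1) (ys ! 0) \<and> cost (ys ! 1) (ys ! 0) = cost (ys ! 1) (ys ! 2)))"
      by (intro computable_conj computable_eq cv' cc' computable_nth) auto
    from computable_sum[OF this computable_nth[of 1 2]]
    show ?thesis by (simp add: rank_def)
  qed
  have crank': "computable k (\<lambda>xs. rank (f xs) (g xs))" if "computable k f" "computable k g" for k f g
    using computable_comp2[OF crank that] by simp
  have cnum: "computable k (\<lambda>xs. num (f xs))" if "computable k f" for k f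
    using computable_comp1[OF num(1) that] by simp
  have "computable 2 (\<lambda>xs. of_bool (P (xs ! 0) (xs ! 1)))"
    unfolding P_def N_def
    by (intro computable_conj computable_less computable_eq computable_power computable_mult computable_add
        computable_const cnum crank' cv' cc' cf computable_nth) auto
  moreover have "computable 1 (\<lambda>xs. fc (xs ! 0))" by (intro cf computable_nth) auto
  ultimately obtain e where e: "\<And>x y. rec_eval e [x] y \<longleftrightarrow> (\<exists>t. P t x \<and> (\<forall>t'<t. \<not> P t' x) \<and> y = fc t)"
    by (rule computable_search) blast
  have P_uniq: "t = t'" if "P t x" "P t' x" for t t' x
  proof -
    have "fs t = fs t' \<and> fn t = fn t' \<and> fc t = fc t'"
      using that unfolding P_def by (intro uniq) auto
    then have "prod_decode t = prod_decode t'"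
      unfolding fs_def fn_def fc_def by (metis prod.expand prod_decode_eq)
    then show ?thesis by simp
  qed
  \<comment> \<open>As there is at most one witness, its minimality in the search is
    automatic.\<close>
  then have e: "rec_eval e [x] y \<longleftrightarrow> (\<exists>t. P t x \<and> y = fc t)" for x y
    unfolding e by (metis less_irrefl)
  define code where "code w = list_encode (map \<kappa> w)" for w
  have code_inj: "w = w'" if "w \<in> lists \<Lambda>" "w' \<in> lists \<Lambda>" "code w = code w'" for w w'
    using that inj unfolding code_def
    by (metis inj_onD inj_on_map_lists list_encode_inverse lists_eq_set mem_Collect_eq)
  define Q where "Q p w \<longleftrightarrow> w \<in> lists \<Lambda> \<and> (\<exists>t. P t (list_encode (map of_bool p)) \<and> fc t = code w)" for p w
  have Q_uniq: "w = w'" if "Q p w" "Q p w'" for p w w'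
    using that P_uniq code_inj unfolding Q_def by metis
  define B where "B p = (if \<exists>w. Q p w then Some (THE w. Q p w) else None)" for p
  have B: "B p = Some w \<longleftrightarrow> w \<in> lists \<Lambda> \<and> (\<exists>t. P t (list_encode (map of_bool p)) \<and> fc t = code w)" for p w
  proof -
    have "B p = Some w \<longleftrightarrow> Q p w"
      unfolding B_def using Q_uniq the_equality[of "Q p"] by (metis option.distinct(1) option.inject)
    then show ?thesis by (simp add: Q_def)
  qed
  have "decompressor \<Lambda> \<kappa> B"
    unfolding decompressor_def
  proof (intro conjI exI[of _ e] allI impI)
    show "w \<in> lists \<Lambda>" if "B p = Some w" for p w using that B by blast
    show "rec_eval e [list_encode (map of_bool p)] y = (\<exists>w. B p = Some w \<and> y = list_encode (map \<kappa> w))" for p y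
    proof -
      have "\<exists>w\<in>lists \<Lambda>. fc t = code w" if "P t x" for t x
        using that word unfolding P_def code_def by blast
      then show ?thesis unfolding e B code_def by metis
    qed
  qed
  then obtain C where C: "\<And>w. w \<in> lists \<Lambda> \<Longrightarrow> K0 A w \<le> K0 B w + enat C"
    using opt unfolding optimal_decompressor_def by blast
  have "K0 A w \<le> enat (cost n (code w) + 2 * s + (C + 2))"
    if w: "w \<in> lists \<Lambda>" and s: "n < 2 ^ s" and v: "valid n (code w)" for n s w
  proof -
    define c where "c = code w"
    have "N s n c \<ge> 1" unfolding N_def One_nat_def Suc_le_eq by (intro mult_pos_pos) simp_all
    then obtain p where p: "word_num p = N s n c" using ex_word_num by blast
    have "P (prod_encode (s, prod_encode (n, c))) (list_encode (map of_bool p))"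
      using s v by (simp add: P_def fn_def fs_def fc_def num p c_def)
    then have "B p = Some w" using w unfolding B by (force simp: fc_def c_def)
    then have 1: "K0 B w \<le> enat (length p)" unfolding K0_def by (intro INF_lower) simp
    \<comment> \<open>\<open>N s n c\<close> has \<open>cost n c + 2 * s + 2\<close> binary digits,
      and this bounds the length of \<open>p\<close> because
      \<open>2 ^ length p \<le> word_num p\<close>.\<close>
    have "rank n c < 2 ^ cost n c" using rank_less v by (simp add: c_def)
    then have "2 ^ cost n c + rank n c + 1 \<le> 2 ^ (cost n c + 1)" by simp
    then have "2 ^ s * (2 ^ cost n c + rank n c + 1) \<le> 2 ^ s * 2 ^ (cost n c + 1)"
      by (rule mult_left_mono) simp
    then have "n + 2 ^ s * (2 ^ cost n c + rank n c) < 2 ^ (s + (cost n c + 1))"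
      using s by (simp add: algebra_simps power_add)
    then have "2 * (n + 2 ^ s * (2 ^ cost n c + rank n c)) + 1 < 2 ^ (s + (cost n c + 1) + 1)" by simp
    then have "N s n c < 2 ^ s * 2 ^ (s + (cost n c + 1) + 1)" unfolding N_def by (rule mult_strict_left_mono) simp
    also have "\<dots> = 2 ^ (cost n c + 2 * s + 2)" 
      unfolding power_add[symmetric] by (rule arg_cong[where f = "(^) 2"]) simp
    finally have "(2::nat) ^ length p < 2 ^ (cost n c + 2 * s + 2)"
      using word_num_ge[of p] p by linarith
    then have "length p < cost n c + 2 * s + 2" by (rule power_less_imp_less_exp[rotated]) simp
    then have "length p \<le> cost n c + 2 * s + 2" by simp
    then have "K0 B w \<le> enat (cost n c + 2 * s + 2)" using 1 order_trans by fastforce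
    then have "K0 B w + enat C \<le> enat (cost n c + 2 * s + 2) + enat C" by (rule add_right_mono)
    with C[OF w] show ?thesis by (simp add: c_def)
  qed
  then show ?thesis unfolding code_def by blast
qed

section \<open>Coding words along a tiling\<close>

text \<open>Makes the canonical code of a finite set a bound for searching its elements, so that
  sums over the set become bounded sums.\<close>

lemma less_set_encode:
  assumes "finite S" "i \<in> S" shows "i < set_encode S"
proof -
  have "i < 2 ^ i" by simp
  also have "\<dots> \<le> set_encode S" unfolding set_encode_def using assms by (intro member_le_sum) auto
  finally show ?thesis .
qed

text \<open>
  The facts of \<^locale>\<open>folding_insort_key\<close> are about the locale version of
  \<^const>\<open>sorted_key_list_of_set\<close>, which is a different constant.
\<close>

lemma linorder_sorted_key_list_of_set:
  "linorder.sorted_key_list_of_set (\<le>) f = sorted_key_list_of_set (f :: 'x \<Rightarrow> nat)"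
proof -
  have "linorder.insort_key (\<le>) f x xs = insort_key f x xs" for x xs
    by (induction xs) (simp_all add: linorder.insort_key.simps[OF linorder_class.linorder_axioms])
  then have "linorder.insort_key (\<le>) f = insort_key f" by blast
  then show ?thesis
    by (simp only: linorder.sorted_key_list_of_set_def[OF linorder_class.linorder_axioms]
        sorted_key_list_of_set_def)
qed

lemma sorted_key_list_of_set_facts:
  fixes \<iota> :: "'x \<Rightarrow> nat"
  assumes inj: "inj_on \<iota> T" and T: "finite T"
  shows "set (sorted_key_list_of_set \<iota> T) = T"
    and "sorted_wrt (<) (map \<iota> (sorted_key_list_of_set \<iota> T))"
    and "length (sorted_key_list_of_set \<iota> T) = card T"
proof -
  interpret folding_insort_key "(\<le>)" "(<)" T \<iota> by unfold_locales (rule inj)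
  show "set (sorted_key_list_of_set \<iota> T) = T"
    and "sorted_wrt (<) (map \<iota> (sorted_key_list_of_set \<iota> T))"
    and "length (sorted_key_list_of_set \<iota> T) = card T"
    using set_sorted_key_list_of_set[OF subset_refl T] strict_sorted_key_list_of_set[OF subset_refl]
      length_sorted_key_list_of_set[OF subset_refl]
    unfolding linorder_sorted_key_list_of_set by - assumption+
qed

text \<open>Locates a site in the listing by counting smaller indices, which a program can do; this
  is how the letter at a given site is read off a coded word.\<close>

lemma nth_sorted_key_list_of_set:
  fixes \<iota> :: "'g \<Rightarrow> nat"
  assumes inj: "inj_on \<iota> T" and T: "finite T" and x: "x \<in> T"
  shows "sorted_key_list_of_set \<iota> T ! card {y\<in>T. \<iota> y < \<iota> x} = x"
proof -
  define xs where "xs = sorted_key_list_of_set \<iota> T"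
  have xs: "set xs = T" "sorted_wrt (<) (map \<iota> xs)" "length xs = card T"
    unfolding xs_def by (rule sorted_key_list_of_set_facts[OF inj T])+
  obtain i where i: "i < length xs" "xs ! i = x" using x xs(1) by (metis in_set_conv_nth)
  have lt: "\<iota> (xs ! j) < \<iota> (xs ! j')" if "j < j'" "j' < length xs" for j j'
    using xs(2) that by (auto simp: sorted_wrt_map sorted_wrt_iff_nth_less)
  have "{y\<in>T. \<iota> y < \<iota> x} = (!) xs ` {..<i}"
  proof
    show "{y\<in>T. \<iota> y < \<iota> x} \<subseteq> (!) xs ` {..<i}"
    proof
      fix y assume y: "y \<in> {y\<in>T. \<iota> y < \<iota> x}"
      then obtain j where j: "j < length xs" "xs ! j = y" using xs(1) by (auto simp: in_set_conv_nth)
      have "j < i"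
      proof (rule ccontr)
        assume "\<not> j < i"
        then have "i = j \<or> i < j" by auto
        then show False using lt[of i j] i j y by auto
      qed
      then show "y \<in> (!) xs ` {..<i}" using j by auto
    qed
  qed (use i lt xs in auto)
  moreover have "inj_on ((!) xs) {..<i}"
    using i lt by (intro inj_onI) (metis less_irrefl lessThan_iff linorder_neqE_nat order.strict_trans)
  ultimately have "card {y\<in>T. \<iota> y < \<iota> x} = i" by (simp add: card_image)
  then show ?thesis using i by (simp add: xs_def)
qed

section \<open>Tiles inside a Foelner set and the cost of a word\<close>

locale computable_tiling = group G for G (structure) +
  fixes \<iota> :: "'a \<Rightarrow> nat" and F Z :: "nat \<Rightarrow> 'a set"
  assumes comp_group: "computable_group G \<iota>"
    and monotiling: "folner_monotiling G F Z"
    and comp_monotiling: "computable_monotiling G \<iota> F Z"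
begin

lemma inj_index: "inj_on \<iota> (carrier G)"
  using comp_group by (simp add: computable_group_def indexing_def)

text \<open>An increasing exhaustion of the group by sets that are finite because
  \<open>\<iota>\<close> is injective.\<close>

definition index_ball :: "nat \<Rightarrow> 'a set" where
  "index_ball m = {g \<in> carrier G. \<iota> g \<le> m}"

lemma index_ball: "finite (index_ball m)" "index_ball m \<subseteq> carrier G"
proof -
  have "inj_on \<iota> (index_ball m)" using inj_index by (auto simp: index_ball_def intro: inj_on_subset)
  moreover have "finite (\<iota> ` index_ball m)"
    by (rule finite_subset[of _ "{..m}"]) (auto simp: index_ball_def)
  ultimately show "finite (index_ball m)" by (simp add: finite_image_iff)
qed (auto simp: index_ball_def)

lemma F_subset: "n \<ge> 1 \<Longrightarrow> F n \<subseteq> carrier G" and F_finite: "n \<ge> 1 \<Longrightarrow> finite (F n)"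
  and F_nonempty: "n \<ge> 1 \<Longrightarrow> F n \<noteq> {}"
  using monotiling by (auto simp: folner_monotiling_def left_folner_def)

lemma Z_subset: "k \<ge> 1 \<Longrightarrow> Z k \<subseteq> carrier G"
  and tiles_cover: "k \<ge> 1 \<Longrightarrow> (\<Union>z\<in>Z k. F k #> z) = carrier G"
  and tiles_disjoint: "k \<ge> 1 \<Longrightarrow> disjoint_family_on (\<lambda>z. F k #> z) (Z k)"
  using monotiling by (auto simp: folner_monotiling_def left_monotiling_def)

lemma card_r_coset: "S \<subseteq> carrier G \<Longrightarrow> z \<in> carrier G \<Longrightarrow> card (S #> z) = card S"
  unfolding r_coset_def UNION_singleton_eq_range
  by (intro card_image inj_onI) (auto simp: subset_iff)

text \<open>The clause \<open>z \<in> F n\<close> keeps the total code length below the weighted sum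
  over \<open>F n\<close> and lets a program look for centres among the indices of
  \<open>F n\<close>.\<close>

definition centers :: "nat \<Rightarrow> nat \<Rightarrow> 'a set" where
  "centers k n = {z \<in> F n \<inter> Z k. \<forall>f\<in>F k. f \<otimes> z \<in> F n}"

text \<open>Patterns are moved back to \<open>F k\<close>, so one table \<open>len\<close> serves
  all tiles. Each uncovered site costs \<open>l\<close> bits; by \<open>card_uncovered\<close> the
  truncated difference is the exact number of these sites.\<close>

definition tile_cost :: "nat \<Rightarrow> (('a \<Rightarrow> 'l) \<Rightarrow> nat) \<Rightarrow> nat \<Rightarrow> nat \<Rightarrow> ('a \<Rightarrow> 'l) \<Rightarrow> nat" where
  "tile_cost k len l n v = (\<Sum>z\<in>centers k n. len (\<lambda>f\<in>F k. v (f \<otimes> z))) + l * (card (F n) - card (F k) * card (centers k n))"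

lemma centers_finite: "n \<ge> 1 \<Longrightarrow> finite (centers k n)"
  using F_finite by (auto simp: centers_def)

lemma centers_subset: "centers k n \<subseteq> Z k" "centers k n \<subseteq> F n"
  by (auto simp: centers_def)

lemma card_uncovered:
  assumes "k \<ge> 1" "n \<ge> 1"
  shows "card (F n - (\<Union>z\<in>centers k n. F k #> z)) = card (F n) - card (F k) * card (centers k n)"
proof -
  have sub: "(\<Union>z\<in>centers k n. F k #> z) \<subseteq> F n"
    by (auto simp: centers_def r_coset_def)
  have "card (\<Union>z\<in>centers k n. F k #> z) = (\<Sum>z\<in>centers k n. card (F k #> z))"
  proof (rule card_UN_disjoint)
    show "\<forall>i\<in>centers k n. finite (F k #> i)"
      using sub F_finite[OF assms(2)] by (auto intro: finite_subset)
    show "\<forall>i\<in>centers k n. \<forall>j\<in>centers k n. i \<noteq> j \<longrightarrow> (F k #> i) \<inter> (F k #> j) = {}"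
      using tiles_disjoint[OF assms(1)] centers_subset unfolding disjoint_family_on_def by blast
  qed (use centers_finite assms in auto)
  also have "\<dots> = card (F k) * card (centers k n)"
    using card_r_coset[OF F_subset[OF assms(1)]] centers_subset(1)[of k n] Z_subset[OF assms(1)]
    by (simp add: subset_iff)
  finally show ?thesis
    using sub F_finite[OF assms(2)] by (simp add: card_Diff_subset finite_subset[OF sub])
qed

text \<open>
  A word on \<open>F n\<close> is determined by its patterns on the tiles inside \<open>F n\<close> and by its letters on the
  uncovered sites, so the weights \<open>2 powr - cost\<close> sum up to at most one.
\<close>

lemma tile_cost_kraft:
  fixes \<Lambda> :: "'l set"
  assumes k: "k \<ge> 1" and n: "n \<ge> 1" and \<Lambda>: "finite \<Lambda>" "card \<Lambda> \<le> 2 ^ l"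
    and kraft: "(\<Sum>u\<in>F k \<rightarrow>\<^sub>E \<Lambda>. (1/2::real) ^ len u) \<le> 1"
  shows "card {v \<in> F n \<rightarrow>\<^sub>E \<Lambda>. tile_cost k len l n v = L} \<le> 2 ^ L"
proof -
  define R where "R = F n - (\<Union>z\<in>centers k n. F k #> z)"
  define pat where "pat z v = (\<lambda>f\<in>F k. v (f \<otimes> z))" for z and v :: "'a \<Rightarrow> 'l"
  define V where "V = F n \<rightarrow>\<^sub>E \<Lambda>"
  define Q where "Q = (centers k n \<rightarrow>\<^sub>E (F k \<rightarrow>\<^sub>E \<Lambda>)) \<times> (R \<rightarrow>\<^sub>E \<Lambda>)"
  define h where "h v = ((\<lambda>z\<in>centers k n. pat z v), restrict v R)" for v :: "'a \<Rightarrow> 'l"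
  have fin: "finite (F k)" "finite (F n)" "finite (centers k n)" "finite R"
    using F_finite k n centers_finite by (auto simp: R_def)
  have finV: "finite V" "finite Q" using fin \<Lambda> by (auto simp: V_def Q_def intro!: finite_PiE)
  have R: "card R = card (F n) - card (F k) * card (centers k n)"
    unfolding R_def by (rule card_uncovered[OF k n])
  have hQ: "h ` V \<subseteq> Q"
    by (force simp: h_def V_def Q_def pat_def R_def centers_def)
  have inj: "inj_on h V"
  proof (rule inj_onI)
    fix v v' assume v: "v \<in> V" "v' \<in> V" "h v = h v'"
    then have p: "pat z v = pat z v'" if "z \<in> centers k n" for z
      using that by (auto simp: h_def fun_eq_iff restrict_def split: if_splits)
    have "v x = v' x" if x: "x \<in> F n" for x
    proof (cases "x \<in> R")
      case True
      then show ?thesis using v(3) by (auto simp: h_def) (metis restrict_apply')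
    next
      case False
      then obtain z f where "z \<in> centers k n" "f \<in> F k" "x = f \<otimes> z"
        using x by (auto simp: R_def r_coset_def)
      then show ?thesis using p[of z] by (auto simp: pat_def) (metis restrict_apply')
    qed
    then show "v = v'" using v unfolding V_def by (intro PiE_ext) auto
  qed
  \<comment> \<open>The weights are extended from words to all pairs of tile patterns and remaining
    letters; there the sum factors into one Kraft sum per tile and the number of words on
    \<open>R\<close>.\<close>
  define q where "q a = (\<Prod>z\<in>centers k n. (1/2::real) ^ len (fst a z)) * (1/2) ^ (l * card R)"
    for a :: "('a \<Rightarrow> 'a \<Rightarrow> 'l) \<times> ('a \<Rightarrow> 'l)"
  have qh: "(1/2) ^ tile_cost k len l n v = q (h v)" for v
    by (simp add: q_def h_def tile_cost_def power_add power_sum R pat_def)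
  have "(\<Sum>v\<in>V. (1/2::real) ^ tile_cost k len l n v) = (\<Sum>a\<in>h ` V. q a)"
    unfolding qh using inj by (simp add: sum.reindex)
  also have "\<dots> \<le> (\<Sum>a\<in>Q. q a)"
    using hQ finV by (intro sum_mono2) (auto simp: q_def intro!: mult_nonneg_nonneg prod_nonneg)
  also have "\<dots> = (\<Sum>p\<in>centers k n \<rightarrow>\<^sub>E (F k \<rightarrow>\<^sub>E \<Lambda>). \<Prod>z\<in>centers k n. (1/2::real) ^ len (p z))
      * (real (card (R \<rightarrow>\<^sub>E \<Lambda>)) * (1/2) ^ (l * card R))"
    unfolding Q_def q_def by (simp add: sum.cartesian_product' sum_distrib_right sum_distrib_left algebra_simps)
  also have "(\<Sum>p\<in>centers k n \<rightarrow>\<^sub>E (F k \<rightarrow>\<^sub>E \<Lambda>). \<Prod>z\<in>centers k n. (1/2::real) ^ len (p z))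
      = (\<Prod>z\<in>centers k n. \<Sum>u\<in>F k \<rightarrow>\<^sub>E \<Lambda>. (1/2::real) ^ len u)"
    using fin \<Lambda> by (subst prod_sum_PiE) (auto intro!: finite_PiE)
  also have "\<dots> * (real (card (R \<rightarrow>\<^sub>E \<Lambda>)) * (1/2) ^ (l * card R)) \<le> 1 * 1"
  proof (rule mult_mono)
    show "(\<Prod>z\<in>centers k n. \<Sum>u\<in>F k \<rightarrow>\<^sub>E \<Lambda>. (1/2::real) ^ len u) \<le> 1"
      using kraft by (intro prod_le_1) (auto intro: sum_nonneg)
    have "real (card \<Lambda>) * (1/2) ^ l \<le> 1"
      using \<Lambda>(2) by (simp add: field_simps)
    then have "(real (card \<Lambda>) * (1/2) ^ l) ^ card R \<le> 1" by (intro power_le_one) auto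
    then show "real (card (R \<rightarrow>\<^sub>E \<Lambda>)) * (1/2) ^ (l * card R) \<le> 1"
      using fin by (simp add: card_PiE power_mult power_mult_distrib)
  qed (auto intro!: prod_nonneg sum_nonneg)
  finally have le1: "(\<Sum>v\<in>V. (1/2::real) ^ tile_cost k len l n v) \<le> 1" by simp
  let ?S = "{v \<in> V. tile_cost k len l n v = L}"
  have "real (card ?S) * (1/2) ^ L = (\<Sum>v\<in>?S. (1/2::real) ^ tile_cost k len l n v)" by simp
  also have "\<dots> \<le> (\<Sum>v\<in>V. (1/2::real) ^ tile_cost k len l n v)" using finV by (intro sum_mono2) auto
  finally have "real (card ?S) * (1/2) ^ L \<le> 1" using le1 by linarith
  then have "real (card ?S) \<le> 2 ^ L" by (simp add: field_simps)
  then show ?thesis unfolding V_def by (metis of_nat_le_iff of_nat_numeral of_nat_power)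
qed

text \<open>The cost is rewritten in terms of indices and codes so that \<open>K0_le_cost\<close>
  applies. The function \<open>len\<close> is arbitrary: only its values on finitely many patterns
  matter, and they become constants of the program.\<close>

lemma tile_complexity:
  fixes \<Lambda> :: "'l set" and A :: "bool list \<Rightarrow> 'l list option"
  assumes k: "k \<ge> 1" and \<Lambda>: "finite \<Lambda>" "card \<Lambda> \<le> 2 ^ l" and \<kappa>: "inj_on \<kappa> \<Lambda>"
    and opt: "optimal_decompressor \<Lambda> \<kappa> A"
    and kraft: "(\<Sum>u\<in>F k \<rightarrow>\<^sub>E \<Lambda>. (1/2::real) ^ len u) \<le> 1"
  shows "\<exists>C. \<forall>n\<ge>1. \<forall>s. \<forall>\<omega>. n < 2 ^ s \<longrightarrow> \<omega> \<in> carrier G \<rightarrow> \<Lambda> \<longrightarrow>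
    K0 A (map \<omega> (sorted_key_list_of_set \<iota> (F n))) \<le> enat (tile_cost k len l n \<omega> + 2 * s + C)"
proof -
  obtain eG where eG: "\<And>g h. g \<in> carrier G \<Longrightarrow> h \<in> carrier G \<Longrightarrow> rec_eval eG [\<iota> g, \<iota> h] (\<iota> (g \<otimes> h))"
    using comp_group unfolding computable_group_def by blast
  obtain eF where eF: "\<And>n. n \<ge> 1 \<Longrightarrow> rec_eval eF [n] (set_encode (\<iota> ` F n))"
    using comp_monotiling unfolding computable_monotiling_def canonically_computable_def by blast
  obtain eZ where eZ: "\<And>n g. n \<ge> 1 \<Longrightarrow> g \<in> carrier G \<Longrightarrow> rec_eval eZ [n, \<iota> g] (of_bool (g \<in> Z n))"
    using comp_monotiling unfolding computable_monotiling_def computable_set_seq_def by blast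
  txt \<open>The program for \<open>F\<close> need not halt on \<open>0\<close>.\<close>
  define T where "T n = F (Suc n)" for n
  have T: "T n \<subseteq> carrier G" "finite (T n)" for n
    using F_subset F_finite by (simp_all add: T_def)
  have injT: "inj_on \<iota> (T n)" for n using inj_index T inj_on_subset by blast
  define Fc where "Fc n = set_encode (\<iota> ` T n)" for n
  have Fc: "set_decode (Fc n) = \<iota> ` T n" for n using T by (simp add: Fc_def)
  have less_Fc: "\<iota> x < Fc n" if "x \<in> T n" for x n
    unfolding Fc_def using T that by (intro less_set_encode) auto
  have cFc: "computable k (\<lambda>xs. Fc (f xs))" if "computable k f" for k f
    by (rule computable_partial_comp[where gs = "[\<lambda>xs. Suc (f xs)]" and e = eF])
      (use that eF in \<open>auto simp: Fc_def T_def intro: computable_Suc\<close>)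
  define mem where "mem n i \<longleftrightarrow> i \<in> set_decode (Fc n)" for n i
  have mem: "mem n i \<longleftrightarrow> i \<in> \<iota> ` T n" for n i by (simp add: mem_def Fc)
  have memI: "x \<in> carrier G \<Longrightarrow> mem n (\<iota> x) \<longleftrightarrow> x \<in> T n" for n x
    using inj_index T(1)[of n] by (auto simp: mem inj_on_eq_iff subset_iff)
  have cmem: "computable k (\<lambda>xs. of_bool (mem (f xs) (g xs)))" if "computable k f" "computable k g" for k f g
    unfolding mem_def using that by (intro computable_mem_set_decode cFc)
  txt \<open>
    The programs for \<open>G\<close> and \<open>Z\<close> need not halt on numbers that are not indices, so these are
    replaced by the index of \<open>\<one>\<close>.
  \<close>
  define el where "el n i = (if mem n i then inv_into (carrier G) \<iota> i else \<one>)" for n i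
  have el: "el n i \<in> carrier G" for n i
    unfolding el_def using T by (auto simp: mem intro!: inv_into_into)
  have el_index: "el n (\<iota> x) = x" if "x \<in> T n" for n x
    using that T inj_index by (auto simp: el_def mem inv_into_f_f subset_iff)
  have cel: "computable k (\<lambda>xs. \<iota> (el (f xs) (g xs)))" if "computable k f" "computable k g" for k f g
  proof -
    have "\<iota> (el n i) = (if mem n i then i else \<iota> \<one>)" for n i
      using T by (auto simp: el_def mem image_iff subset_iff intro!: f_inv_into_f)
    then show ?thesis by (simp only:) (intro computable_if cmem computable_const that)
  qed
  define mu where "mu f n i = \<iota> (f \<otimes> el n i)" for f n i
  have cmu: "computable k (\<lambda>xs. mu h (f xs) (g xs))" if "h \<in> carrier G" "computable k f" "computable k g" for h k f g
    unfolding mu_def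
    by (rule computable_partial_comp[where gs = "[\<lambda>_. \<iota> h, \<lambda>xs. \<iota> (el (f xs) (g xs))]" and e = eG])
      (use that eG el in \<open>auto intro: computable_const cel\<close>)
  have cZ: "computable k' (\<lambda>xs. of_bool (el (f xs) (g xs) \<in> Z k))" if "computable k' f" "computable k' g" for k' f g
    by (rule computable_partial_comp[where gs = "[\<lambda>_. k, \<lambda>xs. \<iota> (el (f xs) (g xs))]" and e = eZ])
      (use that eZ el k in \<open>auto intro: computable_const cel\<close>)
  have Fk: "finite (F k)" "\<And>h. h \<in> F k \<Longrightarrow> h \<in> carrier G" using F_finite F_subset k by auto
  define center where "center n i \<longleftrightarrow> mem n i \<and> el n i \<in> Z k \<and> (\<forall>f\<in>F k. mem n (mu f n i))" for n i
  have ccenter: "computable k (\<lambda>xs. of_bool (center (f xs) (g xs)))" if "computable k f" "computable k g" for k f g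
    unfolding center_def
    by (intro computable_conj computable_set_ball cmem cmu cZ Fk that; assumption)
  have center: "{i. i < Fc n \<and> center n i} = \<iota> ` centers k (Suc n)" for n
  proof -
    have "mem n (mu f n (\<iota> x)) \<longleftrightarrow> f \<otimes> x \<in> T n" if "x \<in> T n" "f \<in> F k" for f x
      using that T(1)[of n] Fk by (simp add: mu_def el_index memI subset_iff)
    then have "center n (\<iota> x) \<longleftrightarrow> x \<in> centers k (Suc n)" if "x \<in> T n" for x
      using that by (auto simp: center_def centers_def el_index mem T_def)
    moreover have "center n i \<Longrightarrow> i \<in> \<iota> ` T n" for i by (simp add: center_def mem)
    moreover have "centers k (Suc n) \<subseteq> T n" by (auto simp: centers_def T_def)
    ultimately show ?thesis using less_Fc by blast
  qed
  define rk where "rk n j = (\<Sum>i<j. of_bool (mem n i) :: nat)" for n j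
  have rk: "rk n (\<iota> x) = card {y\<in>T n. \<iota> y < \<iota> x}" for n x
  proof -
    have "rk n (\<iota> x) = card {i. i < \<iota> x \<and> mem n i}"
      by (simp add: rk_def of_bool_def sum.If_cases Int_def)
    also have "{i. i < \<iota> x \<and> mem n i} = \<iota> ` {y\<in>T n. \<iota> y < \<iota> x}" by (auto simp: mem)
    also have "card \<dots> = card {y\<in>T n. \<iota> y < \<iota> x}"
      using injT by (intro card_image) (auto intro: inj_on_subset)
    finally show ?thesis .
  qed
  have crk: "computable k (\<lambda>xs. rk (f xs) (g xs))" if "computable k f" "computable k g" for k f g
  proof -
    have "computable (Suc 2) (\<lambda>ys. of_bool (mem (ys ! 1) (ys ! 0)))"
      by (intro cmem computable_nth) auto
    from computable_sum[OF this computable_nth[of 1 2]]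
    have "computable 2 (\<lambda>xs. rk (xs ! 0) (xs ! 1))" by (simp add: rk_def)
    from computable_comp2[OF this that] show ?thesis by simp
  qed
  define U where "U = F k \<rightarrow>\<^sub>E \<Lambda>"
  have U: "finite U" unfolding U_def using Fk \<Lambda> by (intro finite_PiE) auto
  define mt where "mt u n c i \<longleftrightarrow> (\<forall>f\<in>F k. code_nth c (rk n (mu f n i)) = \<kappa> (u f))" for u n c i
  define size where "size n = (\<Sum>i<Fc n. of_bool (mem n i) :: nat)" for n
  \<comment> \<open>The inner sum is a table lookup: for the code of a word over
    \<open>\<Lambda>\<close> exactly one pattern of \<open>U\<close> matches at a centre, and its
    \<open>len\<close> is the value of the sum.\<close>
  define cost where "cost n c = (\<Sum>i<Fc n. if center n i then \<Sum>u\<in>U. of_bool (mt u n c i) * len u else 0)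
    + l * (size n - card (F k) * (\<Sum>i<Fc n. of_bool (center n i)))" for n c
  define valid where "valid n c \<longleftrightarrow> length (list_decode c) = size n \<and>
    (\<forall>i<length (list_decode c). code_nth c i \<in> \<kappa> ` \<Lambda>)" for n c
  have size: "size n = card (T n)" for n
  proof -
    have "size n = card {i. i < Fc n \<and> mem n i}"
      by (simp add: size_def of_bool_def sum.If_cases Int_def)
    also have "{i. i < Fc n \<and> mem n i} = \<iota> ` T n" using less_Fc by (auto simp: mem)
    finally show ?thesis using injT by (simp add: card_image)
  qed
  have csize: "computable 2 (\<lambda>xs. size (xs ! 0))"
  proof -
    have "computable (Suc 2) (\<lambda>ys. of_bool (mem (ys ! 1) (ys ! 0)))"
      by (intro cmem computable_nth) auto
    from computable_sum[OF this cFc[OF computable_nth[of 0 2]]]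
    show ?thesis by (simp add: size_def)
  qed
  have ccost: "computable 2 (\<lambda>xs. cost (xs ! 0) (xs ! 1))"
  proof -
    have "computable (Suc 2) (\<lambda>ys. if center (ys ! 1) (ys ! 0)
        then \<Sum>u\<in>U. of_bool (mt u (ys ! 1) (ys ! 2) (ys ! 0)) * len u else 0)"
      unfolding mt_def
      by (intro computable_if ccenter computable_set_sum computable_mult computable_set_ball computable_eq
          computable_code_nth crk cmu computable_const computable_nth Fk; simp)
    from computable_sum[OF this cFc[OF computable_nth[of 0 2]]]
    have 1: "computable 2 (\<lambda>xs. \<Sum>i<Fc (xs ! 0). if center (xs ! 0) i
        then \<Sum>u\<in>U. of_bool (mt u (xs ! 0) (xs ! 1) i) * len u else 0)" by (simp cong: if_cong)
    have "computable (Suc 2) (\<lambda>ys. of_bool (center (ys ! 1) (ys ! 0)))"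
      by (intro ccenter computable_nth) auto
    from computable_sum[OF this cFc[OF computable_nth[of 0 2]]]
    have 2: "computable 2 (\<lambda>xs. \<Sum>i<Fc (xs ! 0). of_bool (center (xs ! 0) i))" by simp
    show ?thesis
      unfolding cost_def
      by (intro computable_add computable_mult computable_diff computable_const csize 1 2)
  qed
  have cvalid: "computable 2 (\<lambda>xs. of_bool (valid (xs ! 0) (xs ! 1)))"
  proof -
    have "computable (Suc 2) (\<lambda>ys. of_bool (code_nth (ys ! 2) (ys ! 0) \<in> \<kappa> ` \<Lambda>))"
      using \<Lambda> by (intro computable_mem_finite computable_code_nth computable_nth) auto
    from computable_ball[OF this computable_code_length[OF computable_nth[of 1 2]]]
    have 1: "computable 2 (\<lambda>xs. of_bool (\<forall>i<length (list_decode (xs ! 1)). code_nth (xs ! 1) i \<in> \<kappa> ` \<Lambda>))"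
      by simp
    show ?thesis unfolding valid_def
      by (intro computable_conj computable_eq computable_code_length computable_nth csize 1) auto
  qed
  define sites where "sites n = sorted_key_list_of_set \<iota> (T n)" for n
  define code where "code n v = list_encode (map \<kappa> (map v (sites n)))" for n v
  have sites: "set (sites n) = T n" "length (sites n) = card (T n)" "distinct (sites n)" for n
  proof -
    show "set (sites n) = T n" "length (sites n) = card (T n)"
      unfolding sites_def by (rule sorted_key_list_of_set_facts[OF injT T(2)])+
    then show "distinct (sites n)" by (metis card_distinct)
  qed
  have sites_nth: "rk n (\<iota> x) < length (sites n) \<and> sites n ! rk n (\<iota> x) = x" if "x \<in> T n" for n x
  proof
    show "sites n ! rk n (\<iota> x) = x"
      unfolding rk sites_def by (rule nth_sorted_key_list_of_set[OF injT T(2) that])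
    show "rk n (\<iota> x) < length (sites n)"
      unfolding rk sites using T that by (intro psubset_card_mono) auto
  qed
  have letter: "code_nth (code n v) (rk n (\<iota> x)) = \<kappa> (v x)" if "x \<in> T n" for n v x
    using sites_nth[OF that] by (simp add: code_def)
  have cost: "cost n (code n v) = tile_cost k len l (Suc n) v" if v: "\<And>x. x \<in> T n \<Longrightarrow> v x \<in> \<Lambda>" for n v
  proof -
    have inj: "inj_on \<iota> (centers k (Suc n))"
      using injT[of n] centers_subset(2)[of k "Suc n"] inj_on_subset by (metis T_def)
    have 1: "(\<Sum>u\<in>U. of_bool (mt u n (code n v) (\<iota> z)) * len u) = len (\<lambda>f\<in>F k. v (f \<otimes> z))"
      if z: "z \<in> centers k (Suc n)" for z
    proof -
      have zT: "z \<in> T n" "\<And>f. f \<in> F k \<Longrightarrow> f \<otimes> z \<in> T n" using z by (auto simp: centers_def T_def)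
      have "mt u n (code n v) (\<iota> z) \<longleftrightarrow> u = (\<lambda>f\<in>F k. v (f \<otimes> z))" if "u \<in> U" for u
      proof -
        have "mt u n (code n v) (\<iota> z) \<longleftrightarrow> (\<forall>f\<in>F k. \<kappa> (v (f \<otimes> z)) = \<kappa> (u f))"
          using zT by (simp add: mt_def mu_def el_index letter)
        also have "\<dots> \<longleftrightarrow> (\<forall>f\<in>F k. v (f \<otimes> z) = u f)"
        proof (intro ball_cong refl)
          fix f assume "f \<in> F k"
          then have "v (f \<otimes> z) \<in> \<Lambda>" "u f \<in> \<Lambda>" using zT v that by (auto simp: U_def)
          then show "\<kappa> (v (f \<otimes> z)) = \<kappa> (u f) \<longleftrightarrow> v (f \<otimes> z) = u f" using \<kappa> by (simp add: inj_on_eq_iff)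
        qed
        also have "\<dots> \<longleftrightarrow> u = (\<lambda>f\<in>F k. v (f \<otimes> z))"
          using that unfolding U_def by (auto intro!: PiE_ext[of u])
        finally show ?thesis .
      qed
      moreover have "(\<lambda>f\<in>F k. v (f \<otimes> z)) \<in> U" using zT v by (auto simp: U_def)
      ultimately have "(\<Sum>u\<in>U. of_bool (mt u n (code n v) (\<iota> z)) * len u)
          = (\<Sum>u\<in>U. if u = (\<lambda>f\<in>F k. v (f \<otimes> z)) then len u else 0)" by (intro sum.cong) auto
      then show ?thesis using U \<open>_ \<in> U\<close> by simp
    qed
    have "(\<Sum>i<Fc n. if center n i then \<Sum>u\<in>U. of_bool (mt u n (code n v) i) * len u else 0)
        = (\<Sum>i\<in>{i. i < Fc n \<and> center n i}. \<Sum>u\<in>U. of_bool (mt u n (code n v) i) * len u)"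
      by (simp only: sum.If_cases[OF finite_lessThan]) (simp add: Int_def)
    also have "\<dots> = (\<Sum>z\<in>centers k (Suc n). len (\<lambda>f\<in>F k. v (f \<otimes> z)))"
      unfolding center by (simp only: sum.reindex[OF inj] o_def) (simp add: 1)
    finally have 2: "(\<Sum>i<Fc n. if center n i then \<Sum>u\<in>U. of_bool (mt u n (code n v) i) * len u else 0)
        = (\<Sum>z\<in>centers k (Suc n). len (\<lambda>f\<in>F k. v (f \<otimes> z)))" .
    have "(\<Sum>i<Fc n. of_bool (center n i) :: nat) = card {i. i < Fc n \<and> center n i}"
      by (simp add: of_bool_def sum.If_cases Int_def)
    also have "\<dots> = card (centers k (Suc n))" unfolding center by (rule card_image[OF inj])
    finally show ?thesis unfolding cost_def 2 tile_cost_def size by (simp add: T_def)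
  qed
  have valid_code: "valid n (code n v)" if "v \<in> T n \<rightarrow> \<Lambda>" for n v
    using that nth_mem[of _ "sites n"] unfolding valid_def by (auto simp: code_def sites size)
  have valid_iff: "valid n c \<longleftrightarrow> (\<exists>v\<in>T n \<rightarrow>\<^sub>E \<Lambda>. c = code n v)" for n c
  proof
    assume val: "valid n c"
    define ys where "ys = list_decode c"
    have len_ys: "length ys = length (sites n)" using val by (simp add: valid_def ys_def sites size)
    define v where "v = (\<lambda>x\<in>T n. inv_into \<Lambda> \<kappa> (ys ! rk n (\<iota> x)))"
    have ys: "ys ! i \<in> \<kappa> ` \<Lambda>" if "i < length ys" for i
      using val that by (auto simp: valid_def ys_def code_nth_def)
    have v: "v \<in> T n \<rightarrow>\<^sub>E \<Lambda>"
      unfolding v_def using sites_nth ys len_ys by (auto intro!: inv_into_into)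
    have "map \<kappa> (map v (sites n)) = ys"
    proof (rule nth_equalityI)
      fix i assume "i < length (map \<kappa> (map v (sites n)))"
      then have i: "i < length (sites n)" by simp
      then have x: "sites n ! i \<in> T n" using sites(1) nth_mem by blast
      then have "rk n (\<iota> (sites n ! i)) = i"
        using sites_nth[OF x] i sites(3)[of n] nth_eq_iff_index_eq by blast
      then show "map \<kappa> (map v (sites n)) ! i = ys ! i"
        using i x ys[of i] len_ys by (simp add: v_def f_inv_into_f)
    qed (simp add: len_ys)
    then have "c = code n v" unfolding code_def by (simp add: ys_def)
    then show "\<exists>v\<in>T n \<rightarrow>\<^sub>E \<Lambda>. c = code n v" using v by blast
  next
    assume "\<exists>v\<in>T n \<rightarrow>\<^sub>E \<Lambda>. c = code n v"
    then obtain v where "v \<in> T n \<rightarrow> \<Lambda>" "c = code n v" by (auto simp: PiE_def)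
    then show "valid n c" using valid_code by blast
  qed
  have "\<exists>C. \<forall>n s. \<forall>w\<in>lists \<Lambda>. n < 2 ^ s \<longrightarrow> valid n (list_encode (map \<kappa> w)) \<longrightarrow>
    K0 A w \<le> enat (cost n (list_encode (map \<kappa> w)) + 2 * s + C)"
  proof (rule K0_le_cost[OF opt \<kappa> cvalid ccost])
    show "\<exists>w\<in>lists \<Lambda>. c = list_encode (map \<kappa> w)" if val: "valid n c" for n c
    proof -
      obtain v where v: "v \<in> T n \<rightarrow>\<^sub>E \<Lambda>" "c = code n v" using val[unfolded valid_iff] by blast
      have "map v (sites n) \<in> lists \<Lambda>" using v sites by (auto simp: lists_eq_set)
      then show ?thesis using v(2) unfolding code_def by blast
    qed
    have eq: "{c. valid n c \<and> cost n c = L} \<subseteq> code n ` {v \<in> T n \<rightarrow>\<^sub>E \<Lambda>. tile_cost k len l (Suc n) v = L}" for n L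
      using cost by (force simp: valid_iff PiE_mem)
    have fin: "finite {v \<in> T n \<rightarrow>\<^sub>E \<Lambda>. tile_cost k len l (Suc n) v = L}" for n L
      using T \<Lambda> by (intro finite_subset[OF _ finite_PiE[of "T n" "\<lambda>_. \<Lambda>"]]) auto
    show "finite {c. valid n c \<and> cost n c = L}" for n L
      by (rule finite_subset[OF eq]) (intro finite_imageI fin)
    show "card {c. valid n c \<and> cost n c = L} \<le> 2 ^ L" for n L
    proof -
      have "card {c. valid n c \<and> cost n c = L} \<le> card {v \<in> T n \<rightarrow>\<^sub>E \<Lambda>. tile_cost k len l (Suc n) v = L}"
        using card_mono[OF finite_imageI[OF fin] eq] card_image_le[OF fin] order_trans by blast
      also have "\<dots> \<le> 2 ^ L"
        unfolding T_def using tile_cost_kraft[OF k _ \<Lambda> kraft] by simp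
      finally show ?thesis .
    qed
  qed
  then obtain C where C: "\<And>n s w. w \<in> lists \<Lambda> \<Longrightarrow> n < 2 ^ s \<Longrightarrow> valid n (list_encode (map \<kappa> w)) \<Longrightarrow>
    K0 A w \<le> enat (cost n (list_encode (map \<kappa> w)) + 2 * s + C)" by blast
  have "K0 A (map \<omega> (sorted_key_list_of_set \<iota> (F n))) \<le> enat (tile_cost k len l n \<omega> + 2 * s + C)"
    if n: "n \<ge> 1" "n < 2 ^ s" and \<omega>: "\<omega> \<in> carrier G \<rightarrow> \<Lambda>" for n s \<omega>
  proof -
    \<comment> \<open>The bound is applied at the shifted index \<open>m\<close> with
      \<open>T m = F n\<close>; \<open>m < 2 ^ s\<close> follows from
      \<open>n < 2 ^ s\<close>.\<close>
    obtain m where m: "n = Suc m" using n by (cases n) auto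
    have \<omega>T: "\<omega> \<in> T m \<rightarrow> \<Lambda>" using \<omega> T by blast
    have "K0 A (map \<omega> (sites m)) \<le> enat (cost m (code m \<omega>) + 2 * s + C)"
      unfolding code_def
    proof (rule C)
      show "map \<omega> (sites m) \<in> lists \<Lambda>" using \<omega>T sites by (auto simp: lists_eq_set)
      show "valid m (list_encode (map \<kappa> (map \<omega> (sites m))))" using valid_code[OF \<omega>T] by (simp add: code_def)
    qed (use n m in simp)
    then show ?thesis using cost[of m \<omega>] \<omega>T by (simp add: sites_def T_def m Pi_iff)
  qed
  then show ?thesis by blast
qed

end

section \<open>Tilings and Foelner asymptotics\<close>

context computable_tiling begin

lemma F_card_pos: "n \<ge> 1 \<Longrightarrow> card (F n) > 0"
  using F_finite F_nonempty by (simp add: card_gt_0_iff)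

lemma finite_set_mult: "finite K \<Longrightarrow> finite S \<Longrightarrow> finite (K <#> S)"
  by (simp add: set_mult_def)

lemma left_folner_tendsto:
  assumes "finite K" "K \<noteq> {}" "K \<subseteq> carrier G"
  shows "(\<lambda>n. real (card (sym_diff (F n) (K <#> F n))) / real (card (F n))) \<longlonglongrightarrow> 0"
  using monotiling assms by (simp add: folner_monotiling_def left_folner_def)

lemma card_set_mult_le:
  assumes "finite K" "K \<noteq> {}" "K \<subseteq> carrier G" "\<epsilon> > 0"
  shows "\<forall>\<^sub>F n in sequentially. real (card (K <#> F n)) \<le> (1 + \<epsilon>) * real (card (F n))"
  using order_tendstoD(2)[OF left_folner_tendsto[OF assms(1-3)] assms(4)] eventually_ge_at_top[of 1]
proof eventually_elim
  case (elim n)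
  have "card (K <#> F n) \<le> card (F n \<union> sym_diff (F n) (K <#> F n))"
    using assms F_finite elim by (intro card_mono) (auto intro: finite_set_mult)
  also have "\<dots> \<le> card (F n) + card (sym_diff (F n) (K <#> F n))" by (rule card_Un_le)
  finally have "real (card (K <#> F n)) \<le> real (card (F n)) + real (card (sym_diff (F n) (K <#> F n)))" by linarith
  then show ?case using elim F_card_pos[of n] by (simp add: field_simps)
qed

lemma card_disjoint_tiles:
  assumes k: "k \<ge> 1" and C: "C \<subseteq> Z k" "finite C" and S: "finite S" "\<And>z. z \<in> C \<Longrightarrow> F k #> z \<subseteq> S"
  shows "card C * card (F k) \<le> card S"
proof -
  have "card (\<Union>z\<in>C. F k #> z) = (\<Sum>z\<in>C. card (F k #> z))"
  proof (rule card_UN_disjoint)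
    show "\<forall>i\<in>C. \<forall>j\<in>C. i \<noteq> j \<longrightarrow> (F k #> i) \<inter> (F k #> j) = {}"
      using tiles_disjoint[OF k] C unfolding disjoint_family_on_def by blast
  qed (use C S in \<open>auto intro: finite_subset\<close>)
  also have "\<dots> = card C * card (F k)"
    using card_r_coset[OF F_subset[OF k]] C Z_subset[OF k] by (simp add: subset_iff)
  finally show ?thesis using card_mono[OF S(1), of "\<Union>z\<in>C. F k #> z"] S(2) by auto
qed

definition meeting :: "nat \<Rightarrow> 'a set \<Rightarrow> 'a set" where
  "meeting k S = {z \<in> Z k. (F k #> z) \<inter> S \<noteq> {}}"

lemma meeting_cover:
  assumes "k \<ge> 1" "S \<subseteq> carrier G"
  shows "S \<subseteq> (\<Union>z\<in>meeting k S. F k #> z)"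
  using tiles_cover[OF assms(1)] assms(2) by (fastforce simp: meeting_def)

text \<open>The centre of a tile that meets \<open>S\<close> has the form
  \<open>inv f' \<otimes> s\<close>, so the tile lies in
  \<open>(F k <#> set_inv (F k)) <#> S\<close>. Such tiles are disjoint, hence counted by the size
  of this thickening of \<open>S\<close>.\<close>

lemma
  assumes k: "k \<ge> 1" and S: "S \<subseteq> carrier G" "finite S"
  shows finite_meeting: "finite (meeting k S)"
    and card_meeting: "card (meeting k S) * card (F k) \<le> card ((F k <#> set_inv (F k)) <#> S)"
proof -
  have Fk: "finite (F k)" "F k \<subseteq> carrier G" using F_finite F_subset k by auto
  have z_in: "\<exists>f'\<in>F k. \<exists>s\<in>S. z = inv f' \<otimes> s" if "z \<in> meeting k S" for z
  proof -
    obtain f s where f: "f \<in> F k" "s \<in> S" "s = f \<otimes> z" using \<open>z \<in> meeting k S\<close> by (auto simp: meeting_def r_coset_def)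
    moreover have "z \<in> carrier G" using \<open>z \<in> meeting k S\<close> Z_subset[OF k] by (auto simp: meeting_def)
    ultimately have "z = inv f \<otimes> s" using Fk by (simp add: inv_solve_left subset_iff)
    then show ?thesis using f by blast
  qed
  then have "meeting k S \<subseteq> (\<lambda>(f, s). inv f \<otimes> s) ` (F k \<times> S)" by fastforce
  then show fin: "finite (meeting k S)" using Fk S by (auto intro: finite_subset)
  show "card (meeting k S) * card (F k) \<le> card ((F k <#> set_inv (F k)) <#> S)"
  proof (rule card_disjoint_tiles[OF k _ fin])
    show "meeting k S \<subseteq> Z k" by (auto simp: meeting_def)
    have "finite (set_inv (F k))" using Fk by (simp add: SET_INV_def)
    then show "finite ((F k <#> set_inv (F k)) <#> S)" using Fk S by (intro finite_set_mult)
    fix z assume z: "z \<in> meeting k S"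
    show "F k #> z \<subseteq> (F k <#> set_inv (F k)) <#> S"
    proof
      fix x assume "x \<in> F k #> z"
      then obtain f where f: "f \<in> F k" "x = f \<otimes> z" by (auto simp: r_coset_def)
      obtain f' s where s: "f' \<in> F k" "s \<in> S" "z = inv f' \<otimes> s" using z_in z by blast
      then have "x = (f \<otimes> inv f') \<otimes> s" using f Fk S by (simp add: m_assoc subset_iff)
      then show "x \<in> (F k <#> set_inv (F k)) <#> S"
        using f s unfolding set_mult_def SET_INV_def by blast
    qed
  qed
qed

text \<open>With the Foelner property this bounds the density of \<open>Z k\<close> in
  \<open>F n\<close> by about \<open>1 / card (F k)\<close>, which turns a mean code length per tile
  into one per site.\<close>

lemma card_centers_le:
  assumes k: "k \<ge> 1" and n: "n \<ge> 1"
  shows "card (F n \<inter> Z k) * card (F k) \<le> card (F k <#> F n)"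
proof (rule card_disjoint_tiles[OF k])
  show "finite (F k <#> F n)" using F_finite k n by (intro finite_set_mult) auto
  show "F k #> z \<subseteq> F k <#> F n" if "z \<in> F n \<inter> Z k" for z
    using that by (auto simp: r_coset_def set_mult_def)
qed (use F_finite n in auto)

text \<open>An uncovered site \<open>x = f \<otimes> z\<close> lies in a tile that leaves
  \<open>F n\<close>, so some \<open>f' \<otimes> inv f\<close> moves \<open>x\<close> out of
  \<open>F n\<close>. Only finitely many such multipliers occur, and each moves few sites out of
  \<open>F n\<close> by the left Foelner property.\<close>

lemma uncovered_tendsto:
  assumes k: "k \<ge> 1" and one: "\<And>n. n \<ge> 1 \<Longrightarrow> \<one> \<in> F n"
  shows "(\<lambda>n. real (card (F n) - card (F k) * card (centers k n)) / real (card (F n))) \<longlonglongrightarrow> 0"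
proof -
  have Fk: "finite (F k)" "F k \<subseteq> carrier G" using F_finite F_subset k by auto
  define K where "K = F k <#> set_inv (F k)"
  have K: "finite K" "K \<subseteq> carrier G"
    using Fk by (auto simp: K_def SET_INV_def set_mult_def)
  have bound: "card (F n) - card (F k) * card (centers k n) \<le> (\<Sum>\<kappa>\<in>K. card (sym_diff (F n) ({\<kappa>} <#> F n)))"
    if n: "n \<ge> 1" for n
  proof -
    have Fn: "finite (F n)" "F n \<subseteq> carrier G" using F_finite F_subset n by auto
    define B where "B \<kappa> = {x \<in> F n. \<kappa> \<otimes> x \<notin> F n}" for \<kappa>
    have cB: "card (B \<kappa>) \<le> card (sym_diff (F n) ({\<kappa>} <#> F n))" if "\<kappa> \<in> K" for \<kappa>
    proof -
      have "inj_on ((\<otimes>) \<kappa>) (B \<kappa>)" using that K Fn by (intro inj_onI) (auto simp: B_def subset_iff)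
      then have "card (B \<kappa>) = card ((\<otimes>) \<kappa> ` B \<kappa>)" by (simp add: card_image)
      also have "\<dots> \<le> card (sym_diff (F n) ({\<kappa>} <#> F n))"
        using Fn by (intro card_mono) (auto simp: B_def set_mult_def)
      finally show ?thesis .
    qed
    have "F n - (\<Union>z\<in>centers k n. F k #> z) \<subseteq> (\<Union>\<kappa>\<in>K. B \<kappa>)"
    proof
      fix x assume x: "x \<in> F n - (\<Union>z\<in>centers k n. F k #> z)"
      then obtain z f where z: "z \<in> Z k" "f \<in> F k" "x = f \<otimes> z"
        using tiles_cover[OF k] Fn by (fastforce simp: r_coset_def)
      have zG: "z \<in> carrier G" "f \<in> carrier G" using z Z_subset[OF k] Fk by auto
      show "x \<in> (\<Union>\<kappa>\<in>K. B \<kappa>)"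
      proof (rule ccontr)
        assume "x \<notin> (\<Union>\<kappa>\<in>K. B \<kappa>)"
        then have *: "\<kappa> \<otimes> x \<in> F n" if "\<kappa> \<in> K" for \<kappa> using that x by (auto simp: B_def)
        have "f' \<otimes> z \<in> F n" if f': "f' \<in> F k" for f'
        proof -
          have "f' \<otimes> inv f \<in> K" using f' z by (auto simp: K_def SET_INV_def set_mult_def)
          then have "(f' \<otimes> inv f) \<otimes> x \<in> F n" by (rule *)
          moreover have "(f' \<otimes> inv f) \<otimes> x = f' \<otimes> z"
          proof -
            have "f' \<in> carrier G" using f' Fk by auto
            then show ?thesis using zG z by (simp add: m_assoc inv_solve_left' l_inv)
          qed
          ultimately show ?thesis by simp
        qed
        \<comment> \<open>\<open>\<one> \<in> F k\<close> makes the centre a site of its own tile,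
          which supplies the clause \<open>z \<in> F n\<close> of \<open>centers\<close>.\<close>
        moreover from this[OF one[OF k]] have "z \<in> F n" using zG by simp
        ultimately have "z \<in> centers k n" using z by (simp add: centers_def)
        then show False using x z by (auto simp: r_coset_def)
      qed
    qed
    then have "card (F n - (\<Union>z\<in>centers k n. F k #> z)) \<le> card (\<Union>\<kappa>\<in>K. B \<kappa>)"
      using Fn K by (intro card_mono) (auto simp: B_def)
    also have "\<dots> \<le> (\<Sum>\<kappa>\<in>K. card (B \<kappa>))" by (rule card_UN_le[OF K(1)])
    also have "\<dots> \<le> (\<Sum>\<kappa>\<in>K. card (sym_diff (F n) ({\<kappa>} <#> F n)))" by (intro sum_mono cB)
    finally show ?thesis using card_uncovered[OF k n] by simp
  qed
  have "(\<lambda>n. \<Sum>\<kappa>\<in>K. real (card (sym_diff (F n) ({\<kappa>} <#> F n))) / real (card (F n))) \<longlonglongrightarrow> (\<Sum>\<kappa>\<in>K. 0)"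
    using K by (intro tendsto_sum left_folner_tendsto) auto
  then have lim: "(\<lambda>n. \<Sum>\<kappa>\<in>K. real (card (sym_diff (F n) ({\<kappa>} <#> F n))) / real (card (F n))) \<longlonglongrightarrow> 0" by simp
  show ?thesis
  proof (rule real_tendsto_sandwich[OF _ _ tendsto_const lim])
    show "\<forall>\<^sub>F n in sequentially. real (card (F n) - card (F k) * card (centers k n)) / real (card (F n))
        \<le> (\<Sum>\<kappa>\<in>K. real (card (sym_diff (F n) ({\<kappa>} <#> F n))) / real (card (F n)))"
      using eventually_ge_at_top[of 1]
    proof eventually_elim
      case (elim n)
      have "real (card (F n) - card (F k) * card (centers k n))
          \<le> (\<Sum>\<kappa>\<in>K. real (card (sym_diff (F n) ({\<kappa>} <#> F n))))"
        using bound[OF elim] by (simp only: of_nat_sum[symmetric] of_nat_le_iff)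
      then show ?case by (simp add: sum_divide_distrib[symmetric] divide_right_mono)
    qed
  qed auto
qed

text \<open>Fekete's argument with tiles in place of intervals: \<open>F n\<close> is covered by
  about \<open>card (F n) / card (F k)\<close> tiles at most, so the quotient at \<open>n\<close> is
  eventually at most \<open>1 + \<epsilon>\<close> times the quotient at \<open>k\<close>. The limit
  is therefore the infimum, whence the second conclusion.\<close>

lemma tiling_fekete:
  fixes h :: "'a set \<Rightarrow> real"
  assumes nonneg: "\<And>S. finite S \<Longrightarrow> S \<subseteq> carrier G \<Longrightarrow> 0 \<le> h S"
    and mono: "\<And>S T. finite T \<Longrightarrow> S \<subseteq> T \<Longrightarrow> T \<subseteq> carrier G \<Longrightarrow> h S \<le> h T"
    and tiles: "\<And>S C. finite S \<Longrightarrow> S \<subseteq> carrier G \<Longrightarrow> finite C \<Longrightarrow> C \<subseteq> carrier G \<Longrightarrow>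
      h (\<Union>z\<in>C. S #> z) \<le> real (card C) * h S"
  obtains L where "(\<lambda>n. h (F n) / real (card (F n))) \<longlonglongrightarrow> L"
    and "\<And>k. k \<ge> 1 \<Longrightarrow> L \<le> h (F k) / real (card (F k))" and "0 \<le> L"
proof -
  define a where "a n = h (F n) / real (card (F n))" for n
  have F: "finite (F n)" "F n \<subseteq> carrier G" if "n \<ge> 1" for n using that F_finite F_subset by auto
  have a0: "0 \<le> a n" if "n \<ge> 1" for n using nonneg F that by (simp add: a_def)
  have ev: "\<forall>\<^sub>F n in sequentially. a n \<le> (1 + \<epsilon>) * a k" if k: "k \<ge> 1" and \<epsilon>: "\<epsilon> > 0" for k \<epsilon>
  proof -
    define K where "K = F k <#> set_inv (F k)"
    have K: "finite K" "K \<subseteq> carrier G" "K \<noteq> {}"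
      using F[OF k] F_nonempty[OF k] by (auto simp: K_def SET_INV_def set_mult_def)
    show ?thesis
      using card_set_mult_le[OF K(1,3,2) \<epsilon>] eventually_ge_at_top[of 1]
    proof eventually_elim
      case (elim n)
      define C where "C = meeting k (F n)"
      have C: "finite C" "C \<subseteq> carrier G"
        using finite_meeting[OF k F(2,1)] Z_subset[OF k] elim by (auto simp: C_def meeting_def)
      have tiles_in: "(\<Union>z\<in>C. F k #> z) \<subseteq> carrier G" "finite (\<Union>z\<in>C. F k #> z)"
        using F[OF k] C by (auto simp: r_coset_def)
      have "h (F n) \<le> h (\<Union>z\<in>C. F k #> z)"
        unfolding C_def using meeting_cover[OF k F(2)] elim tiles_in by (intro mono) (auto simp: C_def)
      also have "\<dots> \<le> real (card C) * h (F k)" using F[OF k] C by (intro tiles) auto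
      also have "\<dots> = (real (card C) * real (card (F k))) * a k"
        using F_card_pos[OF k] by (simp add: a_def)
      also have "\<dots> \<le> ((1 + \<epsilon>) * real (card (F n))) * a k"
      proof (rule mult_right_mono[OF _ a0[OF k]])
        have "real (card C) * real (card (F k)) \<le> real (card (K <#> F n))"
          using card_meeting[OF k F(2,1)] elim unfolding C_def K_def by (metis of_nat_le_iff of_nat_mult)
        then show "real (card C) * real (card (F k)) \<le> (1 + \<epsilon>) * real (card (F n))" using elim by linarith
      qed
      finally show ?case using F_card_pos[of n] elim by (simp add: a_def field_simps)
    qed
  qed
  define L where "L = (INF k\<in>{1..}. a k)"
  have bdd: "bdd_below (a ` {1..})" using a0 by (intro bdd_belowI[of _ 0]) auto
  have L_le: "L \<le> a k" if "k \<ge> 1" for k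
    unfolding L_def using that bdd by (intro cINF_lower) auto
  have L0: "0 \<le> L" unfolding L_def using a0 by (intro cINF_greatest) auto
  have "a \<longlonglongrightarrow> L"
  proof (rule order_tendstoI)
    fix x assume "x < L"
    then show "\<forall>\<^sub>F n in sequentially. x < a n"
      using L_le by (intro eventually_mono[OF eventually_ge_at_top[of 1]]) (metis less_le_trans)
  next
    fix x assume x: "L < x"
    then obtain k where k: "k \<ge> 1" "a k < x"
      unfolding L_def using cINF_less_iff[OF _ bdd] by auto
    \<comment> \<open>Chosen so that \<open>(1 + \<epsilon>) * a k < x\<close>; the
      \<open>+ 1\<close> keeps the denominator positive when \<open>a k = 0\<close>.\<close>
    define \<epsilon> where "\<epsilon> = (x - a k) / (2 * (a k + 1))"
    have \<epsilon>: "\<epsilon> > 0" using k a0[OF k(1)] by (simp add: \<epsilon>_def)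
    have "\<epsilon> * (a k + 1) = (x - a k) / 2" using a0[OF k(1)] by (simp add: \<epsilon>_def field_simps)
    then have "(1 + \<epsilon>) * a k < x" using k \<epsilon> by (simp add: algebra_simps)
    then show "\<forall>\<^sub>F n in sequentially. a n < x"
      by (intro eventually_mono[OF ev[OF k(1) \<epsilon>]]) simp
  qed
  then show ?thesis using that[of L] L_le L0 unfolding a_def by blast
qed

end

section \<open>Entropy of itineraries\<close>

text \<open>This is \<open>ln t \<le> t - 1\<close> at \<open>t = 1 / sqrt x\<close>. Unlike
  \<open>- x log x\<close> itself, the bound is monotone, so in \<open>Ent_rare\<close> it passes
  from \<open>p x\<close> to \<open>\<delta>\<close>.\<close>

lemma minus_log_le_sqrt:
  fixes x :: real
  assumes "0 \<le> x"
  shows "- (x * log 2 x) \<le> 2 * sqrt x / ln 2"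
proof (cases "x = 0")
  case False
  then have x: "x > 0" using assms by simp
  have "ln (1 / sqrt x) \<le> 1 / sqrt x - 1" using x by (intro ln_le_minus_one) simp
  then have "- ln x \<le> 2 / sqrt x" using x by (simp add: ln_div ln_sqrt)
  then have "x * (- ln x) \<le> x * (2 / sqrt x)" using x by (intro mult_left_mono) auto
  also have "x * (2 / sqrt x) = 2 * (x / sqrt x)" by simp
  also have "x / sqrt x = sqrt x" using x by (simp add: real_div_sqrt)
  finally show ?thesis using divide_right_mono[of "- (x * ln x)" "2 * sqrt x" "ln 2"] by (simp add: log_def)
qed simp

lemma minus_log_le_one_minus:
  fixes x :: real
  assumes "0 \<le> x" "x \<le> 1"
  shows "- (x * log 2 x) \<le> (1 - x) / ln 2"
proof (cases "x = 0")
  case False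
  then have x: "x > 0" using assms by simp
  have "ln (1 / x) \<le> 1 / x - 1" using x by (intro ln_le_minus_one) simp
  then have "- ln x \<le> 1 / x - 1" using x by (simp add: ln_div)
  then have "x * (- ln x) \<le> x * (1 / x - 1)" using x by (intro mult_left_mono) auto
  then have "- (x * ln x) \<le> 1 - x" using x by (simp add: algebra_simps)
  then show ?thesis using divide_right_mono[of "- (x * ln x)" "1 - x" "ln 2"] by (simp add: log_def)
qed simp

lemma simple_function_preimage:
  "simple_function M X \<Longrightarrow> X -` A \<inter> space M \<in> sets M"
  by (rule simple_functionD(2))

context prob_space begin

sublocale info2: information_space M 2
  by unfold_locales simp

abbreviation Ent :: "('a \<Rightarrow> 'x) \<Rightarrow> real" where
  "Ent X \<equiv> entropy 2 (count_space (X ` space M)) X"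

lemma Ent_eq:
  assumes "simple_function M X"
  shows "Ent X = - (\<Sum>x\<in>X ` space M. prob (X -` {x} \<inter> space M) * log 2 (prob (X -` {x} \<inter> space M)))"
  by (rule info2.entropy_simple_distributed[OF simple_distributedI[OF assms measure_nonneg refl]])

lemma Ent_pair_le:
  assumes "simple_function M X" "simple_function M Y"
  shows "Ent (\<lambda>y. (X y, Y y)) \<le> Ent X + Ent Y"
  using info2.entropy_chain_rule[OF assms] info2.conditional_entropy_less_eq_entropy[OF assms(2,1)] by simp

lemma Ent_cong:
  assumes X: "simple_function M X" and eq: "\<And>y. y \<in> space M \<Longrightarrow> Y y = X y"
  shows "Ent Y = Ent X"
proof -
  have Y: "simple_function M Y" using X eq simple_function_cong[of M X Y] by metis
  have "Y ` space M = X ` space M" using eq by auto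
  moreover have "Y -` {x} \<inter> space M = X -` {x} \<inter> space M" for x using eq by auto
  ultimately show ?thesis unfolding Ent_eq[OF X] Ent_eq[OF Y] by simp
qed

lemma Ent_factor:
  assumes X: "simple_function M X" and eq: "\<And>y. y \<in> space M \<Longrightarrow> Y y = f (X y)"
  shows "Ent Y \<le> Ent X"
proof -
  have "Ent Y = Ent (f \<circ> X)" using X eq by (intro Ent_cong) (auto intro: simple_function_compose)
  then show ?thesis using info2.entropy_data_processing[OF X, of f] by simp
qed

lemma Ent_const: "Ent (\<lambda>_. c) = 0"
  using not_empty prob_space by (subst Ent_eq) (auto simp: image_constant_conv)

lemma Ent_nonneg: "simple_function M X \<Longrightarrow> 0 \<le> Ent X"
  using Ent_factor[of X "\<lambda>_. ()" "\<lambda>_. ()"] Ent_const[of "()"] by simp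

lemma sum_prob_preimages:
  assumes "simple_function M X" "A \<subseteq> X ` space M"
  shows "(\<Sum>x\<in>A. prob (X -` {x} \<inter> space M)) = prob (X -` A \<inter> space M)"
proof -
  have "finite A" using assms simple_functionD(1) finite_subset by metis
  moreover have "X -` A \<inter> space M = (\<Union>x\<in>A. X -` {x} \<inter> space M)" by auto
  ultimately show ?thesis
    using assms by (simp only:) (intro finite_measure_finite_Union[symmetric],
      auto simp: disjoint_family_on_def simple_function_preimage)
qed

text \<open>Gibbs' inequality against the mixture of the uniform distributions on \<open>S\<close> and on the range.\<close>

lemma Ent_concentrated:
  assumes X: "simple_function M X" and S: "finite S" "S \<noteq> {}"
    and \<delta>: "prob {y \<in> space M. X y \<notin> S} \<le> \<delta>"
  shows "Ent X \<le> 1 + log 2 (real (card S)) + \<delta> * log 2 (real (card (X ` space M)))"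
proof -
  define R where "R = X ` space M"
  define p where "p x = prob (X -` {x} \<inter> space M)" for x
  define N where "N = real (card R)"
  define s where "s = real (card S)"
  \<comment> \<open>On each point \<open>q\<close> keeps only one part of the mixture, so its sum is
    at most one. The factors \<open>1 / 2\<close> account for the \<open>1 +\<close> in the
    bound.\<close>
  define q where "q x = (if x \<in> S then 1 / (2 * s) else 1 / (2 * N))" for x
  have finR: "finite R" unfolding R_def using X by (rule simple_functionD(1))
  have "R \<noteq> {}" unfolding R_def using not_empty by auto
  then have N: "N \<ge> 1" using finR unfolding N_def by (simp add: Suc_le_eq card_gt_0_iff)
  have s: "s \<ge> 1" using S by (simp add: s_def Suc_le_eq card_gt_0_iff)
  have q0: "q x > 0" for x using N s by (simp add: q_def)
  have p0: "p x \<ge> 0" for x by (simp add: p_def)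
  have sum_p: "sum p R = 1"
    unfolding p_def R_def using sum_prob_preimages[OF X subset_refl] prob_space
    by (simp add: Int_absorb2 Int_commute subset_vimage_iff image_subset_iff_subset_vimage[symmetric])
  have sum_q: "sum q R \<le> 1"
  proof -
    have "sum q R = (\<Sum>x\<in>R \<inter> S. 1 / (2 * s)) + (\<Sum>x\<in>R - S. 1 / (2 * N))"
      unfolding q_def using finR by (simp add: sum.If_cases Diff_eq)
    also have "\<dots> = real (card (R \<inter> S)) * (1 / (2 * s)) + real (card (R - S)) * (1 / (2 * N))" by simp
    also have "\<dots> \<le> s * (1 / (2 * s)) + N * (1 / (2 * N))"
      using N s finR S by (intro add_mono mult_right_mono) (auto simp: s_def N_def intro!: card_mono)
    finally show ?thesis using N s by simp
  qed
  have term_le: "- (p x * log 2 (p x)) \<le> - (p x * log 2 (q x)) + (q x - p x) / ln 2" for x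
  proof (cases "p x = 0")
    case True
    then show ?thesis using q0[of x] by simp
  next
    case False
    then have px: "p x > 0" using p0[of x] by simp
    have "ln (q x / p x) \<le> q x / p x - 1" using px q0 by (intro ln_le_minus_one) simp
    then have "p x * (ln (q x) - ln (p x)) \<le> p x * (q x / p x - 1)"
      using px q0[of x] by (intro mult_left_mono) (auto simp: ln_div)
    then have "p x * (ln (q x) - ln (p x)) / ln 2 \<le> (q x - p x) / ln 2"
      using px by (intro divide_right_mono) (auto simp: algebra_simps)
    then show ?thesis by (simp add: log_def algebra_simps diff_divide_distrib)
  qed
  have logq: "- log 2 (q x) = (if x \<in> S then 1 + log 2 s else 1 + log 2 N)" for x
    using N s by (simp add: q_def log_divide log_mult)
  have "Ent X = (\<Sum>x\<in>R. - (p x * log 2 (p x)))"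
    using Ent_eq[OF X] by (simp add: R_def p_def sum_negf)
  also have "\<dots> \<le> (\<Sum>x\<in>R. - (p x * log 2 (q x)) + (q x - p x) / ln 2)" by (intro sum_mono term_le)
  also have "\<dots> = (\<Sum>x\<in>R. p x * (- log 2 (q x))) + (sum q R - sum p R) / ln 2"
    by (simp add: sum.distrib sum_divide_distrib[symmetric] sum_subtractf sum_negf)
  also have "\<dots> \<le> (\<Sum>x\<in>R. p x * (- log 2 (q x)))"
    using sum_p sum_q by (simp add: divide_nonpos_pos)
  also have "\<dots> \<le> (\<Sum>x\<in>R. p x * (1 + log 2 s) + (if x \<in> S then 0 else p x * log 2 N))"
    unfolding logq using p0 N s by (intro sum_mono) (auto simp: algebra_simps intro!: mult_nonneg_nonneg)
  also have "\<dots> = (1 + log 2 s) + (\<Sum>x\<in>R - S. p x) * log 2 N"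
    using finR sum_p by (simp add: sum.distrib sum_distrib_right[symmetric] sum.If_cases Diff_eq)
  also have "(\<Sum>x\<in>R - S. p x) = prob (X -` (R - S) \<inter> space M)"
    unfolding p_def by (rule sum_prob_preimages[OF X]) (auto simp: R_def)
  also have "X -` (R - S) \<inter> space M = {y \<in> space M. X y \<notin> S}" by (auto simp: R_def)
  also have "(1 + log 2 s) + prob {y \<in> space M. X y \<notin> S} * log 2 N \<le> (1 + log 2 s) + \<delta> * log 2 N"
    using \<delta> N by (intro add_left_mono mult_right_mono) auto
  finally show ?thesis by (simp add: s_def N_def R_def)
qed

text \<open>The dominant value \<open>x0\<close> contributes at most \<open>\<delta> / ln 2\<close>
  because \<open>1 - p x0 \<le> \<delta>\<close>; every other value has probability at most
  \<open>\<delta>\<close>. What matters is that the bound vanishes with \<open>\<delta>\<close> for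
  fixed \<open>N\<close>.\<close>

lemma Ent_rare:
  assumes X: "simple_function M X" and N: "card (X ` space M) \<le> N"
    and \<delta>: "prob {y \<in> space M. X y \<noteq> x0} \<le> \<delta>"
  shows "Ent X \<le> (\<delta> + 2 * real N * sqrt \<delta>) / ln 2"
proof -
  define R where "R = X ` space M"
  define p where "p x = prob (X -` {x} \<inter> space M)" for x
  have finR: "finite R" unfolding R_def using X by (rule simple_functionD(1))
  have \<delta>0: "\<delta> \<ge> 0" using \<delta> measure_nonneg order_trans by blast
  have bad: "{y \<in> space M. X y \<noteq> x0} = space M - (X -` {x0} \<inter> space M)" by auto
  have px0: "1 - p x0 \<le> \<delta>"
    using \<delta> prob_compl[OF simple_function_preimage[OF X, of "{x0}"]] unfolding bad p_def by simp
  have px: "p x \<le> \<delta>" if "x \<noteq> x0" for x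
  proof -
    have "{y \<in> space M. X y \<noteq> x0} \<in> sets M" unfolding bad using X by (intro sets.Diff sets.top simple_function_preimage)
    then have "p x \<le> prob {y \<in> space M. X y \<noteq> x0}"
      unfolding p_def using that by (intro finite_measure_mono) auto
    then show ?thesis using \<delta> by simp
  qed
  have "Ent X = (\<Sum>x\<in>R. - (p x * log 2 (p x)))"
    using Ent_eq[OF X] by (simp add: R_def p_def sum_negf)
  also have "\<dots> \<le> (\<Sum>x\<in>R. (if x = x0 then \<delta> / ln 2 else 0) + 2 * sqrt \<delta> / ln 2)"
  proof (intro sum_mono)
    fix x assume "x \<in> R"
    show "- (p x * log 2 (p x)) \<le> (if x = x0 then \<delta> / ln 2 else 0) + 2 * sqrt \<delta> / ln 2"
    proof (cases "x = x0")
      case True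
      have "- (p x * log 2 (p x)) \<le> (1 - p x) / ln 2"
        by (rule minus_log_le_one_minus) (auto simp: p_def)
      also have "\<dots> \<le> \<delta> / ln 2" using px0 True by (intro divide_right_mono) auto
      finally show ?thesis using True \<delta>0 by (simp add: add_increasing2)
    next
      case False
      have "- (p x * log 2 (p x)) \<le> 2 * sqrt (p x) / ln 2"
        by (rule minus_log_le_sqrt) (auto simp: p_def)
      also have "\<dots> \<le> 2 * sqrt \<delta> / ln 2" using px[OF False] by (intro divide_right_mono) auto
      finally show ?thesis using False by simp
    qed
  qed
  also have "\<dots> = (if x0 \<in> R then \<delta> / ln 2 else 0) + real (card R) * (2 * sqrt \<delta> / ln 2)"
    using finR by (simp add: sum.distrib)
  also have "\<dots> \<le> \<delta> / ln 2 + real N * (2 * sqrt \<delta> / ln 2)"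
    using \<delta>0 N by (intro add_mono mult_right_mono) (auto simp: R_def)
  finally show ?thesis by (simp add: add_divide_distrib algebra_simps)
qed

end

section \<open>Itineraries under a measure-preserving action\<close>

locale pmp_action = group G for G (structure) +
  fixes M :: "'y measure" and act :: "'a \<Rightarrow> 'y \<Rightarrow> 'y"
  assumes sys: "pmp_system G M act"
begin

sublocale prob_space M
  using sys by (simp add: pmp_system_def)

sublocale action: group_action G "space M" act
  using sys by (simp add: pmp_system_def)

lemma act_space: "g \<in> carrier G \<Longrightarrow> y \<in> space M \<Longrightarrow> act g y \<in> space M"
  by (rule action.element_image) auto

lemma act_mult: "g \<in> carrier G \<Longrightarrow> h \<in> carrier G \<Longrightarrow> y \<in> space M \<Longrightarrow> act (g \<otimes> h) y = act g (act h y)"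
  by (rule action.composition_rule)

lemma act_measurable: "g \<in> carrier G \<Longrightarrow> act g \<in> measurable M M"
  using sys by (simp add: pmp_system_def)

lemma act_one: "y \<in> space M \<Longrightarrow> act \<one> y = y"
  using action.id_eq_one by (metis restrict_apply')

lemma prob_act:
  assumes "g \<in> carrier G" "A \<in> sets M"
  shows "prob (act g -` A \<inter> space M) = prob A"
proof -
  have "prob A = measure (distr M M (act g)) A" using sys assms by (simp add: pmp_system_def)
  then show ?thesis using act_measurable[OF assms(1)] assms(2) by (simp add: measure_distr)
qed

text \<open>A random variable whose level sets are the cells of the join of the pulled-back level
  partitions of \<open>b\<close>; entropies of refined partitions thus become entropies of random
  variables.\<close>

definition itin :: "('y \<Rightarrow> 'c) \<Rightarrow> 'a set \<Rightarrow> 'y \<Rightarrow> 'a \<Rightarrow> 'c" where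
  "itin b T y = (\<lambda>g\<in>T. b (act g y))"

lemma itin_range: "T \<subseteq> carrier G \<Longrightarrow> itin b T ` space M \<subseteq> T \<rightarrow>\<^sub>E b ` space M"
  using act_space by (auto simp: itin_def)

lemma simple_itin:
  assumes b: "simple_function M b" and T: "finite T" "T \<subseteq> carrier G"
  shows "simple_function M (itin b T)"
  unfolding simple_function_def
proof (intro conjI ballI)
  have "finite (T \<rightarrow>\<^sub>E b ` space M)" using T b by (intro finite_PiE) (auto dest: simple_functionD)
  then show "finite (itin b T ` space M)" using itin_range[OF T(2)] finite_subset by blast
  fix u assume "u \<in> itin b T ` space M"
  then have "itin b T -` {u} \<inter> space M = (\<Inter>g\<in>T. act g -` (b -` {u g} \<inter> space M) \<inter> space M) \<inter> space M"
    using T act_space by (auto simp: itin_def fun_eq_iff restrict_def subset_iff) (metis)+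
  moreover have meas: "act g -` (b -` {u g} \<inter> space M) \<inter> space M \<in> sets M" if "g \<in> T" for g
    using that T b by (intro measurable_sets[OF act_measurable] simple_function_preimage) auto
  have "(\<Inter>g\<in>T. act g -` (b -` {u g} \<inter> space M) \<inter> space M) \<inter> space M \<in> sets M"
  proof (cases "T = {}")
    case False
    then show ?thesis by (intro sets.Int sets.finite_INT[OF T(1)] sets.top meas)
  qed simp
  ultimately show "itin b T -` {u} \<inter> space M \<in> sets M" by simp
qed

definition H :: "('y \<Rightarrow> 'c) \<Rightarrow> 'a set \<Rightarrow> real" where
  "H b T = Ent (itin b T)"

lemma H_nonneg: "simple_function M b \<Longrightarrow> finite T \<Longrightarrow> T \<subseteq> carrier G \<Longrightarrow> 0 \<le> H b T"
  unfolding H_def by (intro Ent_nonneg simple_itin)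

lemma H_mono:
  assumes "simple_function M b" "finite T" "S \<subseteq> T" "T \<subseteq> carrier G"
  shows "H b S \<le> H b T"
  unfolding H_def
  by (rule Ent_factor[OF simple_itin, where f = "\<lambda>u. restrict u S"]) (use assms in \<open>auto simp: itin_def Int_absorb1\<close>)

lemma H_Un:
  assumes b: "simple_function M b" and T: "finite T" "T \<subseteq> carrier G" and S: "finite S" "S \<subseteq> carrier G"
  shows "H b (S \<union> T) \<le> H b S + H b T"
proof -
  note sf = simple_itin[OF b S] simple_itin[OF b T]
  have "H b (S \<union> T) \<le> Ent (\<lambda>y. (itin b S y, itin b T y))"
    unfolding H_def
    by (rule Ent_factor[OF simple_function_Pair[OF sf],
          where f = "\<lambda>u. \<lambda>g\<in>S \<union> T. if g \<in> S then fst u g else snd u g"]) (auto simp: itin_def)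
  also have "\<dots> \<le> H b S + H b T" unfolding H_def by (rule Ent_pair_le[OF sf])
  finally show ?thesis .
qed

lemma H_UN:
  assumes b: "simple_function M b" and "finite I"
    and "\<And>i. i \<in> I \<Longrightarrow> finite (S i)" "\<And>i. i \<in> I \<Longrightarrow> S i \<subseteq> carrier G"
  shows "H b (\<Union>i\<in>I. S i) \<le> (\<Sum>i\<in>I. H b (S i))"
  using assms(2-)
proof (induction I)
  case empty
  have "itin b {} = (\<lambda>_. \<lambda>_. undefined)" by (auto simp: itin_def fun_eq_iff)
  then show ?case by (simp add: H_def Ent_const)
next
  case (insert i I)
  have "H b (\<Union>i\<in>insert i I. S i) \<le> H b (S i) + H b (\<Union>i\<in>I. S i)"
    using insert by (simp, intro H_Un[OF b]) auto
  also have "\<dots> \<le> H b (S i) + (\<Sum>i\<in>I. H b (S i))" using insert by simp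
  finally show ?case using insert by simp
qed

lemma Ent_act:
  assumes X: "simple_function M X" and z: "z \<in> carrier G"
  shows "Ent (\<lambda>y. X (act z y)) = Ent X"
proof -
  have surj: "act z ` space M = space M" using action.surj_prop[OF z] .
  have sf: "simple_function M (\<lambda>y. X (act z y))"
    unfolding simple_function_def
  proof (intro conjI ballI)
    show "finite ((\<lambda>y. X (act z y)) ` space M)"
      using simple_functionD(1)[OF X] act_space[OF z] by (auto intro: finite_subset[of _ "X ` space M"])
    show "(\<lambda>y. X (act z y)) -` {x} \<inter> space M \<in> sets M" for x
    proof -
      have "(\<lambda>y. X (act z y)) -` {x} \<inter> space M = act z -` (X -` {x} \<inter> space M) \<inter> space M"
        using act_space[OF z] by auto
      then show ?thesis using measurable_sets[OF act_measurable[OF z] simple_function_preimage[OF X]] by simp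
    qed
  qed
  have range: "(\<lambda>y. X (act z y)) ` space M = X ` space M" using surj by (metis image_image)
  have "prob ((\<lambda>y. X (act z y)) -` {x} \<inter> space M) = prob (X -` {x} \<inter> space M)" for x
  proof -
    have "(\<lambda>y. X (act z y)) -` {x} \<inter> space M = act z -` (X -` {x} \<inter> space M) \<inter> space M"
      using act_space[OF z] by auto
    then show ?thesis using prob_act[OF z simple_function_preimage[OF X]] by simp
  qed
  then show ?thesis using Ent_eq[OF X] Ent_eq[OF sf] unfolding range by simp
qed

text \<open>As \<open>act (t \<otimes> z) y = act t (act z y)\<close>, the labels of
  \<open>y\<close> along \<open>T #> z\<close> are those of \<open>act z y\<close> along
  \<open>T\<close>, and \<open>act z\<close> preserves probabilities.\<close>

lemma H_r_coset:
  assumes b: "simple_function M b" and T: "finite T" "T \<subseteq> carrier G" and z: "z \<in> carrier G"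
  shows "H b (T #> z) \<le> H b T"
proof -
  have sf: "simple_function M (itin b T)" by (rule simple_itin[OF b T])
  have eq: "itin b (T #> z) y = (\<lambda>g\<in>T #> z. itin b T (act z y) (g \<otimes> inv z))" if "y \<in> space M" for y
  proof -
    have "b (act g y) = itin b T (act z y) (g \<otimes> inv z)" if g: "g \<in> T #> z" for g
    proof -
      obtain t where t: "t \<in> T" "g = t \<otimes> z" using g by (auto simp: r_coset_def)
      then have "g \<otimes> inv z = t" using T z by (simp add: m_assoc subset_iff)
      then show ?thesis using t T z \<open>y \<in> space M\<close> by (simp add: itin_def act_mult subset_iff)
    qed
    then show ?thesis by (auto simp: itin_def)
  qed
  have act': "simple_function M (\<lambda>y. itin b T (act z y))"
  proof -
    \<comment> \<open>The itinerary is itself used as a labelling, read at the single site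
      \<open>z\<close>, so that its measurability comes from \<open>simple_itin\<close>.\<close>
    have "simple_function M (itin (itin b T) {z})" by (rule simple_itin[OF sf]) (use z in auto)
    then have "simple_function M ((\<lambda>u. u z) \<circ> itin (itin b T) {z})" by (rule simple_function_compose)
    then show ?thesis by (simp add: itin_def comp_def)
  qed
  have "H b (T #> z) \<le> Ent (\<lambda>y. itin b T (act z y))"
    unfolding H_def
    by (rule Ent_factor[where f = "\<lambda>u. \<lambda>g\<in>T #> z. u (g \<otimes> inv z)", OF act' eq])
  also have "\<dots> = H b T" unfolding H_def by (rule Ent_act[OF sf z])
  finally show ?thesis .
qed

lemma Ent_le_card:
  assumes X: "simple_function M X" and "X ` space M \<subseteq> A" "finite A"
  shows "Ent X \<le> log 2 (real (card A))"
proof -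
  have "Ent X \<le> log 2 (real (card (X ` space M)))"
    by (rule info2.entropy_le_card[OF simple_distributedI[OF X measure_nonneg refl]])
  also have "\<dots> \<le> log 2 (real (card A))"
    using assms not_empty by (intro log_mono) (auto simp: card_gt_0_iff finite_subset intro: card_mono)
  finally show ?thesis .
qed

lemma H_le_card:
  assumes b: "simple_function M b" and T: "finite T" "T \<subseteq> carrier G"
  shows "H b T \<le> real (card T) * log 2 (real (card (b ` space M)))"
proof -
  have fin: "finite (b ` space M)" using b by (rule simple_functionD(1))
  have "H b T \<le> log 2 (real (card (T \<rightarrow>\<^sub>E b ` space M)))"
    unfolding H_def using T fin by (intro Ent_le_card[OF simple_itin[OF b T] itin_range[OF T(2)]] finite_PiE) auto
  also have "\<dots> = real (card T) * log 2 (real (card (b ` space M)))"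
    using T fin not_empty by (simp add: card_PiE log_nat_power card_gt_0_iff)
  finally show ?thesis .
qed

lemma H_le_Ent:
  assumes b: "simple_function M b" and T: "finite T" "T \<subseteq> carrier G"
  shows "H b T \<le> real (card T) * Ent b"
proof -
  have "H b {g} \<le> Ent b" if "g \<in> carrier G" for g
  proof -
    have "H b ({\<one>} #> g) \<le> H b {\<one>}" using that by (intro H_r_coset[OF b]) auto
    also have "H b {\<one>} \<le> Ent b"
      unfolding H_def by (rule Ent_factor[OF b, where f = "\<lambda>x. \<lambda>g\<in>{\<one>}. x"]) (auto simp: itin_def act_one)
    finally show ?thesis using that by (simp add: r_coset_def)
  qed
  then have "(\<Sum>g\<in>T. H b {g}) \<le> (\<Sum>g\<in>T. Ent b)" using T by (intro sum_mono) auto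
  moreover have "H b (\<Union>g\<in>T. {g}) \<le> (\<Sum>g\<in>T. H b {g})" using T by (intro H_UN[OF b]) auto
  ultimately show ?thesis by simp
qed

text \<open>At \<open>act g y\<close> the window \<open>K\<close> reads the labels of
  \<open>y\<close> at the sites \<open>k \<otimes> g\<close>, so \<open>b\<close> along
  \<open>K <#> T\<close> determines \<open>c\<close> along \<open>T\<close>.\<close>

lemma H_factor:
  assumes b: "simple_function M b" and T: "finite T" "T \<subseteq> carrier G" and K: "finite K" "K \<subseteq> carrier G"
    and c: "\<And>y. y \<in> space M \<Longrightarrow> c y = \<phi> (itin b K y)"
  shows "H c T \<le> H b (K <#> T)"
  unfolding H_def
proof (rule Ent_factor[OF simple_itin[OF b]])
  show "finite (K <#> T)" "K <#> T \<subseteq> carrier G" using T K by (auto simp: set_mult_def)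
  show "itin c T y = (\<lambda>u. \<lambda>g\<in>T. \<phi> (\<lambda>k\<in>K. u (k \<otimes> g))) (itin b (K <#> T) y)" if y: "y \<in> space M" for y
  proof -
    have "c (act g y) = \<phi> (\<lambda>k\<in>K. itin b (K <#> T) y (k \<otimes> g))" if g: "g \<in> T" for g
    proof -
      have "itin b K (act g y) = (\<lambda>k\<in>K. itin b (K <#> T) y (k \<otimes> g))"
      proof -
        have "b (act k (act g y)) = itin b (K <#> T) y (k \<otimes> g)" if "k \<in> K" for k
        proof -
          have "k \<otimes> g \<in> K <#> T" using that g by (auto simp: set_mult_def)
          then show ?thesis using that g y K T by (simp add: itin_def act_mult subset_iff)
        qed
        then show ?thesis by (auto simp: itin_def)
      qed
      then show ?thesis using c[of "act g y"] act_space y g T by (simp add: subset_iff)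
    qed
    then show ?thesis by (auto simp: itin_def)
  qed
qed

lemma H_pointwise:
  assumes b: "simple_function M b" and T: "finite T" "T \<subseteq> carrier G"
    and c: "\<And>y. y \<in> space M \<Longrightarrow> c y = \<phi> (b y)"
  shows "H c T \<le> H b T"
proof -
  have "{\<one>} <#> T = T" using T by (auto simp: set_mult_def subset_iff)
  moreover have "H c T \<le> H b ({\<one>} <#> T)"
    by (rule H_factor[OF b T, where \<phi> = "\<lambda>u. \<phi> (u \<one>)"]) (auto simp: itin_def act_one c)
  ultimately show ?thesis by simp
qed

lemma H_pair_le:
  assumes b: "simple_function M b" and c: "simple_function M c" and T: "finite T" "T \<subseteq> carrier G"
  shows "H (\<lambda>y. (b y, c y)) T \<le> H b T + H c T"
proof -
  note sf = simple_itin[OF b T] simple_itin[OF c T]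
  have "H (\<lambda>y. (b y, c y)) T \<le> Ent (\<lambda>y. (itin b T y, itin c T y))"
    unfolding H_def
    by (rule Ent_factor[OF simple_function_Pair[OF sf], where f = "\<lambda>u. \<lambda>g\<in>T. (fst u g, snd u g)"])
      (auto simp: itin_def)
  also have "\<dots> \<le> H b T + H c T" unfolding H_def by (rule Ent_pair_le[OF sf])
  finally show ?thesis .
qed

section \<open>Partitions as labellings\<close>

lemma level_sets_entropy:
  assumes X: "simple_function M X"
  shows "partition_entropy M ((\<lambda>x. X -` {x} \<inter> space M) ` (X ` space M)) = Ent X"
proof -
  have "inj_on (\<lambda>x. X -` {x} \<inter> space M) (X ` space M)" by (rule inj_onI) auto
  then show ?thesis unfolding partition_entropy_def Ent_eq[OF X] by (subst sum.reindex) auto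
qed

definition cell :: "'y set set \<Rightarrow> 'y \<Rightarrow> 'y set" where
  "cell \<alpha> y = (THE B. B \<in> \<alpha> \<and> y \<in> B)"

lemma cell_eq:
  assumes "partition_on (space M) \<alpha>" "B \<in> \<alpha>" "y \<in> B"
  shows "cell \<alpha> y = B"
  unfolding cell_def using assms
  by (intro the_equality) (auto simp: partition_on_def disjoint_def)

lemma cell:
  assumes "partition_on (space M) \<alpha>" "y \<in> space M"
  shows "cell \<alpha> y \<in> \<alpha>" "y \<in> cell \<alpha> y"
proof -
  obtain B where "B \<in> \<alpha>" "y \<in> B" using assms by (auto simp: partition_on_def)
  then show "cell \<alpha> y \<in> \<alpha>" "y \<in> cell \<alpha> y" using cell_eq[OF assms(1)] by auto
qed

lemma simple_cell:
  assumes "finite_measurable_partition M \<alpha>"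
  shows "simple_function M (cell \<alpha>)"
  unfolding simple_function_def
proof (intro conjI ballI)
  have p: "partition_on (space M) \<alpha>" "finite \<alpha>" "\<alpha> \<subseteq> sets M"
    using assms by (auto simp: finite_measurable_partition_def)
  show "finite (cell \<alpha> ` space M)" using cell(1)[OF p(1)] p(2) by (auto intro: finite_subset)
  fix B assume "B \<in> cell \<alpha> ` space M"
  then have B: "B \<in> \<alpha>" using cell(1)[OF p(1)] by auto
  have "cell \<alpha> -` {B} \<inter> space M = B"
  proof (intro equalityI subsetI)
    fix y assume "y \<in> cell \<alpha> -` {B} \<inter> space M"
    then show "y \<in> B" using cell(2)[OF p(1), of y] by simp
  next
    fix y assume "y \<in> B"
    then show "y \<in> cell \<alpha> -` {B} \<inter> space M"
      using cell_eq[OF p(1) B] p(3) B sets.sets_into_space[of B M] by auto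
  qed
  then show "cell \<alpha> -` {B} \<inter> space M \<in> sets M" using B p(3) by auto
qed

text \<open>Both sides consist of the sets \<open>E y\<close> of points with the itinerary of
  \<open>y\<close>. In the common refinement, sets chosen from the partitions with a common point
  \<open>y\<close> are the ones that contain \<open>y\<close>.\<close>

lemma refined_partition_eq:
  assumes \<alpha>: "partition_on (space M) \<alpha>" and T: "T \<noteq> {}" "T \<subseteq> carrier G"
  shows "refined_partition M act \<alpha> T
    = (\<lambda>x. itin (cell \<alpha>) T -` {x} \<inter> space M) ` (itin (cell \<alpha>) T ` space M)"
proof -
  define Q where "Q g = (\<lambda>A. act g -` A \<inter> space M) ` \<alpha>" for g
  define E where "E y = {y' \<in> space M. \<forall>g\<in>T. act g y' \<in> cell \<alpha> (act g y)}" for y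
  have E: "itin (cell \<alpha>) T -` {itin (cell \<alpha>) T y} \<inter> space M = E y" if y: "y \<in> space M" for y
  proof -
    have "cell \<alpha> (act g y') = cell \<alpha> (act g y) \<longleftrightarrow> act g y' \<in> cell \<alpha> (act g y)"
      if "g \<in> T" "y' \<in> space M" for g y'
      using that y T cell[OF \<alpha>, of "act g y"] cell[OF \<alpha>, of "act g y'"] cell_eq[OF \<alpha>]
        act_space[of g] by (metis subsetD)
    then show ?thesis by (auto simp: E_def itin_def fun_eq_iff restrict_def) metis
  qed
  have Q_cell: "act g -` cell \<alpha> (act g y) \<inter> space M \<in> Q g" "y \<in> act g -` cell \<alpha> (act g y) \<inter> space M"
    if "g \<in> T" "y \<in> space M" for g y
    using that T cell[OF \<alpha>] act_space[of g y] by (auto simp: Q_def)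
  have Q_uniq: "B = act g -` cell \<alpha> (act g y) \<inter> space M" if "B \<in> Q g" "y \<in> B" for B g y
    using that cell_eq[OF \<alpha>] by (auto simp: Q_def)
  have "common_refinement (Q ` T) = E ` space M"
  proof (intro equalityI subsetI)
    fix B assume "B \<in> common_refinement (Q ` T)"
    then obtain f where f: "f \<in> (\<Pi> P\<in>Q ` T. P)" "B = \<Inter> (f ` Q ` T)" "B \<noteq> {}"
      unfolding common_refinement by blast
    then obtain y where y: "y \<in> B" by auto
    have "f (Q g) = act g -` cell \<alpha> (act g y) \<inter> space M" if "g \<in> T" for g
      using f y that by (intro Q_uniq) auto
    moreover have "y \<in> space M" using y f T calculation by auto
    ultimately show "B \<in> E ` space M" using f T by (intro image_eqI[of _ _ y]) (auto simp: E_def)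
  next
    fix B assume "B \<in> E ` space M"
    then obtain y where y: "y \<in> space M" "B = E y" by auto
    \<comment> \<open>The choice has to depend on the partition and not on \<open>g\<close>, since
      different \<open>g\<close> may give the same \<open>Q g\<close>; choosing the set that
      contains \<open>y\<close> respects this.\<close>
    define f where "f P = (SOME B. B \<in> P \<and> y \<in> B)" for P :: "'y set set"
    have f: "f (Q g) \<in> Q g \<and> y \<in> f (Q g)" if "g \<in> T" for g
      unfolding f_def using Q_cell[OF that y(1)] by (rule_tac someI) blast
    then have feq: "f (Q g) = act g -` cell \<alpha> (act g y) \<inter> space M" if "g \<in> T" for g
      using that by (intro Q_uniq) auto
    have "B = \<Inter> (f ` Q ` T)" using T feq unfolding y(2) E_def by auto
    moreover have "y \<in> B" unfolding y(2) E_def using y T cell[OF \<alpha>] act_space by (auto simp: subset_iff)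
    ultimately show "B \<in> common_refinement (Q ` T)"
      unfolding common_refinement using f by blast
  qed
  moreover have "(\<lambda>x. itin (cell \<alpha>) T -` {x} \<inter> space M) ` (itin (cell \<alpha>) T ` space M) = E ` space M"
    unfolding image_image using E by (intro image_cong) auto
  ultimately show ?thesis by (simp add: refined_partition_def Q_def)
qed

lemma partition_entropy_refined:
  assumes \<alpha>: "finite_measurable_partition M \<alpha>" and T: "finite T" "T \<noteq> {}" "T \<subseteq> carrier G"
  shows "partition_entropy M (refined_partition M act \<alpha> T) = H (cell \<alpha>) T"
proof -
  have "partition_on (space M) \<alpha>" using \<alpha> by (simp add: finite_measurable_partition_def)
  then show ?thesis
    unfolding H_def using T by (simp add: refined_partition_eq level_sets_entropy simple_itin simple_cell[OF \<alpha>])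
qed

end

section \<open>Entropy rates and subshifts\<close>

locale tiling_action = computable_tiling G \<iota> F Z + pmp_action G M act
  for G :: "('a, 'b) monoid_scheme" (structure) and \<iota> F Z and M :: "'y measure" and act
begin

definition hrate :: "('y \<Rightarrow> 'c) \<Rightarrow> real" where
  "hrate b = lim (\<lambda>n. H b (F n) / real (card (F n)))"

text \<open>\<open>H b\<close> is monotone, subadditive and does not grow under right translation,
  so \<open>tiling_fekete\<close> applies. That the limit is an infimum lets the lower bound compare
  \<open>hrate\<close> with the entropy at a single \<open>n\<close>.\<close>

lemma
  assumes b: "simple_function M b"
  shows hrate_tendsto: "(\<lambda>n. H b (F n) / real (card (F n))) \<longlonglongrightarrow> hrate b"
    and hrate_le: "k \<ge> 1 \<Longrightarrow> hrate b \<le> H b (F k) / real (card (F k))"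
    and hrate_nonneg: "0 \<le> hrate b"
proof -
  have tiles: "H b (\<Union>z\<in>C. S #> z) \<le> real (card C) * H b S"
    if S: "finite S" "S \<subseteq> carrier G" and C: "finite C" "C \<subseteq> carrier G" for S C
  proof -
    have "H b (\<Union>z\<in>C. S #> z) \<le> (\<Sum>z\<in>C. H b (S #> z))"
      using S C by (intro H_UN[OF b]) (auto simp: r_coset_def)
    also have "\<dots> \<le> (\<Sum>z\<in>C. H b S)" using S C by (intro sum_mono H_r_coset[OF b]) auto
    finally show ?thesis by simp
  qed
  obtain L where L: "(\<lambda>n. H b (F n) / real (card (F n))) \<longlonglongrightarrow> L"
    "\<And>k. k \<ge> 1 \<Longrightarrow> L \<le> H b (F k) / real (card (F k))" "0 \<le> L"
    by (rule tiling_fekete[of "H b"]) (use H_nonneg[OF b] H_mono[OF b] tiles in auto)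
  have "hrate b = L" unfolding hrate_def by (rule limI[OF L(1)])
  then show "(\<lambda>n. H b (F n) / real (card (F n))) \<longlonglongrightarrow> hrate b"
    "k \<ge> 1 \<Longrightarrow> hrate b \<le> H b (F k) / real (card (F k))" "0 \<le> hrate b"
    using L by auto
qed

lemma entropy_rate_eq:
  assumes "finite_measurable_partition M \<alpha>"
  shows "entropy_rate M act F \<alpha> = hrate (cell \<alpha>)"
proof -
  have ev: "\<forall>\<^sub>F n in sequentially. H (cell \<alpha>) (F n) / real (card (F n))
      = partition_entropy M (refined_partition M act \<alpha> (F n)) / real (card (F n))"
    using eventually_ge_at_top[of 1]
    by eventually_elim (simp add: partition_entropy_refined[OF assms F_finite F_nonempty F_subset])
  show ?thesis
    unfolding entropy_rate_def
    by (rule limI[OF Lim_transform_eventually[OF hrate_tendsto[OF simple_cell[OF assms]] ev]])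
qed

text \<open>The Kolmogorov-Sinai generator theorem, with "generating" only required for the label \<open>c\<close>.\<close>

lemma hrate_le_hrate:
  assumes b: "simple_function M b" and c: "simple_function M c"
    and gen: "\<And>\<delta>. \<delta> > 0 \<Longrightarrow> \<exists>K \<phi>. finite K \<and> K \<subseteq> carrier G \<and>
      prob {y \<in> space M. c y \<noteq> \<phi> (itin b K y)} \<le> \<delta>"
  shows "hrate c \<le> hrate b"
proof -
  define N where "N = Suc (card (c ` space M))"
  have main: "hrate c \<le> hrate b + (\<delta> + 2 * real N * sqrt \<delta>) / ln 2" if \<delta>: "\<delta> > 0" for \<delta>
  proof -
    obtain K \<phi> where K: "finite K" "K \<subseteq> carrier G" and \<phi>: "prob {y \<in> space M. c y \<noteq> \<phi> (itin b K y)} \<le> \<delta>"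
      using gen[OF \<delta>] by blast
    define c' where "c' y = \<phi> (itin b K y)" for y
    \<comment> \<open>\<open>d\<close> records the correction where the guess \<open>c'\<close>
      fails. The pair \<open>(c', d)\<close> determines \<open>c\<close>, and \<open>d\<close> has
      small entropy because it is rarely different from \<open>None\<close>.\<close>
    define d where "d y = (if c y = c' y then None else Some (c y))" for y
    have c': "simple_function M c'"
      using simple_function_compose[OF simple_itin[OF b K], of \<phi>] by (simp add: c'_def[abs_def] comp_def)
    have d: "simple_function M d"
      using simple_function_compose[OF simple_function_Pair[OF c c'], of "\<lambda>(u, v). if u = v then None else Some u"]
      by (simp add: d_def[abs_def] comp_def)
    have "card (d ` space M) \<le> card (insert None (Some ` c ` space M))"
      using simple_functionD(1)[OF c] by (intro card_mono) (auto simp: d_def)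
    also have "\<dots> \<le> N"
      using simple_functionD(1)[OF c] by (simp add: N_def card_insert_if card_image)
    finally have cardd: "card (d ` space M) \<le> N" .
    have "{y \<in> space M. d y \<noteq> None} = {y \<in> space M. c y \<noteq> \<phi> (itin b K y)}" by (auto simp: d_def c'_def)
    then have Ed: "Ent d \<le> (\<delta> + 2 * real N * sqrt \<delta>) / ln 2" using \<phi> by (intro Ent_rare[OF d cardd, where ?x0.0 = None]) (simp only:)
    \<comment> \<open>The Foelner condition speaks of non-empty sets only, and \<open>K\<close> may
      be empty.\<close>
    define K' where "K' = insert \<one> K"
    have K': "finite K'" "K' \<noteq> {}" "K' \<subseteq> carrier G" using K by (auto simp: K'_def)
    define l where "l = log 2 (real (card (b ` space M)))"
    have l: "l \<ge> 0"
      using simple_functionD(1)[OF b] not_empty by (simp add: l_def Suc_le_eq card_gt_0_iff)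
    define r where "r n = real (card (sym_diff (F n) (K' <#> F n))) / real (card (F n))" for n
    have r: "r \<longlonglongrightarrow> 0" unfolding r_def by (rule left_folner_tendsto[OF K'])
    have bound: "H c (F n) / real (card (F n)) \<le> H b (F n) / real (card (F n)) + r n * l + Ent d" if n: "n \<ge> 1" for n
    proof -
      have Fn: "finite (F n)" "F n \<subseteq> carrier G" using F_finite F_subset n by auto
      have KF: "finite (K' <#> F n)" "K' <#> F n \<subseteq> carrier G"
        using K' Fn by (auto simp: set_mult_def)
      \<comment> \<open>Passing from \<open>F n\<close> to the window around it adds only the sites
        \<open>D\<close>, each costing at most \<open>l\<close>; their number is negligible by the
        Foelner property.\<close>
      define D where "D = (K' <#> F n) - F n"
      have D: "finite D" "D \<subseteq> carrier G" using KF by (auto simp: D_def)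
      have "H c (F n) \<le> H (\<lambda>y. (c' y, d y)) (F n)"
        by (rule H_pointwise[OF simple_function_Pair[OF c' d] Fn, where \<phi> = "\<lambda>(u, v). case v of None \<Rightarrow> u | Some s \<Rightarrow> s"])
          (simp add: d_def)
      also have "\<dots> \<le> H c' (F n) + H d (F n)" by (rule H_pair_le[OF c' d Fn])
      also have "H c' (F n) \<le> H b (K <#> F n)"
        by (rule H_factor[OF b Fn K]) (simp add: c'_def)
      also have "H b (K <#> F n) \<le> H b (F n \<union> D)"
      proof (rule H_mono[OF b])
        show "finite (F n \<union> D)" "F n \<union> D \<subseteq> carrier G" using Fn D by auto
        show "K <#> F n \<subseteq> F n \<union> D" by (auto simp: D_def K'_def set_mult_def)
      qed
      also have "H b (F n \<union> D) \<le> H b (F n) + H b D" by (rule H_Un[OF b D Fn])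
      also have "H b D \<le> real (card D) * l" unfolding l_def by (rule H_le_card[OF b D])
      also have "real (card D) * l \<le> real (card (sym_diff (F n) (K' <#> F n))) * l"
        using l Fn KF by (intro mult_right_mono of_nat_mono card_mono) (auto simp: D_def)
      also have "H d (F n) \<le> real (card (F n)) * Ent d" by (rule H_le_Ent[OF d Fn])
      finally have "H c (F n) \<le> H b (F n) + real (card (sym_diff (F n) (K' <#> F n))) * l + real (card (F n)) * Ent d"
        by simp
      then have "H c (F n) / real (card (F n))
          \<le> (H b (F n) + real (card (sym_diff (F n) (K' <#> F n))) * l + real (card (F n)) * Ent d) / real (card (F n))"
        by (rule divide_right_mono) simp
      then show ?thesis using F_card_pos[OF n] by (simp add: r_def add_divide_distrib)
    qed
    have "hrate c \<le> hrate b + 0 * l + Ent d"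
    proof (rule tendsto_le[OF _ _ hrate_tendsto[OF c]])
      show "(\<lambda>n. H b (F n) / real (card (F n)) + r n * l + Ent d) \<longlonglongrightarrow> hrate b + 0 * l + Ent d"
        by (intro tendsto_intros hrate_tendsto[OF b] r)
      show "\<forall>\<^sub>F n in sequentially. H c (F n) / real (card (F n)) \<le> H b (F n) / real (card (F n)) + r n * l + Ent d"
        using eventually_ge_at_top[of 1] by eventually_elim (rule bound)
    qed simp
    then show ?thesis using Ed by simp
  qed
  have "(\<lambda>m. hrate b + (inverse (real (Suc m)) + 2 * real N * sqrt (inverse (real (Suc m)))) / ln 2)
      \<longlonglongrightarrow> hrate b + (0 + 2 * real N * sqrt 0) / ln 2"
    by (intro tendsto_intros LIMSEQ_inverse_real_of_nat) auto
  then have "hrate c \<le> hrate b + (0 + 2 * real N * sqrt 0) / ln 2"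
    by (rule LIMSEQ_le_const) (use main in \<open>auto intro!: exI[of _ 0]\<close>)
  then show ?thesis by simp
qed

text \<open>Partitions enter as labellings by their own cells, hence the type of \<open>c\<close> in
  the hypothesis. Conversely the level sets of \<open>b\<close> form a partition whose cell at
  \<open>y\<close> determines \<open>b y\<close>, so the supremum reaches
  \<open>hrate b\<close>.\<close>

lemma KS_entropy_eq:
  assumes b: "simple_function M b"
    and gen: "\<And>(c :: 'y \<Rightarrow> 'y set) \<delta>. simple_function M c \<Longrightarrow> \<delta> > 0 \<Longrightarrow>
      \<exists>K \<phi>. finite K \<and> K \<subseteq> carrier G \<and> prob {y \<in> space M. c y \<noteq> \<phi> (itin b K y)} \<le> \<delta>"
  shows "KS_entropy M act F = ereal (hrate b)"
proof (rule antisym)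
  show "KS_entropy M act F \<le> ereal (hrate b)"
    unfolding KS_entropy_def
    using hrate_le_hrate[OF b simple_cell gen[OF simple_cell]]
    by (intro SUP_least) (simp add: entropy_rate_eq)
next
  define \<alpha> where "\<alpha> = (\<lambda>x. b -` {x} \<inter> space M) ` (b ` space M)"
  have part: "partition_on (space M) \<alpha>"
    by (rule partition_onI) (auto simp: \<alpha>_def disjnt_def)
  have fmp: "finite_measurable_partition M \<alpha>"
    unfolding finite_measurable_partition_def
  proof (intro conjI part)
    show "finite \<alpha>" using simple_functionD(1)[OF b] by (simp add: \<alpha>_def)
    show "\<alpha> \<subseteq> sets M" using simple_function_preimage[OF b] by (auto simp: \<alpha>_def)
  qed
  have cell: "cell \<alpha> y = b -` {b y} \<inter> space M" if "y \<in> space M" for y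
    using that by (intro cell_eq[OF part]) (auto simp: \<alpha>_def)
  have "H b (F n) \<le> H (cell \<alpha>) (F n)" if "n \<ge> 1" for n
  proof (rule H_pointwise[OF simple_cell[OF fmp] F_finite[OF that] F_subset[OF that]])
    fix y assume y: "y \<in> space M"
    have "\<exists>y'. y' \<in> cell \<alpha> y" using y cell by auto
    then have "(SOME y'. y' \<in> cell \<alpha> y) \<in> cell \<alpha> y" by (rule someI_ex)
    then show "b y = (\<lambda>B. b (SOME y'. y' \<in> B)) (cell \<alpha> y)" using cell[OF y] by simp
  qed
  then have "hrate b \<le> hrate (cell \<alpha>)"
    by (intro tendsto_le[OF _ hrate_tendsto[OF simple_cell[OF fmp]] hrate_tendsto[OF b]]
        eventually_mono[OF eventually_ge_at_top[of 1]] divide_right_mono) auto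
  then have "ereal (hrate b) \<le> ereal (entropy_rate M act F \<alpha>)" by (simp add: entropy_rate_eq[OF fmp])
  also have "\<dots> \<le> KS_entropy M act F"
    unfolding KS_entropy_def using fmp by (intro SUP_upper) simp
  finally show "ereal (hrate b) \<le> KS_entropy M act F" .
qed

end

section \<open>The letter at the identity generates a subshift\<close>

locale subshift_system = computable_tiling G \<iota> F Z
  for G :: "('a, 'b) monoid_scheme" (structure) and \<iota> F Z +
  fixes \<Lambda> :: "'l set" and X :: "('a \<Rightarrow> 'l) set" and \<mu> :: "('a \<Rightarrow> 'l) measure"
  assumes finite_alphabet: "finite \<Lambda>"
    and subshift: "subshift G \<Lambda> X"
    and sets_\<mu>: "sets \<mu> = sets (borel_of (subtopology (full_shift G \<Lambda>) X))"
    and pmp: "pmp_system G \<mu> (shift_action G X)"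
begin

sublocale tiling_action G \<iota> F Z \<mu> "shift_action G X"
  by unfold_locales (rule pmp)

lemma X_subset: "X \<subseteq> carrier G \<rightarrow>\<^sub>E \<Lambda>"
  using subshift closedin_subset by (fastforce simp: subshift_def full_shift_def)

lemma sets_borel_of: "sets (borel_of T) = sigma_sets (topspace T) {U. openin T U}"
  unfolding borel_of_def by (rule sets_measure_of) (auto dest: openin_subset)

lemma topspace_X: "topspace (subtopology (full_shift G \<Lambda>) X) = X"
  using X_subset by (auto simp: full_shift_def)

lemma space_\<mu>: "space \<mu> = X"
proof -
  have "space (borel_of (subtopology (full_shift G \<Lambda>) X)) = X"
    unfolding borel_of_def using topspace_X by (simp add: space_measure_of_conv)
  then show ?thesis using sets_eq_imp_space_eq[OF sets_\<mu>] by simp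
qed

lemma sets_\<mu>_eq: "sets \<mu> = sigma_sets X {U. openin (subtopology (full_shift G \<Lambda>) X) U}"
  unfolding sets_\<mu> sets_borel_of topspace_X ..

definition letter :: "('a \<Rightarrow> 'l) \<Rightarrow> 'l" where
  "letter \<omega> = \<omega> \<one>"

text \<open>The point \<open>g \<omega>\<close> has the letter \<open>\<omega> g\<close> at
  \<open>\<one>\<close>, so reading this letter along the orbit spells out
  \<open>\<omega>\<close>.\<close>

lemma itin_letter: "\<omega> \<in> X \<Longrightarrow> T \<subseteq> carrier G \<Longrightarrow> itin letter T \<omega> = restrict \<omega> T"
  by (auto simp: itin_def letter_def shift_action_def subset_iff)

lemma simple_letter: "simple_function \<mu> letter"
  unfolding simple_function_def space_\<mu>
proof (intro conjI ballI)
  have range: "letter ` X \<subseteq> \<Lambda>" using X_subset by (auto simp: letter_def)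
  then show "finite (letter ` X)" using finite_alphabet finite_subset by blast
  fix a assume "a \<in> letter ` X"
  have "openin (full_shift G \<Lambda>) {\<omega> \<in> topspace (full_shift G \<Lambda>). \<omega> \<one> \<in> {a}}"
    unfolding full_shift_def
    by (rule openin_continuous_map_preimage[OF continuous_map_product_projection])
      (use range \<open>a \<in> letter ` X\<close> in auto)
  then have "openin (subtopology (full_shift G \<Lambda>) X) (letter -` {a} \<inter> X)"
    unfolding openin_subtopology using X_subset
    by (intro exI[of _ "{\<omega> \<in> topspace (full_shift G \<Lambda>). \<omega> \<one> \<in> {a}}"]) (auto simp: full_shift_def letter_def)
  then show "letter -` {a} \<inter> X \<in> sets \<mu>" unfolding sets_\<mu>_eq by (intro sigma_sets.Basic) simp
qed

definition cyl :: "'a set \<Rightarrow> ('a \<Rightarrow> 'l) set \<Rightarrow> ('a \<Rightarrow> 'l) set" where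
  "cyl K S = {\<omega> \<in> X. restrict \<omega> K \<in> S}"

lemma cyl_sets: "finite K \<Longrightarrow> K \<subseteq> carrier G \<Longrightarrow> cyl K S \<in> sets \<mu>"
proof -
  assume K: "finite K" "K \<subseteq> carrier G"
  have "cyl K S = itin letter K -` S \<inter> space \<mu>" using K by (auto simp: cyl_def space_\<mu> itin_letter)
  then show "cyl K S \<in> sets \<mu>" using simple_function_preimage[OF simple_itin[OF simple_letter K]] by simp
qed

text \<open>\<open>cyl (K m) (S m)\<close> is the largest cylinder over \<open>K m\<close> inside
  \<open>U\<close>. These cylinders increase to \<open>U\<close>, as a basic open neighbourhood
  restricts only finitely many coordinates, all of which lie in some \<open>K m\<close>.\<close>

lemma open_approx:
  assumes U: "openin (subtopology (full_shift G \<Lambda>) X) U" and \<epsilon>: "\<epsilon> > 0"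
  shows "\<exists>K S. finite K \<and> K \<subseteq> carrier G \<and> prob (sym_diff U (cyl K S)) < \<epsilon>"
proof -
  obtain V where V: "openin (full_shift G \<Lambda>) V" "U = V \<inter> X"
    using U by (auto simp: openin_subtopology)
  define K where "K m = index_ball m" for m
  have K: "finite (K m)" "K m \<subseteq> carrier G" for m
    unfolding K_def by (rule index_ball)+
  define S where "S m = {u. \<forall>\<omega>\<in>X. restrict \<omega> (K m) = u \<longrightarrow> \<omega> \<in> U}" for m
  have sub: "cyl (K m) (S m) \<subseteq> U" for m by (auto simp: cyl_def S_def)
  have mono: "incseq (\<lambda>m. cyl (K m) (S m))"
  proof (rule incseq_SucI, rule subsetI)
    fix m \<omega> assume \<omega>: "\<omega> \<in> cyl (K m) (S m)"
    have "\<omega>' \<in> U" if "\<omega>' \<in> X" "restrict \<omega>' (K (Suc m)) = restrict \<omega> (K (Suc m))" for \<omega>'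
    proof -
      have "restrict \<omega>' (K m) = restrict (restrict \<omega>' (K (Suc m))) (K m)" by (auto simp: K_def index_ball_def restrict_def fun_eq_iff)
      also have "\<dots> = restrict \<omega> (K m)" unfolding that(2) by (auto simp: K_def index_ball_def restrict_def fun_eq_iff)
      finally show ?thesis using \<omega> that(1) by (auto simp: cyl_def S_def)
    qed
    then show "\<omega> \<in> cyl (K (Suc m)) (S (Suc m))" using \<omega> by (auto simp: cyl_def S_def)
  qed
  have "U \<subseteq> (\<Union>m. cyl (K m) (S m))"
  proof
    fix \<omega> assume \<omega>: "\<omega> \<in> U"
    then have "\<omega> \<in> V" "\<omega> \<in> X" using V by auto
    then obtain W where W: "finite {i \<in> carrier G. W i \<noteq> \<Lambda>}" "\<omega> \<in> PiE (carrier G) W" "PiE (carrier G) W \<subseteq> V"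
      using V(1) unfolding full_shift_def openin_product_topology_alt by (auto 4 3)
    define m where "m = Max (insert 0 (\<iota> ` {i \<in> carrier G. W i \<noteq> \<Lambda>}))"
    have m: "i \<in> K m" if "i \<in> carrier G" "W i \<noteq> \<Lambda>" for i
      using that W(1) by (auto simp: K_def index_ball_def m_def intro!: Max_ge)
    have "\<omega>' \<in> U" if \<omega>': "\<omega>' \<in> X" "restrict \<omega>' (K m) = restrict \<omega> (K m)" for \<omega>'
    proof -
      have "\<omega>' i \<in> W i" if i: "i \<in> carrier G" for i
      proof (cases "W i = \<Lambda>")
        case True
        then show ?thesis using \<omega>'(1) X_subset i by auto
      next
        case False
        then have "\<omega>' i = \<omega> i" using \<omega>'(2) m[OF i] by (metis restrict_apply')
        then show ?thesis using W(2) i by auto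
      qed
      then have "\<omega>' \<in> PiE (carrier G) W" using \<omega>'(1) X_subset by (auto simp: PiE_def)
      then show ?thesis using W(3) V(2) \<omega>'(1) by auto
    qed
    then have "\<omega> \<in> cyl (K m) (S m)" using \<open>\<omega> \<in> X\<close> by (auto simp: cyl_def S_def)
    then show "\<omega> \<in> (\<Union>m. cyl (K m) (S m))" by blast
  qed
  then have UN: "(\<Union>m. cyl (K m) (S m)) = U" using sub by blast
  have Us: "U \<in> sets \<mu>" unfolding UN[symmetric] using cyl_sets[OF K] by blast
  have "(\<lambda>m. prob (cyl (K m) (S m))) \<longlonglongrightarrow> prob U"
    using finite_Lim_measure_incseq[OF _ mono] cyl_sets[OF K] unfolding UN by blast
  then have "\<forall>\<^sub>F m in sequentially. prob U - \<epsilon> < prob (cyl (K m) (S m))"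
    using \<epsilon> by (intro order_tendstoD) auto
  then obtain m where m: "prob U - \<epsilon> < prob (cyl (K m) (S m))" by (auto simp: eventually_sequentially)
  have "sym_diff U (cyl (K m) (S m)) = U - cyl (K m) (S m)" using sub by blast
  then have "prob (sym_diff U (cyl (K m) (S m))) = prob U - prob (cyl (K m) (S m))"
    using finite_measure_Diff[OF Us cyl_sets[OF K] sub] by simp
  then show ?thesis using m K by (intro exI[of _ "K m"] exI[of _ "S m"]) auto
qed

lemma restrict_cyl:
  assumes "K \<subseteq> L"
  shows "cyl K S = cyl L {u. restrict u K \<in> S}"
  using assms by (auto simp: cyl_def Int_absorb1)

text \<open>The approximable sets form a sigma-algebra: a countable union is first cut off to a
  finite one by continuity from below, and finite unions of cylinders are again cylinders over a
  larger window.\<close>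

lemma sets_approx:
  assumes "A \<in> sets \<mu>"
  shows "\<epsilon> > 0 \<Longrightarrow> \<exists>K S. finite K \<and> K \<subseteq> carrier G \<and> prob (sym_diff A (cyl K S)) < \<epsilon>"
  using assms unfolding sets_\<mu>_eq
proof (induction arbitrary: \<epsilon> rule: sigma_sets.induct)
  case (Basic a)
  then show ?case using open_approx by blast
next
  case Empty
  have "cyl {} {} = {}" by (simp add: cyl_def)
  then show ?case using Empty by (intro exI[of _ "{}"]) auto
next
  case (Compl a)
  then obtain K S where K: "finite K" "K \<subseteq> carrier G" "prob (sym_diff a (cyl K S)) < \<epsilon>" by blast
  have "a \<subseteq> X" using Compl(1) sets.sets_into_space[of a \<mu>] by (simp add: sets_\<mu>_eq space_\<mu>)
  then have "sym_diff (X - a) (cyl K (- S)) = sym_diff a (cyl K S)" by (auto simp: cyl_def)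
  then show ?case using K by metis
next
  case (Union a)
  have a: "a i \<in> sets \<mu>" for i using Union(1) by (simp add: sets_\<mu>_eq)
  define U where "U n = (\<Union>i<n. a i)" for n
  have Us: "U n \<in> sets \<mu>" for n using a by (auto simp: U_def)
  have UN: "(\<Union>n. U n) = (\<Union>i. a i)" by (auto simp: U_def)
  have "(\<lambda>n. prob (U n)) \<longlonglongrightarrow> prob (\<Union>i. a i)"
    using finite_Lim_measure_incseq[of U] Us unfolding UN by (fastforce simp: incseq_def U_def)
  then have "\<forall>\<^sub>F n in sequentially. prob (\<Union>i. a i) - \<epsilon> / 2 < prob (U n)"
    using Union(3) by (intro order_tendstoD) auto
  then obtain n where n: "prob (\<Union>i. a i) - \<epsilon> / 2 < prob (U n)" by (auto simp: eventually_sequentially)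
  \<comment> \<open>Half of \<open>\<epsilon>\<close> is spent on the cut-off, the other half is
    shared by the \<open>n\<close> remaining sets; \<open>Suc n\<close> covers
    \<open>n = 0\<close>.\<close>
  define \<eta> where "\<eta> = \<epsilon> / (2 * real (Suc n))"
  have "\<eta> > 0" using Union(3) by (simp add: \<eta>_def)
  then have "\<forall>i. \<exists>K S. finite K \<and> K \<subseteq> carrier G \<and> prob (sym_diff (a i) (cyl K S)) < \<eta>" using Union(2) by blast
  then obtain K S where K: "\<And>i. finite (K i)" "\<And>i. K i \<subseteq> carrier G" "\<And>i. prob (sym_diff (a i) (cyl (K i) (S i))) < \<eta>"
    by metis
  define L where "L = (\<Union>i<n. K i)"
  define R where "R = {u. \<exists>i<n. restrict u (K i) \<in> S i}"
  have L: "finite L" "L \<subseteq> carrier G" using K by (auto simp: L_def)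
  have cyl: "cyl L R = (\<Union>i<n. cyl (K i) (S i))"
  proof -
    have "cyl (K i) (S i) = cyl L {u. restrict u (K i) \<in> S i}" if "i < n" for i
      using that by (intro restrict_cyl) (auto simp: L_def)
    then have "(\<Union>i<n. cyl (K i) (S i)) = (\<Union>i<n. cyl L {u. restrict u (K i) \<in> S i})" by simp
    then show ?thesis by (auto simp: cyl_def R_def)
  qed
  have sds: "sym_diff (a i) (cyl (K i) (S i)) \<in> sets \<mu>" for i using a cyl_sets[OF K(1,2)] by auto
  have "sym_diff (\<Union>i. a i) (cyl L R) \<subseteq> ((\<Union>i. a i) - U n) \<union> (\<Union>i<n. sym_diff (a i) (cyl (K i) (S i)))"
    unfolding cyl U_def by blast
  then have "prob (sym_diff (\<Union>i. a i) (cyl L R)) \<le> prob (((\<Union>i. a i) - U n) \<union> (\<Union>i<n. sym_diff (a i) (cyl (K i) (S i))))"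
    using a Us sds by (intro finite_measure_mono) auto
  also have "\<dots> \<le> prob ((\<Union>i. a i) - U n) + prob (\<Union>i<n. sym_diff (a i) (cyl (K i) (S i)))"
    using a Us sds by (intro measure_Un_le) auto
  also have "prob ((\<Union>i. a i) - U n) = prob (\<Union>i. a i) - prob (U n)"
    using a Us by (intro finite_measure_Diff) (auto simp: U_def)
  also have "prob (\<Union>i<n. sym_diff (a i) (cyl (K i) (S i))) \<le> (\<Sum>i<n. prob (sym_diff (a i) (cyl (K i) (S i))))"
    using sds by (intro finite_measure_subadditive_finite) auto
  also have "\<dots> \<le> (\<Sum>i<n. \<eta>)" using K(3) less_imp_le by (intro sum_mono) auto
  also have "\<dots> \<le> \<epsilon> / 2" using Union(3) by (simp add: \<eta>_def field_simps)
  finally have "prob (sym_diff (\<Union>i. a i) (cyl L R)) < \<epsilon>" using n by linarith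
  then show ?case using L by blast
qed

text \<open>Each level set of \<open>c\<close> is approximated by a cylinder up to
  \<open>\<delta> / card C\<close>. Outside the errors, \<open>y\<close> lies in exactly one of
  these cylinders, and \<open>\<phi>\<close> returns the value belonging to it.\<close>

lemma letter_generates:
  fixes c :: "('a \<Rightarrow> 'l) \<Rightarrow> 'c"
  assumes c: "simple_function \<mu> c" and \<delta>: "\<delta> > 0"
  shows "\<exists>K \<phi>. finite K \<and> K \<subseteq> carrier G \<and> prob {y \<in> space \<mu>. c y \<noteq> \<phi> (itin letter K y)} \<le> \<delta>"
proof -
  define C where "C = c ` space \<mu>"
  have C: "finite C" "card C > 0"
    using simple_functionD(1)[OF c] not_empty by (auto simp: C_def card_gt_0_iff)
  define B where "B s = c -` {s} \<inter> space \<mu>" for s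
  have B: "B s \<in> sets \<mu>" for s unfolding B_def by (rule simple_function_preimage[OF c])
  have "\<forall>s. \<exists>K S. finite K \<and> K \<subseteq> carrier G \<and> prob (sym_diff (B s) (cyl K S)) < \<delta> / real (card C)"
    using sets_approx[OF B] \<delta> C by simp
  then obtain K S where K: "\<And>s. finite (K s)" "\<And>s. K s \<subseteq> carrier G"
    "\<And>s. prob (sym_diff (B s) (cyl (K s) (S s))) < \<delta> / real (card C)"
    by metis
  define L where "L = (\<Union>s\<in>C. K s)"
  have L: "finite L" "L \<subseteq> carrier G" using C K by (auto simp: L_def)
  define \<phi> where "\<phi> u = (SOME s. s \<in> C \<and> restrict u (K s) \<in> S s)" for u
  have sds: "sym_diff (B s) (cyl (K s) (S s)) \<in> sets \<mu>" for s using B cyl_sets[OF K(1,2)] by auto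
  have "{y \<in> space \<mu>. c y \<noteq> \<phi> (itin letter L y)} \<subseteq> (\<Union>s\<in>C. sym_diff (B s) (cyl (K s) (S s)))"
  proof (rule subsetI, rule ccontr)
    fix y assume y: "y \<in> {y \<in> space \<mu>. c y \<noteq> \<phi> (itin letter L y)}"
      and n: "y \<notin> (\<Union>s\<in>C. sym_diff (B s) (cyl (K s) (S s)))"
    have yX: "y \<in> X" using y by (simp add: space_\<mu>)
    have iff: "restrict (itin letter L y) (K s) \<in> S s \<longleftrightarrow> c y = s" if s: "s \<in> C" for s
    proof -
      have "restrict (itin letter L y) (K s) = restrict y (K s)"
        using s L yX by (auto simp: itin_letter L_def restrict_def fun_eq_iff)
      moreover have "y \<in> cyl (K s) (S s) \<longleftrightarrow> y \<in> B s" using n s by blast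
      ultimately show ?thesis using y yX by (auto simp: cyl_def B_def)
    qed
    have "c y \<in> C" using y by (auto simp: C_def)
    then have "\<phi> (itin letter L y) = c y" unfolding \<phi>_def using iff by (intro some_equality) auto
    then show False using y by simp
  qed
  then have "prob {y \<in> space \<mu>. c y \<noteq> \<phi> (itin letter L y)} \<le> prob (\<Union>s\<in>C. sym_diff (B s) (cyl (K s) (S s)))"
    using sds C by (intro finite_measure_mono) auto
  also have "\<dots> \<le> (\<Sum>s\<in>C. prob (sym_diff (B s) (cyl (K s) (S s))))"
    using sds C by (intro finite_measure_subadditive_finite) auto
  also have "\<dots> \<le> (\<Sum>s\<in>C. \<delta> / real (card C))" using K(3) less_imp_le by (intro sum_mono) auto
  also have "\<dots> = \<delta>" using C by (auto simp: card_gt_0_iff)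
  finally show ?thesis using L by blast
qed

lemma KS_entropy_letter: "KS_entropy \<mu> (shift_action G X) F = ereal (hrate letter)"
  by (rule KS_entropy_eq[OF simple_letter letter_generates])

end

section \<open>The lower bound\<close>

text \<open>Lengths are natural numbers, so a finite infimum is attained by a program.\<close>

lemma K0_le_iff: "K0 A w \<le> enat m \<longleftrightarrow> (\<exists>p. A p = Some w \<and> length p \<le> m)"
proof
  assume le: "K0 A w \<le> enat m"
  show "\<exists>p. A p = Some w \<and> length p \<le> m"
  proof (rule ccontr)
    assume "\<not> ?thesis"
    then have "enat (Suc m) \<le> K0 A w"
      unfolding K0_def by (intro INF_greatest) (auto simp: not_le)
    then show False using le by (meson enat_ord_simps(1) not_less_eq_eq order.refl order_trans)
  qed
next
  assume "\<exists>p. A p = Some w \<and> length p \<le> m"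
  then obtain p where "A p = Some w" "length p \<le> m" by blast
  then show "K0 A w \<le> enat m" unfolding K0_def by (intro INF_lower2[of p]) auto
qed

lemma finite_K0_le: "finite {w. K0 A w \<le> enat m}"
  and card_K0_le: "card {w. K0 A w \<le> enat m} \<le> 2 ^ (m + 1)"
proof -
  let ?P = "{p :: bool list. set p \<subseteq> UNIV \<and> length p \<le> m}"
  have fin: "finite ?P" by (rule finite_lists_length_le) simp
  have sub: "{w. K0 A w \<le> enat m} \<subseteq> (\<lambda>p. the (A p)) ` ?P"
  proof
    fix w assume "w \<in> {w. K0 A w \<le> enat m}"
    then obtain p where "A p = Some w" "length p \<le> m" by (auto simp: K0_le_iff)
    then show "w \<in> (\<lambda>p. the (A p)) ` ?P" by (intro image_eqI[of _ _ p]) auto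
  qed
  show "finite {w. K0 A w \<le> enat m}" using fin sub by (auto intro: finite_subset)
  have "card {w. K0 A w \<le> enat m} \<le> card ?P"
    using card_mono[OF finite_imageI[OF fin] sub] card_image_le[OF fin, of "\<lambda>p. the (A p)"] by linarith
  also have "\<dots> = (\<Sum>i\<le>m. card (UNIV :: bool set) ^ i)" by (rule card_lists_length_le) simp
  also have "\<dots> \<le> 2 ^ (m + 1)" by (induction m) auto
  finally show "card {w. K0 A w \<le> enat m} \<le> 2 ^ (m + 1)" .
qed

context subshift_system begin

lemma sites: "n \<ge> 1 \<Longrightarrow> set (sorted_key_list_of_set \<iota> (F n)) = F n"
  using sorted_key_list_of_set_facts(1)[OF inj_on_subset[OF inj_index F_subset] F_finite] by blast

lemma mean_complexity_cong:
  assumes "n \<ge> 1" "\<And>x. x \<in> F n \<Longrightarrow> u x = v x"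
  shows "mean_complexity \<iota> A u (F n) = mean_complexity \<iota> A v (F n)"
proof -
  have "map u (sorted_key_list_of_set \<iota> (F n)) = map v (sorted_key_list_of_set \<iota> (F n))"
    using assms sites by auto
  then show ?thesis by (simp only: mean_complexity_def)
qed

lemma mean_complexity_nonneg: "0 \<le> mean_complexity \<iota> A u (F n)"
  by (auto simp: mean_complexity_def ereal_of_enat_nonneg intro!: zero_le_divide_ereal)

definition simple_words :: "(bool list \<Rightarrow> 'l list option) \<Rightarrow> nat \<Rightarrow> real \<Rightarrow> ('a \<Rightarrow> 'l) set" where
  "simple_words A n e = {v \<in> F n \<rightarrow>\<^sub>E \<Lambda>. mean_complexity \<iota> A v (F n) < ereal e}"

lemma finite_simple_words: "n \<ge> 1 \<Longrightarrow> finite (simple_words A n e)"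
  using F_finite finite_alphabet unfolding simple_words_def
  by (intro finite_subset[OF _ finite_PiE[of "F n" "\<lambda>_. \<Lambda>"]]) auto

lemma card_simple_words:
  assumes n: "n \<ge> 1" and e: "e \<ge> 0"
  shows "real (card (simple_words A n e)) \<le> 2 powr (e * real (card (F n)) + 1)"
proof -
  define xs where "xs = sorted_key_list_of_set \<iota> (F n)"
  define m where "m = nat \<lfloor>e * real (card (F n))\<rfloor>"
  have xs: "set xs = F n" unfolding xs_def by (rule sites[OF n])
  have "(\<lambda>v. map v xs) ` simple_words A n e \<subseteq> {w. K0 A w \<le> enat m}"
  proof
    fix w assume "w \<in> (\<lambda>v. map v xs) ` simple_words A n e"
    then obtain v where v: "w = map v xs" "mean_complexity \<iota> A v (F n) < ereal e"
      by (auto simp: simple_words_def)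
    then have lt: "ereal_of_enat (K0 A w) / ereal (real (card (F n))) < ereal e"
      by (simp add: mean_complexity_def xs_def)
    then obtain j where j: "K0 A w = enat j"
      using F_card_pos[OF n] by (cases "K0 A w") auto
    have "real j / real (card (F n)) < e" using lt F_card_pos[OF n] by (simp add: j)
    then have "real j \<le> e * real (card (F n))" using F_card_pos[OF n] by (simp add: field_simps)
    then have "j \<le> m" unfolding m_def by linarith
    then show "w \<in> {w. K0 A w \<le> enat m}" by (simp add: j)
  qed
  moreover have "inj_on (\<lambda>v. map v xs) (simple_words A n e)"
  proof (rule inj_onI)
    fix u v assume uv: "u \<in> simple_words A n e" "v \<in> simple_words A n e" "map u xs = map v xs"
    have "u x = v x" if "x \<in> F n" for x using uv(3) that xs by auto
    then show "u = v" using uv(1,2) by (intro PiE_ext[of u "F n" "\<lambda>_. \<Lambda>"]) (auto simp: simple_words_def)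
  qed
  ultimately have "card (simple_words A n e) \<le> card {w. K0 A w \<le> enat m}"
    by (rule card_inj_on_le[OF _ _ finite_K0_le, rotated])
  also have "\<dots> \<le> 2 ^ (m + 1)" by (rule card_K0_le)
  finally have "real (card (simple_words A n e)) \<le> 2 ^ (m + 1)"
    by (metis of_nat_le_iff of_nat_numeral of_nat_power)
  also have "\<dots> = 2 powr (real (m + 1))" by (rule powr_realpow[symmetric]) simp
  also have "\<dots> \<le> 2 powr (e * real (card (F n)) + 1)"
    using e by (intro powr_mono) (auto simp: m_def)
  finally show ?thesis .
qed

lemma act_eq: "g \<in> carrier G \<Longrightarrow> \<omega> \<in> X \<Longrightarrow> x \<in> carrier G \<Longrightarrow> shift_action G X g \<omega> x = \<omega> (x \<otimes> g)"
  by (simp add: shift_action_def)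

text \<open>
  If \<open>g \<omega>\<close> is simple on \<open>F n\<close>, then \<open>\<omega>\<close> is known on \<open>F n \<inter> F n g\<close>; the remaining sites of
  \<open>F n\<close> are few since \<open>F\<close> is a right Foelner sequence.
\<close>

definition shifted_words :: "(bool list \<Rightarrow> 'l list option) \<Rightarrow> nat \<Rightarrow> real \<Rightarrow> 'a set \<Rightarrow> ('a \<Rightarrow> 'l) set" where
  "shifted_words A n e J = (\<Union>g\<in>J. (\<lambda>(v, r). \<lambda>y\<in>F n. if y \<in> F n #> g then v (y \<otimes> inv g) else r y) `
     (simple_words A n e \<times> ((F n - (F n #> g)) \<rightarrow>\<^sub>E \<Lambda>)))"

lemma shifted_words_mem:
  assumes n: "n \<ge> 1" and J: "J \<subseteq> carrier G" "g \<in> J" and \<omega>: "\<omega> \<in> X"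
    and simple: "mean_complexity \<iota> A (shift_action G X g \<omega>) (F n) < ereal e"
  shows "restrict \<omega> (F n) \<in> shifted_words A n e J"
proof -
  have g: "g \<in> carrier G" using J by auto
  have g\<omega>: "shift_action G X g \<omega> \<in> X" using act_space[OF g] \<omega> by (simp add: space_\<mu>)
  define v where "v = restrict (shift_action G X g \<omega>) (F n)"
  define r where "r = restrict \<omega> (F n - (F n #> g))"
  have "v \<in> simple_words A n e"
    unfolding simple_words_def
  proof (intro CollectI conjI)
    show "v \<in> F n \<rightarrow>\<^sub>E \<Lambda>" using g\<omega> X_subset F_subset[OF n] by (auto simp: v_def)
    show "mean_complexity \<iota> A v (F n) < ereal e"
      using simple mean_complexity_cong[OF n, of v "shift_action G X g \<omega>"] by (simp add: v_def)
  qed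
  moreover have "r \<in> (F n - (F n #> g)) \<rightarrow>\<^sub>E \<Lambda>" using \<omega> X_subset F_subset[OF n] by (auto simp: r_def)
  moreover have "restrict \<omega> (F n) = (\<lambda>y\<in>F n. if y \<in> F n #> g then v (y \<otimes> inv g) else r y)"
  proof -
    have "v (y \<otimes> inv g) = \<omega> y" if "y \<in> F n #> g" for y
    proof -
      obtain x where x: "x \<in> F n" "y = x \<otimes> g" using \<open>y \<in> F n #> g\<close> by (auto simp: r_coset_def)
      have xG: "x \<in> carrier G" using x F_subset[OF n] by auto
      then have "y \<otimes> inv g = x" using x g by (simp add: m_assoc)
      then show ?thesis using x xG act_eq[OF g \<omega>] by (simp add: v_def)
    qed
    then show ?thesis by (auto simp: r_def)
  qed
  ultimately show ?thesis unfolding shifted_words_def using J(2) by force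
qed

lemma
  assumes n: "n \<ge> 1" and e: "e \<ge> 0" and J: "finite J" "J \<subseteq> carrier G" and \<Lambda>: "\<Lambda> \<noteq> {}"
  shows finite_shifted_words: "finite (shifted_words A n e J)"
    and card_shifted_words: "real (card (shifted_words A n e J)) \<le>
      real (card J) * (2 powr (e * real (card (F n)) + 1) *
        real (card \<Lambda>) ^ (\<Sum>g\<in>J. card (sym_diff (F n) (F n <#> {g}))))"
proof -
  \<comment> \<open>A common exponent for all \<open>g\<close>: every single symmetric difference is
    at most the sum.\<close>
  define D where "D = (\<Sum>g\<in>J. card (sym_diff (F n) (F n <#> {g})))"
  define P where "P g = simple_words A n e \<times> ((F n - (F n #> g)) \<rightarrow>\<^sub>E \<Lambda>)" for g
  have finP: "finite (P g)" for g
    unfolding P_def using finite_simple_words[OF n] F_finite[OF n] finite_alphabet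
    by (intro finite_cartesian_product finite_PiE) auto
  show "finite (shifted_words A n e J)"
    unfolding shifted_words_def using J finP unfolding P_def by (intro finite_UN_I finite_imageI) auto
  have c\<Lambda>: "1 \<le> card \<Lambda>" using \<Lambda> finite_alphabet by (simp add: Suc_le_eq card_gt_0_iff)
  have cardP: "card (P g) \<le> card (simple_words A n e) * card \<Lambda> ^ D" if g: "g \<in> J" for g
  proof -
    have "card (F n - (F n #> g)) \<le> card (sym_diff (F n) (F n <#> {g}))"
    proof (rule card_mono)
      show "finite (sym_diff (F n) (F n <#> {g}))" using F_finite[OF n] by (auto simp: set_mult_def)
    qed (auto simp: set_mult_def r_coset_def)
    also have "\<dots> \<le> D" unfolding D_def using J g by (intro member_le_sum) auto
    finally have "card \<Lambda> ^ card (F n - (F n #> g)) \<le> card \<Lambda> ^ D" using c\<Lambda> by (intro power_increasing)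
    then show ?thesis using F_finite[OF n] by (simp add: P_def card_cartesian_product card_PiE)
  qed
  have "card (shifted_words A n e J) \<le> (\<Sum>g\<in>J. card (P g))"
    unfolding shifted_words_def P_def[symmetric]
    by (intro order_trans[OF card_UN_le[OF J(1)]] sum_mono card_image_le finP)
  also have "\<dots> \<le> (\<Sum>g\<in>J. card (simple_words A n e) * card \<Lambda> ^ D)" by (intro sum_mono cardP)
  finally have "real (card (shifted_words A n e J)) \<le> real (card J * (card (simple_words A n e) * card \<Lambda> ^ D))"
    unfolding of_nat_le_iff by simp
  also have "\<dots> = real (card J) * (real (card (simple_words A n e)) * real (card \<Lambda>) ^ D)" by simp
  also have "\<dots> \<le> real (card J) * (2 powr (e * real (card (F n)) + 1) * real (card \<Lambda>) ^ D)"
    by (intro mult_left_mono mult_right_mono card_simple_words n e) auto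
  finally show "real (card (shifted_words A n e J)) \<le>
      real (card J) * (2 powr (e * real (card (F n)) + 1) *
        real (card \<Lambda>) ^ (\<Sum>g\<in>J. card (sym_diff (F n) (F n <#> {g}))))"
    by (simp add: D_def)
qed

text \<open>Off an event of probability at most \<open>\<delta>\<close>, the word on
  \<open>F n\<close> lies in \<open>shifted_words\<close>, whose size is
  \<open>2 powr (e * card (F n))\<close> up to a subexponential factor.
  \<open>Ent_concentrated\<close> and \<open>hrate_le\<close> then give
  \<open>hrate letter \<le> e + \<delta> * l\<close> as \<open>n\<close> grows, which is absurd for
  small \<open>\<delta>\<close>.\<close>

lemma eventually_simple_null:
  fixes A :: "bool list \<Rightarrow> 'l list option"
  assumes erg: "ergodic_action G \<mu> (shift_action G X)" and right: "right_folner G F"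
    and card_F: "filterlim (\<lambda>n. real (card (F n))) at_top sequentially"
    and e: "0 \<le> e" "e < hrate letter" and N: "N \<ge> 1"
  defines "B \<equiv> {\<omega> \<in> X. \<forall>n\<ge>N. mean_complexity \<iota> A \<omega> (F n) < ereal e}"
  shows "B \<in> sets \<mu>" "prob B = 0"
proof -
  define W where "W n = cyl (F n) {u. mean_complexity \<iota> A u (F n) < ereal e}" for n
  have W: "\<omega> \<in> W n \<longleftrightarrow> \<omega> \<in> X \<and> mean_complexity \<iota> A \<omega> (F n) < ereal e" if "n \<ge> 1" for \<omega> n
    using mean_complexity_cong[OF that, of "restrict \<omega> (F n)" \<omega>] by (auto simp: W_def cyl_def)
  have "B = (\<Inter>n\<in>{N..}. W n)" using W N by (auto simp: B_def)
  also have "\<dots> \<in> sets \<mu>"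
  proof (rule sets.countable_INT')
    show "W ` {N..} \<subseteq> sets \<mu>"
    proof (rule image_subsetI)
      fix n assume "n \<in> {N..}"
      then have "n \<ge> 1" using N by simp
      then show "W n \<in> sets \<mu>" unfolding W_def by (intro cyl_sets F_finite F_subset)
    qed
  qed auto
  finally show B: "B \<in> sets \<mu>" .
  show "prob B = 0"
  proof (rule ccontr)
    assume "prob B \<noteq> 0"
    then have pB: "prob B > 0" using measure_nonneg[of \<mu> B] by linarith
    define E where "E J = (\<Union>g\<in>J. shift_action G X g -` B \<inter> space \<mu>)" for J
    have pre: "shift_action G X g -` B \<inter> space \<mu> \<in> sets \<mu>" if "g \<in> carrier G" for g
      using measurable_sets[OF act_measurable[OF that] B] .
    define K where "K m = index_ball m" for m
    have K: "finite (K m)" "K m \<subseteq> carrier G" for m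
      unfolding K_def by (rule index_ball)+
    have EK: "E (K m) \<in> sets \<mu>" for m
      unfolding E_def using K pre by (intro sets.finite_UN) auto
    have UN: "(\<Union>m. E (K m)) = E (carrier G)" by (auto simp: E_def K_def index_ball_def)
    have EG: "E (carrier G) \<in> sets \<mu>" unfolding UN[symmetric] using EK by blast
    have "shift_action G X h -` E (carrier G) \<inter> space \<mu> = E (carrier G)" if h: "h \<in> carrier G" for h
    proof (intro equalityI subsetI)
      fix y assume "y \<in> shift_action G X h -` E (carrier G) \<inter> space \<mu>"
      then obtain g where g: "g \<in> carrier G" "shift_action G X g (shift_action G X h y) \<in> B" "y \<in> space \<mu>"
        by (auto simp: E_def)
      then have "shift_action G X (g \<otimes> h) y \<in> B" using act_mult h by simp
      then show "y \<in> E (carrier G)" using g h by (auto simp: E_def)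
    next
      fix y assume "y \<in> E (carrier G)"
      then obtain g where g: "g \<in> carrier G" "shift_action G X g y \<in> B" "y \<in> space \<mu>" by (auto simp: E_def)
      have hy: "shift_action G X h y \<in> space \<mu>" using act_space h g by simp
      have "shift_action G X (g \<otimes> inv h) (shift_action G X h y) = shift_action G X g y"
        using act_mult[of "g \<otimes> inv h" h y] g h by (simp add: m_assoc)
      then show "y \<in> shift_action G X h -` E (carrier G) \<inter> space \<mu>"
        using g h hy by (auto simp: E_def intro!: bexI[of _ "g \<otimes> inv h"])
    qed
    then have "\<forall>h\<in>carrier G. shift_action G X h -` E (carrier G) \<inter> space \<mu> = E (carrier G)" by (rule ballI)
    then have "prob (E (carrier G)) = 0 \<or> prob (E (carrier G)) = 1"
      by (rule erg[unfolded ergodic_action_def, THEN bspec, OF EG, THEN mp])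
    moreover have "prob B \<le> prob (E (carrier G))"
    proof (rule finite_measure_mono[OF _ EG])
      show "B \<subseteq> E (carrier G)"
        using act_one sets.sets_into_space[OF B] by (auto simp: E_def intro!: bexI[of _ \<one>])
    qed
    ultimately have E1: "prob (E (carrier G)) = 1" using pB by linarith
    have "incseq (\<lambda>m. E (K m))" by (rule incseq_SucI) (auto simp: E_def K_def index_ball_def)
    then have lim: "(\<lambda>m. prob (E (K m))) \<longlonglongrightarrow> 1"
      using finite_Lim_measure_incseq[of "\<lambda>m. E (K m)"] EK E1 unfolding UN by auto
    have \<Lambda>: "\<Lambda> \<noteq> {}" using not_empty X_subset by (auto simp: space_\<mu>)
    define l where "l = log 2 (real (card \<Lambda>))"
    have c\<Lambda>: "1 \<le> card \<Lambda>" using \<Lambda> finite_alphabet by (simp add: Suc_le_eq card_gt_0_iff)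
    have l: "l \<ge> 0" using c\<Lambda> by (simp add: l_def)
    have bound: "hrate letter \<le> e + \<delta> * l" if \<delta>: "0 < \<delta>" "\<delta> < 1" for \<delta>
    proof -
      obtain m where m: "1 - \<delta> < prob (E (K m))"
        using order_tendstoD(1)[OF lim, of "1 - \<delta>"] \<delta> by (auto simp: eventually_sequentially)
      define J where "J = K m"
      have J: "finite J" "J \<subseteq> carrier G" using K by (simp_all add: J_def)
      have J0: "J \<noteq> {}" using m \<delta> by (auto simp: J_def E_def)
      define D where "D n = (\<Sum>g\<in>J. card (sym_diff (F n) (F n <#> {g})))" for n
      have lim_D: "(\<lambda>n. real (D n) / real (card (F n))) \<longlonglongrightarrow> 0"
      proof -
        have "(\<lambda>n. \<Sum>g\<in>J. real (card (sym_diff (F n) (F n <#> {g}))) / real (card (F n))) \<longlonglongrightarrow> (\<Sum>g\<in>J. 0)"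
          using right J unfolding right_folner_def by (intro tendsto_sum) auto
        moreover have "real (D n) / real (card (F n))
            = (\<Sum>g\<in>J. real (card (sym_diff (F n) (F n <#> {g}))) / real (card (F n)))" for n
          by (simp only: D_def of_nat_sum sum_divide_distrib)
        ultimately show ?thesis by (simp only: sum.neutral_const)
      qed
      \<comment> \<open>The \<open>2\<close> collects the \<open>1\<close> of
        \<open>Ent_concentrated\<close> and the \<open>1\<close> in the exponent bounding the number
        of simple words.\<close>
      have step: "hrate letter \<le> (2 + log 2 (real (card J))) / real (card (F n)) + e
          + real (D n) / real (card (F n)) * l + \<delta> * l" if n: "n \<ge> N" for n
      proof -
        have n1: "n \<ge> 1" using n N by simp
        define S where "S = shifted_words A n e J"
        have finS: "finite S" unfolding S_def by (rule finite_shifted_words[OF n1 e(1) J \<Lambda>])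
        have ES: "restrict \<omega> (F n) \<in> S" if \<omega>: "\<omega> \<in> E J" for \<omega>
        proof -
          obtain g where g: "g \<in> J" "shift_action G X g \<omega> \<in> B" "\<omega> \<in> X"
            using \<omega> by (auto simp: E_def space_\<mu>)
          then show ?thesis unfolding S_def
            using n by (intro shifted_words_mem[OF n1 J(2)]) (auto simp: B_def)
        qed
        have sf: "simple_function \<mu> (itin letter (F n))"
          by (rule simple_itin[OF simple_letter F_finite[OF n1] F_subset[OF n1]])
        have "E J \<noteq> {}" using m \<delta> by (auto simp: J_def)
        then have S0: "S \<noteq> {}" using ES by auto
        have "{\<omega> \<in> space \<mu>. itin letter (F n) \<omega> \<notin> S} \<subseteq> space \<mu> - E J"
          using ES itin_letter F_subset[OF n1] by (auto simp: space_\<mu>)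
        then have "prob {\<omega> \<in> space \<mu>. itin letter (F n) \<omega> \<notin> S} \<le> prob (space \<mu> - E J)"
          using EK[of m] by (intro finite_measure_mono) (auto simp: J_def)
        also have "\<dots> \<le> \<delta>" using m EK[of m] by (simp add: prob_compl J_def)
        finally have "H letter (F n) \<le> 1 + log 2 (real (card S))
            + \<delta> * log 2 (real (card (itin letter (F n) ` space \<mu>)))"
          unfolding H_def by (intro Ent_concentrated[OF sf finS S0])
        moreover have "log 2 (real (card S)) \<le> log 2 (real (card J)) + (e * real (card (F n)) + 1) + real (D n) * l"
        proof -
          have "log 2 (real (card S)) \<le> log 2 (real (card J) * (2 powr (e * real (card (F n)) + 1) * real (card \<Lambda>) ^ D n))"
            using card_shifted_words[OF n1 e(1) J \<Lambda>] finS S0 unfolding S_def D_def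
            by (intro log_mono) (auto simp: card_gt_0_iff)
          also have "\<dots> = log 2 (real (card J)) + (e * real (card (F n)) + 1) + real (D n) * l"
            using J J0 c\<Lambda> by (simp add: log_mult log_nat_power l_def card_gt_0_iff)
          finally show ?thesis .
        qed
        moreover have "log 2 (real (card (itin letter (F n) ` space \<mu>))) \<le> real (card (F n)) * l"
        proof -
          have "itin letter (F n) ` space \<mu> \<subseteq> F n \<rightarrow>\<^sub>E \<Lambda>"
            using itin_letter F_subset[OF n1] X_subset by (fastforce simp: space_\<mu>)
          moreover have finP: "finite (F n \<rightarrow>\<^sub>E \<Lambda>)" using F_finite[OF n1] finite_alphabet by (intro finite_PiE)
          ultimately have "card (itin letter (F n) ` space \<mu>) \<le> card (F n \<rightarrow>\<^sub>E \<Lambda>)" "card (itin letter (F n) ` space \<mu>) > 0"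
            using not_empty by (auto intro: card_mono simp: card_gt_0_iff finite_subset)
          then have "log 2 (real (card (itin letter (F n) ` space \<mu>))) \<le> log 2 (real (card (F n \<rightarrow>\<^sub>E \<Lambda>)))"
            by (intro log_mono) auto
          also have "\<dots> = real (card (F n)) * l"
            using F_finite[OF n1] c\<Lambda> by (simp add: card_PiE log_nat_power l_def)
          finally show ?thesis .
        qed
        then have "\<delta> * log 2 (real (card (itin letter (F n) ` space \<mu>))) \<le> \<delta> * (real (card (F n)) * l)"
          using \<delta> by (intro mult_left_mono) auto
        ultimately have "H letter (F n) \<le> (2 + log 2 (real (card J))) + e * real (card (F n))
            + real (D n) * l + \<delta> * l * real (card (F n))"
          by (simp add: algebra_simps)
        then have "H letter (F n) / real (card (F n)) \<le> ((2 + log 2 (real (card J))) + e * real (card (F n))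
            + real (D n) * l + \<delta> * l * real (card (F n))) / real (card (F n))"
          by (rule divide_right_mono) simp
        moreover have "hrate letter \<le> H letter (F n) / real (card (F n))" by (rule hrate_le[OF simple_letter n1])
        ultimately show ?thesis using F_card_pos[OF n1] by (simp add: add_divide_distrib)
      qed
      have "(\<lambda>n. (2 + log 2 (real (card J))) / real (card (F n)) + e + real (D n) / real (card (F n)) * l + \<delta> * l)
          \<longlonglongrightarrow> 0 + e + 0 * l + \<delta> * l"
        by (intro tendsto_intros lim_D real_tendsto_divide_at_top[OF tendsto_const card_F])
      then have "hrate letter \<le> 0 + e + 0 * l + \<delta> * l"
        by (rule LIMSEQ_le_const) (use step in blast)
      then show ?thesis by simp
    qed
    \<comment> \<open>Makes \<open>\<delta> * l\<close> at most half of the gap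
      \<open>hrate letter - e\<close>; \<open>l + 1\<close> avoids dividing by zero for a one-letter
      alphabet, where \<open>l = 0\<close>.\<close>
    define \<delta> where "\<delta> = min (1/2) ((hrate letter - e) / (2 * (l + 1)))"
    have \<delta>: "0 < \<delta>" "\<delta> < 1" using e l by (auto simp: \<delta>_def)
    have "\<delta> * l \<le> (hrate letter - e) / (2 * (l + 1)) * l" using l by (intro mult_right_mono) (auto simp: \<delta>_def)
    also have "\<dots> \<le> (hrate letter - e) / 2" using l e by (simp add: field_simps)
    finally show False using bound[OF \<delta>] e by simp
  qed
qed

lemma asymptotic_complexity_ge:
  assumes erg: "ergodic_action G \<mu> (shift_action G X)" and right: "right_folner G F"
    and card_F: "filterlim (\<lambda>n. real (card (F n))) at_top sequentially"
  shows "AE \<omega> in \<mu>. ereal (hrate letter) \<le> asymptotic_complexity \<iota> A F \<omega>"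
proof -
  define h where "h = hrate letter"
  have h0: "0 \<le> h" unfolding h_def by (rule hrate_nonneg[OF simple_letter])
  \<comment> \<open>Truncated at zero because \<open>eventually_simple_null\<close> asks for
    \<open>0 \<le> e\<close>. For \<open>h = 0\<close> the claim is just non-negativity of
    complexity, hence the guard \<open>h > 0\<close> below.\<close>
  define e where "e m = max 0 (h - inverse (real (Suc m)))" for m
  define B where "B m N = {\<omega> \<in> X. \<forall>n\<ge>Suc N. mean_complexity \<iota> A \<omega> (F n) < ereal (e m)}" for m N
  have "B m N \<in> null_sets \<mu>" if "h > 0" for m N
  proof -
    have "0 \<le> e m" "e m < hrate letter" "1 \<le> Suc N" using that by (auto simp: e_def h_def)
    note null = eventually_simple_null[OF erg right card_F this, of A]
    show ?thesis
      unfolding B_def by (intro null_setsI null(1)) (simp only: emeasure_eq_measure null(2) ennreal_0)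
  qed
  then have "AE \<omega> in \<mu>. h > 0 \<longrightarrow> \<omega> \<notin> B m N" for m N
    using AE_not_in[of "B m N" \<mu>] by (cases "h > 0") auto
  then have "AE \<omega> in \<mu>. \<forall>m N. h > 0 \<longrightarrow> \<omega> \<notin> B m N"
    unfolding AE_all_countable by blast
  then show ?thesis using AE_space
  proof eventually_elim
    case (elim \<omega>)
    have \<omega>: "\<omega> \<in> X" using elim by (simp add: space_\<mu>)
    show ?case
    proof (rule ccontr)
      assume "\<not> ?case"
      then have lt: "asymptotic_complexity \<iota> A F \<omega> < ereal h" by (simp add: h_def not_le)
      have nonneg: "0 \<le> asymptotic_complexity \<iota> A F \<omega>"
        unfolding asymptotic_complexity_def by (intro le_Limsup always_eventually allI mean_complexity_nonneg) simp
      obtain r where r: "asymptotic_complexity \<iota> A F \<omega> = ereal r" "0 \<le> r" "r < h"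
        using lt nonneg by (cases "asymptotic_complexity \<iota> A F \<omega>") auto
      obtain m where "inverse (real (Suc m)) < h - r" using reals_Archimedean[of "h - r"] r by auto
      then have "r < e m" by (simp add: e_def)
      then have "asymptotic_complexity \<iota> A F \<omega> < ereal (e m)" using r by simp
      then have "\<forall>\<^sub>F n in sequentially. mean_complexity \<iota> A \<omega> (F n) < ereal (e m)"
        unfolding asymptotic_complexity_def by (rule Limsup_lessD)
      then obtain N where "\<forall>n\<ge>N. mean_complexity \<iota> A \<omega> (F n) < ereal (e m)"
        unfolding eventually_sequentially by blast
      then have "\<omega> \<in> B m N" using \<omega> by (auto simp: B_def)
      then show False using elim r by auto
    qed
  qed
qed

end

section \<open>The upper bound\<close>

text \<open>
  The code lengths are Shannon's, plus one, so that half of the Kraft sum is left for the patterns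
  of measure zero.
\<close>

lemma shannon_code:
  fixes p :: "'u \<Rightarrow> real"
  assumes U: "finite U" and p0: "\<And>u. u \<in> U \<Longrightarrow> 0 \<le> p u" and p1: "sum p U = 1"
  obtains len :: "'u \<Rightarrow> nat" where "(\<Sum>u\<in>U. (1/2::real) ^ len u) \<le> 1"
    and "(\<Sum>u\<in>U. p u * real (len u)) \<le> - (\<Sum>u\<in>U. p u * log 2 (p u)) + 2"
proof
  \<comment> \<open>Patterns of measure zero get length \<open>card U\<close> because
    \<open>2 * card U \<le> 2 ^ card U\<close>; together they use at most half of the Kraft
    sum.\<close>
  define len where "len u = (if p u > 0 then nat \<lceil>- log 2 (p u)\<rceil> + 1 else card U)" for u
  have ple: "p u \<le> 1" if "u \<in> U" for u
    using member_le_sum[OF that, of p] p0 U p1 by auto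
  have bound: "(1/2::real) ^ len u \<le> p u / 2 + (1/2) * (1 / real (card U))" if u: "u \<in> U" for u
  proof (cases "p u > 0")
    case True
    have "- log 2 (p u) \<le> real (nat \<lceil>- log 2 (p u)\<rceil>)" by linarith
    then have "2 powr (- real (nat \<lceil>- log 2 (p u)\<rceil>)) \<le> 2 powr (log 2 (p u))" by (intro powr_mono) auto
    also have "\<dots> = p u" using True by simp
    finally have "(1/2::real) ^ nat \<lceil>- log 2 (p u)\<rceil> \<le> p u"
      by (simp add: powr_minus powr_realpow power_one_over inverse_eq_divide)
    then show ?thesis using True by (simp add: len_def add_increasing2)
  next
    case False
    have cU: "card U > 0" using U u by (auto simp: card_gt_0_iff)
    have "2 * real (card U) \<le> 2 ^ card U"
    proof -
      have "2 * m \<le> 2 ^ m" if "m > 0" for m :: nat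
        using that by (induction m rule: nat_induct_non_zero) auto
      from this[OF cU] show ?thesis by (metis of_nat_le_iff of_nat_mult of_nat_numeral of_nat_power)
    qed
    then have "(1/2::real) ^ card U \<le> (1/2) * (1 / real (card U))"
      using cU by (simp add: power_one_over field_simps)
    then show ?thesis using False p0[OF u] by (simp add: len_def)
  qed
  have "(\<Sum>u\<in>U. (1/2::real) ^ len u) \<le> (\<Sum>u\<in>U. p u / 2 + (1/2) * (1 / real (card U)))"
    by (intro sum_mono bound)
  also have "\<dots> = sum p U / 2 + real (card U) * ((1/2) * (1 / real (card U)))"
    by (simp add: sum.distrib sum_divide_distrib)
  also have "\<dots> \<le> 1" by (simp add: p1)
  finally show "(\<Sum>u\<in>U. (1/2::real) ^ len u) \<le> 1" .
  have "(\<Sum>u\<in>U. p u * real (len u)) \<le> (\<Sum>u\<in>U. - (p u * log 2 (p u)) + 2 * p u)"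
  proof (intro sum_mono)
    fix u assume u: "u \<in> U"
    show "p u * real (len u) \<le> - (p u * log 2 (p u)) + 2 * p u"
    proof (cases "p u > 0")
      case True
      have "log 2 (p u) \<le> 0" using True ple[OF u] by simp
      then have "real (len u) \<le> - log 2 (p u) + 2" using True by (simp add: len_def) linarith
      then have "p u * real (len u) \<le> p u * (- log 2 (p u) + 2)" using True by (intro mult_left_mono) auto
      then show ?thesis by (simp add: algebra_simps)
    next
      case False
      then have "p u = 0" using p0[OF u] by simp
      then show ?thesis by simp
    qed
  qed
  also have "\<dots> = - (\<Sum>u\<in>U. p u * log 2 (p u)) + 2 * sum p U"
    by (simp add: sum.distrib sum_negf sum_subtractf sum_distrib_left)
  finally show "(\<Sum>u\<in>U. p u * real (len u)) \<le> - (\<Sum>u\<in>U. p u * log 2 (p u)) + 2" by (simp add: p1)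
qed

context subshift_system begin

text \<open>\<open>f\<close> is the limit of the averages of the code length \<open>\<psi>\<close>
  weighted by the indicator of \<open>Z k\<close>. By dominated convergence its mean is the limit of
  the mean of \<open>\<psi>\<close> times the density of \<open>Z k\<close> in \<open>F n\<close>,
  which is asymptotically at most \<open>1 / card (F k)\<close>. The \<open>+ 2\<close> is the
  redundancy in \<open>shannon_code\<close>.\<close>

lemma upper_function:
  assumes opt: "optimal_decompressor \<Lambda> \<kappa> A" and \<kappa>: "inj_on \<kappa> \<Lambda>"
    and good: "\<And>k. k \<ge> 1 \<Longrightarrow> good_weight G F (indicator (Z k))"
    and growth: "filterlim (\<lambda>n. real (card (F n)) / log 2 (real n)) at_top sequentially"
    and card_F: "filterlim (\<lambda>n. real (card (F n))) at_top sequentially"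
    and one: "\<And>n. n \<ge> 1 \<Longrightarrow> \<one> \<in> F n"
    and k: "k \<ge> 1"
  obtains f where "integrable \<mu> f" and "integral\<^sup>L \<mu> f \<le> (H letter (F k) + 2) / real (card (F k))"
    and "AE \<omega> in \<mu>. asymptotic_complexity \<iota> A F \<omega> \<le> ereal (f \<omega>)"
proof -
  define U where "U = F k \<rightarrow>\<^sub>E \<Lambda>"
  define Y where "Y = itin letter (F k)"
  have Fk: "finite (F k)" "F k \<subseteq> carrier G" using F_finite F_subset k by auto
  have Y: "simple_function \<mu> Y" unfolding Y_def by (rule simple_itin[OF simple_letter Fk])
  have Y_eq: "Y \<omega> = restrict \<omega> (F k)" if "\<omega> \<in> X" for \<omega> using that Fk by (simp add: Y_def itin_letter)
  have U: "finite U" unfolding U_def using Fk finite_alphabet by (intro finite_PiE) auto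
  have YU: "Y ` space \<mu> \<subseteq> U" using Y_eq X_subset Fk by (fastforce simp: U_def space_\<mu>)
  define p where "p u = prob (Y -` {u} \<inter> space \<mu>)" for u
  have p_out: "p u = 0" if "u \<notin> Y ` space \<mu>" for u
  proof -
    have "Y -` {u} \<inter> space \<mu> = {}" using that by auto
    then show ?thesis by (simp add: p_def)
  qed
  have sum_U: "(\<Sum>u\<in>U. p u * g u) = (\<Sum>u\<in>Y ` space \<mu>. p u * g u)" for g :: "_ \<Rightarrow> real"
    using YU U p_out by (intro sum.mono_neutral_right) auto
  have "sum p (Y ` space \<mu>) = prob (Y -` (Y ` space \<mu>) \<inter> space \<mu>)"
    unfolding p_def by (rule sum_prob_preimages[OF Y subset_refl])
  also have "Y -` (Y ` space \<mu>) \<inter> space \<mu> = space \<mu>" by auto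
  finally have "sum p U = 1" using sum_U[of "\<lambda>_. 1"] prob_space by simp
  then obtain len :: "_ \<Rightarrow> nat" where len: "(\<Sum>u\<in>U. (1/2::real) ^ len u) \<le> 1"
    "(\<Sum>u\<in>U. p u * real (len u)) \<le> - (\<Sum>u\<in>U. p u * log 2 (p u)) + 2"
    using shannon_code[OF U, of p] by (auto simp: p_def)
  define \<psi> where "\<psi> \<omega> = real (len (Y \<omega>))" for \<omega>
  define Lm where "Lm = real (Max (len ` U))"
  have \<psi>_bound: "0 \<le> \<psi> \<omega>" "\<psi> \<omega> \<le> Lm" if "\<omega> \<in> space \<mu>" for \<omega>
    using that YU U by (auto simp: \<psi>_def Lm_def intro!: Max_ge)
  have \<psi>_sf: "simple_function \<mu> \<psi>"
    unfolding \<psi>_def using simple_function_compose[OF Y, of "\<lambda>u. real (len u)"] by (simp add: comp_def)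
  have \<psi>_meas [measurable]: "\<psi> \<in> borel_measurable \<mu>"
    using \<psi>_sf by (rule borel_measurable_simple_function)
  have \<psi>_int: "integral\<^sup>L \<mu> \<psi> \<le> H letter (F k) + 2"
  proof -
    have "integral\<^sup>L \<mu> \<psi> = (\<integral>\<omega>. (\<Sum>u\<in>Y ` space \<mu>. real (len u) * indicator (Y -` {u} \<inter> space \<mu>) \<omega>) \<partial>\<mu>)"
    proof (rule Bochner_Integration.integral_cong[OF refl])
      fix \<omega> assume \<omega>: "\<omega> \<in> space \<mu>"
      have "(\<Sum>u\<in>Y ` space \<mu>. real (len u) * indicator (Y -` {u} \<inter> space \<mu>) \<omega>)
          = (\<Sum>u\<in>Y ` space \<mu>. if u = Y \<omega> then real (len u) else 0)"
        using \<omega> by (intro sum.cong) (auto simp: indicator_def)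
      also have "\<dots> = \<psi> \<omega>" using \<omega> simple_functionD(1)[OF Y] by (simp add: \<psi>_def)
      finally show "\<psi> \<omega> = (\<Sum>u\<in>Y ` space \<mu>. real (len u) * indicator (Y -` {u} \<inter> space \<mu>) \<omega>)" by simp
    qed
    also have "\<dots> = (\<Sum>u\<in>Y ` space \<mu>. real (len u) * p u)"
      using simple_function_preimage[OF Y]
      by (subst Bochner_Integration.integral_sum) (auto simp: p_def emeasure_eq_measure)
    also have "\<dots> = (\<Sum>u\<in>U. p u * real (len u))" unfolding sum_U by (simp add: mult.commute)
    also have "\<dots> \<le> - (\<Sum>u\<in>Y ` space \<mu>. p u * log 2 (p u)) + 2" using len(2) unfolding sum_U .
    also have "\<dots> = H letter (F k) + 2"
      unfolding H_def Y_def[symmetric] using Ent_eq[OF Y] by (simp add: p_def)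
    finally show ?thesis .
  qed
  define avg where "avg n \<omega> = (\<Sum>g\<in>F n. indicator (Z k) g * \<psi> (shift_action G X g \<omega>)) / real (card (F n))" for n \<omega>
  \<comment> \<open>The index is shifted because nothing is known about \<open>F 0\<close>;
    measurability and boundedness of \<open>avg n\<close> are available for
    \<open>n \<ge> 1\<close>.\<close>
  define f where "f \<omega> = lim (\<lambda>n. avg (Suc n) \<omega>)" for \<omega>
  have act_meas [measurable]: "(\<lambda>\<omega>. \<psi> (shift_action G X g \<omega>)) \<in> borel_measurable \<mu>" if "g \<in> carrier G" for g
    using act_measurable[OF that] by (rule measurable_compose) (rule \<psi>_meas)
  have avg_meas [measurable]: "avg (Suc n) \<in> borel_measurable \<mu>" for n
    unfolding avg_def using F_subset[of "Suc n"]
    by (intro borel_measurable_divide borel_measurable_sum borel_measurable_times act_meas) auto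
  have f_meas [measurable]: "f \<in> borel_measurable \<mu>" unfolding f_def by measurable
  have Lm0: "0 \<le> Lm" by (simp add: Lm_def)
  have avg_bound: "norm (avg (Suc n) \<omega>) \<le> Lm" if \<omega>: "\<omega> \<in> space \<mu>" for n \<omega>
  proof -
    have b: "0 \<le> indicator (Z k) g * \<psi> (shift_action G X g \<omega>)" "indicator (Z k) g * \<psi> (shift_action G X g \<omega>) \<le> Lm"
      if "g \<in> F (Suc n)" for g
      using \<psi>_bound[OF act_space[OF _ \<omega>]] that F_subset[of "Suc n"] Lm0 by (auto simp: indicator_def)
    have "(\<Sum>g\<in>F (Suc n). indicator (Z k) g * \<psi> (shift_action G X g \<omega>)) \<le> (\<Sum>g\<in>F (Suc n). Lm)"
      by (intro sum_mono b)
    moreover have "0 \<le> (\<Sum>g\<in>F (Suc n). indicator (Z k) g * \<psi> (shift_action G X g \<omega>))"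
      by (intro sum_nonneg b)
    ultimately show ?thesis
      unfolding avg_def using F_card_pos[of "Suc n"] by (simp add: divide_le_eq mult.commute)
  qed
  have conv: "AE \<omega> in \<mu>. (\<lambda>n. avg (Suc n) \<omega>) \<longlonglongrightarrow> f \<omega>"
  proof -
    have "good_weight_for G F (indicator (Z k)) \<mu> (shift_action G X)"
      using good[OF k] pmp F_subset by (rule good_weight_all_systems) auto
    moreover have "AE \<omega> in \<mu>. \<bar>\<psi> \<omega>\<bar> \<le> Lm" using \<psi>_bound by (intro AE_I2) simp
    ultimately have "AE \<omega> in \<mu>. convergent (\<lambda>n. avg n \<omega>)"
      unfolding good_weight_for_def avg_def using \<psi>_meas by blast
    then show ?thesis
    proof eventually_elim
      case (elim \<omega>)
      then have "convergent (\<lambda>n. avg (Suc n) \<omega>)"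
        by (rule convergent_Suc_iff[of "\<lambda>n. avg n \<omega>", THEN iffD2])
      then show ?case unfolding f_def by (simp add: convergent_LIMSEQ_iff)
    qed
  qed
  have int: "integrable \<mu> f"
    and int_lim: "(\<lambda>n. integral\<^sup>L \<mu> (avg (Suc n))) \<longlonglongrightarrow> integral\<^sup>L \<mu> f"
    using integrable_dominated_convergence[OF f_meas avg_meas _ conv, of "\<lambda>_. Lm"]
      integral_dominated_convergence[OF f_meas avg_meas _ conv, of "\<lambda>_. Lm"] avg_bound by auto
  have int_avg: "integral\<^sup>L \<mu> (avg (Suc n))
      = real (card (F (Suc n) \<inter> Z k)) / real (card (F (Suc n))) * integral\<^sup>L \<mu> \<psi>" for n
  proof -
    have inv: "integral\<^sup>L \<mu> (\<lambda>\<omega>. \<psi> (shift_action G X g \<omega>)) = integral\<^sup>L \<mu> \<psi>"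
      "integrable \<mu> (\<lambda>\<omega>. \<psi> (shift_action G X g \<omega>))" if g: "g \<in> carrier G" for g
    proof -
      have "distr \<mu> \<mu> (shift_action G X g) = \<mu>" using sys g by (simp add: pmp_system_def)
      then show "integral\<^sup>L \<mu> (\<lambda>\<omega>. \<psi> (shift_action G X g \<omega>)) = integral\<^sup>L \<mu> \<psi>"
        using integral_distr[OF act_measurable[OF g] \<psi>_meas] by simp
      show "integrable \<mu> (\<lambda>\<omega>. \<psi> (shift_action G X g \<omega>))"
        using \<psi>_bound act_space[OF g] by (intro integrable_const_bound[of _ Lm] act_meas[OF g] AE_I2) auto
    qed
    have Fn: "finite (F (Suc n))" "\<And>g. g \<in> F (Suc n) \<Longrightarrow> g \<in> carrier G"
      using F_finite[of "Suc n"] F_subset[of "Suc n"] by auto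
    have "integral\<^sup>L \<mu> (avg (Suc n))
        = (\<integral>\<omega>. (\<Sum>g\<in>F (Suc n). indicator (Z k) g * \<psi> (shift_action G X g \<omega>)) \<partial>\<mu>) / real (card (F (Suc n)))"
      by (simp add: avg_def[abs_def])
    also have "(\<integral>\<omega>. (\<Sum>g\<in>F (Suc n). indicator (Z k) g * \<psi> (shift_action G X g \<omega>)) \<partial>\<mu>)
        = (\<Sum>g\<in>F (Suc n). indicator (Z k) g * integral\<^sup>L \<mu> \<psi>)"
      using Fn inv by (subst Bochner_Integration.integral_sum) (auto intro!: sum.cong)
    also have "\<dots> = real (card (F (Suc n) \<inter> Z k)) * integral\<^sup>L \<mu> \<psi>"
      using Fn by (simp add: sum_distrib_right[symmetric] indicator_def sum.If_cases Int_def)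
    finally show ?thesis by simp
  qed
  have \<psi>_int0: "0 \<le> integral\<^sup>L \<mu> \<psi>" using \<psi>_bound by (intro integral_nonneg_AE AE_I2) auto
  have "integral\<^sup>L \<mu> f \<le> integral\<^sup>L \<mu> \<psi> / real (card (F k))"
  proof (rule field_le_epsilon)
    fix \<epsilon> :: real assume \<epsilon>: "\<epsilon> > 0"
    define I where "I = integral\<^sup>L \<mu> \<psi> / real (card (F k))"
    have I: "I \<ge> 0" using \<psi>_int0 by (simp add: I_def)
    define \<eta> where "\<eta> = \<epsilon> / (I + 1)"
    have \<eta>: "\<eta> > 0" "\<eta> * I \<le> \<epsilon>" using \<epsilon> I by (auto simp: \<eta>_def field_simps)
    have "\<forall>\<^sub>F n in sequentially. real (card (F k <#> F n)) \<le> (1 + \<eta>) * real (card (F n))"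
      using Fk F_nonempty[OF k] \<eta> by (intro card_set_mult_le)
    then have "\<forall>\<^sub>F n in sequentially. real (card (F k <#> F (Suc n))) \<le> (1 + \<eta>) * real (card (F (Suc n)))"
      by (rule eventually_compose_filterlim) (rule filterlim_Suc)
    then have "\<forall>\<^sub>F n in sequentially. integral\<^sup>L \<mu> (avg (Suc n)) \<le> (1 + \<eta>) * I"
    proof eventually_elim
      case (elim n)
      have "real (card (F (Suc n) \<inter> Z k)) * real (card (F k)) \<le> real (card (F k <#> F (Suc n)))"
        using card_centers_le[OF k, of "Suc n"] by (metis le_add1 of_nat_le_iff of_nat_mult plus_1_eq_Suc)
      then have "real (card (F (Suc n) \<inter> Z k)) * real (card (F k)) \<le> (1 + \<eta>) * real (card (F (Suc n)))"
        using elim by linarith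
      then have "real (card (F (Suc n) \<inter> Z k)) / real (card (F (Suc n))) \<le> (1 + \<eta>) / real (card (F k))"
        using F_card_pos[OF k] F_card_pos[of "Suc n"] by (simp add: field_simps)
      then have "real (card (F (Suc n) \<inter> Z k)) / real (card (F (Suc n))) * integral\<^sup>L \<mu> \<psi>
          \<le> (1 + \<eta>) / real (card (F k)) * integral\<^sup>L \<mu> \<psi>"
        using \<psi>_int0 by (rule mult_right_mono)
      then show ?case unfolding int_avg by (simp add: I_def)
    qed
    then have "integral\<^sup>L \<mu> f \<le> (1 + \<eta>) * I"
      by (intro tendsto_upperbound[OF int_lim]) auto
    then show "integral\<^sup>L \<mu> f \<le> integral\<^sup>L \<mu> \<psi> / real (card (F k)) + \<epsilon>"
      using \<eta>(2) unfolding I_def[symmetric] by (simp add: algebra_simps)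
  qed
  also have "\<dots> \<le> (H letter (F k) + 2) / real (card (F k))" using \<psi>_int by (intro divide_right_mono) auto
  finally have int_le: "integral\<^sup>L \<mu> f \<le> (H letter (F k) + 2) / real (card (F k))" .
  \<comment> \<open>A crude number of bits per letter; any \<open>l\<close> with
    \<open>card \<Lambda> \<le> 2 ^ l\<close> would do, as the proportion of uncovered sites tends
    to zero.\<close>
  define l where "l = card \<Lambda>"
  have "card \<Lambda> \<le> 2 ^ l" by (simp add: l_def less_imp_le)
  then obtain C where C: "\<And>n s \<omega>. n \<ge> 1 \<Longrightarrow> n < 2 ^ s \<Longrightarrow> \<omega> \<in> carrier G \<rightarrow> \<Lambda> \<Longrightarrow>
      K0 A (map \<omega> (sorted_key_list_of_set \<iota> (F n))) \<le> enat (tile_cost k len l n \<omega> + 2 * s + C)"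
    using tile_complexity[OF k finite_alphabet _ \<kappa> opt, of l len] len(1) unfolding U_def by blast
  define unc where "unc n = real (card (F n) - card (F k) * card (centers k n)) / real (card (F n))" for n
  have unc: "unc \<longlonglongrightarrow> 0" unfolding unc_def by (rule uncovered_tendsto[OF k one])
  define err where "err n = real l * unc n + (2 * (log 2 (real n) + 1) + real C) / real (card (F n))" for n
  have err: "err \<longlonglongrightarrow> 0"
  proof -
    have "(\<lambda>n. inverse (real (card (F n)) / log 2 (real n))) \<longlonglongrightarrow> 0"
      using growth by (rule tendsto_inverse_0_at_top)
    then have g: "(\<lambda>n. log 2 (real n) / real (card (F n))) \<longlonglongrightarrow> 0" by simp
    have c: "(\<lambda>n. (2 + real C) / real (card (F n))) \<longlonglongrightarrow> 0"
      by (rule real_tendsto_divide_at_top[OF tendsto_const card_F])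
    have eq: "err = (\<lambda>n. real l * unc n + (2 * (log 2 (real n) / real (card (F n))) + (2 + real C) / real (card (F n))))"
      by (rule ext) (simp add: err_def add_divide_distrib algebra_simps)
    have "err \<longlonglongrightarrow> real l * 0 + (2 * 0 + 0)"
      unfolding eq by (intro tendsto_intros unc g c)
    then show ?thesis by simp
  qed
  have upper: "mean_complexity \<iota> A \<omega> (F n) \<le> ereal (avg n \<omega> + err n)" if n: "n \<ge> 1" and \<omega>: "\<omega> \<in> X" for n \<omega>
  proof -
    \<comment> \<open>The number of binary digits of \<open>n\<close>: large enough for
      \<open>n < 2 ^ s\<close>, yet at most \<open>log 2 n + 1\<close>.\<close>
    define s where "s = nat \<lfloor>log 2 (real n)\<rfloor> + 1"
    have log0: "0 \<le> log 2 (real n)" using n by simp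
    have s_le: "real s \<le> log 2 (real n) + 1" using log0 by (simp add: s_def)
    have "log 2 (real n) < real s" using log0 unfolding s_def by linarith
    then have "real n < 2 powr real s" using n by (simp add: log_less_iff)
    then have ns: "n < 2 ^ s" by (simp add: powr_realpow)
    have \<omega>\<Lambda>: "\<omega> \<in> carrier G \<rightarrow> \<Lambda>" using \<omega> X_subset by auto
    define c where "c = tile_cost k len l n \<omega> + 2 * s + C"
    have "ereal_of_enat (K0 A (map \<omega> (sorted_key_list_of_set \<iota> (F n)))) \<le> ereal_of_enat (enat c)"
      unfolding c_def ereal_of_enat_le_iff by (rule C[OF n ns \<omega>\<Lambda>])
    then have "mean_complexity \<iota> A \<omega> (F n) \<le> ereal_of_enat (enat c) / ereal (real (card (F n)))"
      unfolding mean_complexity_def using F_card_pos[OF n] by (intro ereal_divide_right_mono) auto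
    also have "\<dots> = ereal (real c / real (card (F n)))" using F_card_pos[OF n] by simp
    also have "real c / real (card (F n)) \<le> avg n \<omega> + err n"
    proof -
      have Fn: "finite (F n)" "F n \<subseteq> carrier G" using F_finite F_subset n by auto
      \<comment> \<open>As \<open>z \<omega>\<close> has the letter
        \<open>\<omega> (f \<otimes> z)\<close> at \<open>f\<close>, the code length of the tile at
        \<open>z\<close> is \<open>\<psi>\<close> evaluated at \<open>z \<omega>\<close>.\<close>
      have "real (\<Sum>z\<in>centers k n. len (\<lambda>f\<in>F k. \<omega> (f \<otimes> z))) = (\<Sum>z\<in>centers k n. \<psi> (shift_action G X z \<omega>))"
        unfolding of_nat_sum
      proof (intro sum.cong refl)
        fix z assume "z \<in> centers k n"
        then have z: "z \<in> carrier G" using Fn by (auto simp: centers_def)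
        have "shift_action G X z \<omega> \<in> X" using act_space[OF z] \<omega> by (simp add: space_\<mu>)
        then have "Y (shift_action G X z \<omega>) = (\<lambda>f\<in>F k. \<omega> (f \<otimes> z))"
          using Y_eq act_eq[OF z \<omega>] Fk by (auto simp: fun_eq_iff restrict_def subset_iff)
        then show "real (len (\<lambda>f\<in>F k. \<omega> (f \<otimes> z))) = \<psi> (shift_action G X z \<omega>)" by (simp add: \<psi>_def)
      qed
      \<comment> \<open>Elements of \<open>F n \<inter> Z k\<close> whose tiles leave
        \<open>F n\<close> are added; their terms are non-negative, and the sum becomes the weighted
        ergodic sum.\<close>
      also have "\<dots> \<le> (\<Sum>z\<in>F n \<inter> Z k. \<psi> (shift_action G X z \<omega>))"
        using Fn \<psi>_bound(1) act_space \<omega> by (intro sum_mono2) (auto simp: centers_def space_\<mu>)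
      also have "\<dots> = (\<Sum>g\<in>F n. indicator (Z k) g * \<psi> (shift_action G X g \<omega>))"
        using Fn by (simp add: indicator_def sum.inter_restrict if_distrib[of "\<lambda>t. t * _"] cong: if_cong)
      finally have 1: "real (\<Sum>z\<in>centers k n. len (\<lambda>f\<in>F k. \<omega> (f \<otimes> z))) \<le> avg n \<omega> * real (card (F n))"
        using F_card_pos[OF n] by (simp add: avg_def)
      have "real c = real (\<Sum>z\<in>centers k n. len (\<lambda>f\<in>F k. \<omega> (f \<otimes> z)))
          + real l * (unc n * real (card (F n))) + 2 * real s + real C"
        using F_card_pos[OF n] by (simp add: c_def tile_cost_def unc_def)
      also have "\<dots> \<le> avg n \<omega> * real (card (F n)) + real l * (unc n * real (card (F n)))
          + 2 * (log 2 (real n) + 1) + real C"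
        by (intro add_mono 1 order_refl) (use s_le in simp)
      finally show ?thesis
        using F_card_pos[OF n] by (simp add: err_def field_simps)
    qed
    finally show ?thesis by simp
  qed
  have "AE \<omega> in \<mu>. asymptotic_complexity \<iota> A F \<omega> \<le> ereal (f \<omega>)"
    using conv AE_space
  proof eventually_elim
    case (elim \<omega>)
    have \<omega>: "\<omega> \<in> X" using elim by (simp add: space_\<mu>)
    have "(\<lambda>n. avg n \<omega>) \<longlonglongrightarrow> f \<omega>" using elim(1) by (rule LIMSEQ_imp_Suc)
    then have "(\<lambda>n. avg n \<omega> + err n) \<longlonglongrightarrow> f \<omega> + 0" by (intro tendsto_add err)
    then have lim: "limsup (\<lambda>n. ereal (avg n \<omega> + err n)) = ereal (f \<omega>)"
      by (intro lim_imp_Limsup) auto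
    have "asymptotic_complexity \<iota> A F \<omega> \<le> limsup (\<lambda>n. ereal (avg n \<omega> + err n))"
      unfolding asymptotic_complexity_def
      by (intro Limsup_mono eventually_mono[OF eventually_ge_at_top[of 1]] upper[OF _ \<omega>])
    then show ?case unfolding lim .
  qed
  then show ?thesis using that[OF int int_le] by blast
qed

text \<open>By the lower bound \<open>f k - h\<close> is non-negative almost everywhere, and its
  mean is at most a quantity tending to zero. Markov's inequality makes the event that
  \<open>f k - h \<ge> \<epsilon>\<close> for every \<open>k\<close> null; off it some
  \<open>f k\<close> bounds the complexity by \<open>h + \<epsilon>\<close>.\<close>

lemma asymptotic_complexity_eq:
  assumes opt: "optimal_decompressor \<Lambda> \<kappa> A" and \<kappa>: "inj_on \<kappa> \<Lambda>"
    and good: "\<And>k. k \<ge> 1 \<Longrightarrow> good_weight G F (indicator (Z k))"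
    and growth: "filterlim (\<lambda>n. real (card (F n)) / log 2 (real n)) at_top sequentially"
    and one: "\<And>n. n \<ge> 1 \<Longrightarrow> \<one> \<in> F n"
    and erg: "ergodic_action G \<mu> (shift_action G X)" and right: "right_folner G F"
  shows "AE \<omega> in \<mu>. asymptotic_complexity \<iota> A F \<omega> = ereal (hrate letter)"
proof -
  \<comment> \<open>From \<open>n = 2\<close> on, \<open>log 2 n \<ge> 1\<close>, so
    \<open>card (F n)\<close> dominates the quotient that tends to infinity.\<close>
  have card_F: "filterlim (\<lambda>n. real (card (F n))) at_top sequentially"
  proof (rule filterlim_at_top_mono[OF growth])
    show "\<forall>\<^sub>F n in sequentially. real (card (F n)) / log 2 (real n) \<le> real (card (F n))"
      using eventually_ge_at_top[of 2]
    proof eventually_elim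
      case (elim n)
      then have "1 \<le> log 2 (real n)" by simp
      then show ?case by (simp add: divide_le_eq mult_le_cancel_left1)
    qed
  qed
  define h where "h = hrate letter"
  have "\<forall>k. \<exists>f. integrable \<mu> f \<and> integral\<^sup>L \<mu> f \<le> (H letter (F (Suc k)) + 2) / real (card (F (Suc k))) \<and>
      (AE \<omega> in \<mu>. asymptotic_complexity \<iota> A F \<omega> \<le> ereal (f \<omega>))"
    using upper_function[OF opt \<kappa> good growth card_F one] by (metis le_add1 plus_1_eq_Suc)
  then obtain f where f: "\<And>k. integrable \<mu> (f k)"
    "\<And>k. integral\<^sup>L \<mu> (f k) \<le> (H letter (F (Suc k)) + 2) / real (card (F (Suc k)))"
    "\<And>k. AE \<omega> in \<mu>. asymptotic_complexity \<iota> A F \<omega> \<le> ereal (f k \<omega>)"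
    by metis
  have lower: "AE \<omega> in \<mu>. ereal h \<le> asymptotic_complexity \<iota> A F \<omega>"
    unfolding h_def by (rule asymptotic_complexity_ge[OF erg right card_F])
  have ub: "AE \<omega> in \<mu>. \<forall>k. asymptotic_complexity \<iota> A F \<omega> \<le> ereal (f k \<omega>)"
    unfolding AE_all_countable using f(3) by blast
  have fh: "AE \<omega> in \<mu>. 0 \<le> f k \<omega> - h" for k
    using lower f(3)[of k]
  proof eventually_elim
    case (elim \<omega>)
    then have "ereal h \<le> ereal (f k \<omega>)" by (rule order_trans)
    then show ?case by simp
  qed
  have lim: "(\<lambda>k. (H letter (F (Suc k)) + 2) / real (card (F (Suc k))) - h) \<longlonglongrightarrow> 0"
  proof -
    have "(\<lambda>n. H letter (F n) / real (card (F n)) + 2 / real (card (F n)) - h) \<longlonglongrightarrow> h + 0 - h"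
      unfolding h_def by (intro tendsto_intros hrate_tendsto[OF simple_letter] real_tendsto_divide_at_top[OF tendsto_const card_F])
    then have "(\<lambda>n. (H letter (F n) + 2) / real (card (F n)) - h) \<longlonglongrightarrow> 0" by (simp add: add_divide_distrib)
    then show ?thesis by (rule LIMSEQ_Suc)
  qed
  define E where "E \<epsilon> k = {\<omega> \<in> space \<mu>. f k \<omega> - h \<ge> \<epsilon>}" for \<epsilon> k
  have E: "E \<epsilon> k \<in> sets \<mu>" for \<epsilon> k
    using borel_measurable_integrable[OF f(1)[of k]] unfolding E_def by measurable
  have null: "(\<Inter>k. E \<epsilon> k) \<in> null_sets \<mu>" if \<epsilon>: "\<epsilon> > 0" for \<epsilon>
  proof -
    have sets: "(\<Inter>k. E \<epsilon> k) \<in> sets \<mu>" using E by auto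
    have "prob (\<Inter>k. E \<epsilon> k) \<le> ((H letter (F (Suc k)) + 2) / real (card (F (Suc k))) - h) / \<epsilon>" for k
    proof -
      have "prob (\<Inter>k. E \<epsilon> k) \<le> prob (E \<epsilon> k)" using E by (intro finite_measure_mono) auto
      also have "\<dots> \<le> (\<integral>\<omega>. f k \<omega> - h \<partial>\<mu>) / \<epsilon>"
        unfolding E_def using f(1) \<epsilon> fh by (intro integral_Markov_inequality_measure[where A = "space \<mu>"]) auto
      also have "(\<integral>\<omega>. f k \<omega> - h \<partial>\<mu>) = integral\<^sup>L \<mu> (f k) - h"
        using f(1) prob_space by simp
      also have "(integral\<^sup>L \<mu> (f k) - h) / \<epsilon> \<le> ((H letter (F (Suc k)) + 2) / real (card (F (Suc k))) - h) / \<epsilon>"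
        using f(2)[of k] \<epsilon> by (intro divide_right_mono) auto
      finally show ?thesis .
    qed
    then have "prob (\<Inter>k. E \<epsilon> k) \<le> 0 / \<epsilon>"
      by (intro LIMSEQ_le_const[OF tendsto_divide[OF lim tendsto_const]]) (use \<epsilon> in auto)
    then have "prob (\<Inter>k. E \<epsilon> k) = 0" by (intro antisym measure_nonneg) simp
    then show ?thesis using sets by (intro null_setsI) (simp_all only: emeasure_eq_measure ennreal_0)
  qed
  have "AE \<omega> in \<mu>. \<omega> \<notin> (\<Inter>k. E (inverse (real (Suc m))) k)" for m
    by (rule AE_not_in[OF null]) simp
  then have "AE \<omega> in \<mu>. \<forall>m. \<omega> \<notin> (\<Inter>k. E (inverse (real (Suc m))) k)"
    unfolding AE_all_countable by blast
  then show ?thesis using lower ub AE_space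
  proof eventually_elim
    case (elim \<omega>)
    have "asymptotic_complexity \<iota> A F \<omega> \<le> ereal h"
    proof (rule ereal_le_epsilon2)
      fix \<epsilon> :: real assume "0 < \<epsilon>"
      then obtain m where m: "inverse (real (Suc m)) < \<epsilon>" using reals_Archimedean by blast
      obtain k where "\<omega> \<notin> E (inverse (real (Suc m))) k" using elim(1) by blast
      then have "f k \<omega> \<le> h + \<epsilon>" using m elim(4) by (simp add: E_def)
      then have "ereal (f k \<omega>) \<le> ereal h + ereal \<epsilon>" by simp
      then show "asymptotic_complexity \<iota> A F \<omega> \<le> ereal h + ereal \<epsilon>" using elim(3) order_trans by blast
    qed
    then show ?case using elim(2) by (simp add: h_def)
  qed
qed

end

theorem theorem3p1:
  fixes G :: "('g, 'b) monoid_scheme"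
    and \<iota> :: "'g \<Rightarrow> nat"
    and F Z :: "nat \<Rightarrow> 'g set"
    and \<Lambda> :: "'l set"
    and \<kappa> :: "'l \<Rightarrow> nat"
    and A :: "bool list \<Rightarrow> 'l list option"
    and X :: "('g \<Rightarrow> 'l) set"
    and \<mu> :: "('g \<Rightarrow> 'l) measure"
  assumes "computable_group G \<iota>" and "infinite (carrier G)"
    and "folner_monotiling G F Z"
    and "regular_monotiling G F Z"
    and "symmetric_monotiling G Z"
    and "computable_monotiling G \<iota> F Z"
    and "finite \<Lambda>" and "indexing \<Lambda> \<kappa>"
    and "optimal_decompressor \<Lambda> \<kappa> A"
    and "subshift G \<Lambda> X"
    and "sets \<mu> = sets (borel_of (subtopology (full_shift G \<Lambda>) X))"
    and "pmp_system G \<mu> (shift_action G X)"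
    and "ergodic_action G \<mu> (shift_action G X)"
  shows "AE \<omega> in \<mu>. asymptotic_complexity \<iota> A F \<omega> = KS_entropy \<mu> (shift_action G X) F"
proof -
  interpret group G using assms(1) by (simp add: computable_group_def)
  interpret subshift_system G \<iota> F Z \<Lambda> X \<mu>
    by unfold_locales (use assms in auto)
  have "inj_on \<kappa> \<Lambda>" using assms(8) by (simp add: indexing_def)
  then show ?thesis
    unfolding KS_entropy_letter
    using assms(4,9,13) by (intro asymptotic_complexity_eq) (auto simp: regular_monotiling_def)
qed

end
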